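(* Let $\tau>0$. As $\lambda\to\infty$ we have $$\left(\varphi^0(\tau),\ \varphi^{\lambda/\tau}(\tau)-\lambda\right)\Rightarrow(\xi_0+\xi_1,\ \xi_0+\xi_2),$$ where $\xi_0,\xi_1,\xi_2$ are independent mean zero normal random variables with variances $\tau,\tau/2,\tau/2$, respectively. In particular, for $\theta\in[0,2\pi)$ and $k\to\infty$ along the integers we have $$\mathrm{Sch}_\tau[0,2\pi k+\theta]-k\Rightarrow\left\lfloor\frac{\xi_0+\xi_2+\theta}{2\pi}\right\rfloor-\left\lfloor\frac{\xi_0+\xi_1}{2\pi}\right\rfloor.$$
   Context: Let $\mathcal B,\mathcal B_2,\mathcal B_3$ be independent standard real Brownian motions, $\mathcal W=\frac1{\sqrt2}(\mathcal B_2+i\mathcal B_3)$, and let $\varphi^\lambda(t)$, $\lambda\in\mathbb R$, be the solutions, all driven by the same $\mathcal B,\mathcal W$, of $d\varphi^\lambda=\lambda\,dt+d\mathcal B+\mathrm{Re}[e^{-i\varphi^\lambda}d\mathcal W]$, $\varphi^\lambda(0)=0$ (in the version for which $\lambda\mapsto\varphi^\lambda(t)$ is strictly increasing and real-analytic for $t>0$). $\mathrm{Sch}_\tau=\{\lambda\in\mathbb R:\varphi^{\lambda/\tau}(\tau)\in2\pi\mathbb Z\}$, and $\mathrm{Sch}_\tau[a,b]$ denotes the number of points of $\mathrm{Sch}_\tau$ in $[a,b]$. $\Rightarrow$ denotes convergence in distribution. *)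

theory Defs
  imports "HOL-Probability.Probability"
begin

definition standard_brownian_motion :: "'a measure \<Rightarrow> (real \<Rightarrow> 'a \<Rightarrow> real) \<Rightarrow> bool" where
  "standard_brownian_motion M B \<longleftrightarrow>
     (\<forall>t\<ge>0. B t \<in> borel_measurable M) \<and>
     (AE \<omega> in M. B 0 \<omega> = 0) \<and>
     (AE \<omega> in M. continuous_on {0..} (\<lambda>t. B t \<omega>)) \<and>
     (\<forall>s t. 0 \<le> s \<and> s < t \<longrightarrow>
        distributed M lborel (\<lambda>\<omega>. B t \<omega> - B s \<omega>) (normal_density 0 (sqrt (t - s)))) \<and>
     (\<forall>(n::nat) ts. 0 \<le> ts 0 \<and> (\<forall>i<n. ts i < ts (Suc i)) \<longrightarrow>
        prob_space.indep_vars M (\<lambda>_. borel) (\<lambda>i \<omega>. B (ts (Suc i)) \<omega> - B (ts i) \<omega>) {..<n})"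

text \<open>Independence of the three processes is independence of their paths, as random elements of
  the product space over the time set.\<close>

definition independent_processes3 ::
    "'a measure \<Rightarrow> (real \<Rightarrow> 'a \<Rightarrow> real) \<Rightarrow> (real \<Rightarrow> 'a \<Rightarrow> real) \<Rightarrow> (real \<Rightarrow> 'a \<Rightarrow> real) \<Rightarrow> bool" where
  "independent_processes3 M X Y Z \<longleftrightarrow>
     prob_space.indep_vars M (\<lambda>_. PiM {0..} (\<lambda>_. borel))
       (\<lambda>i \<omega>. \<lambda>t\<in>{0..}. ([X, Y, Z] ! i) t \<omega>) {..<3::nat}"

definition adapted :: "(real \<Rightarrow> 'a measure) \<Rightarrow> (real \<Rightarrow> 'a \<Rightarrow> 'b::topological_space) \<Rightarrow> bool" where
  "adapted F X \<longleftrightarrow> (\<forall>t\<ge>0. X t \<in> borel_measurable (F t))"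

text \<open>Only the part of the filtration with nonnegative index matters.\<close>

definition filtration_on :: "'a measure \<Rightarrow> (real \<Rightarrow> 'a measure) \<Rightarrow> bool" where
  "filtration_on M F \<longleftrightarrow> filtration (space M) F \<and> (\<forall>t. subalgebra M (F t))"

text \<open>The joint increments after time \<open>s\<close> are independent of the past \<open>F s\<close>, so that stochastic
  integrals of \<open>F\<close>-adapted integrands make sense.  For the (augmented) filtration generated by
  three independent Brownian motions this holds automatically.\<close>

definition driving_noise ::
    "'a measure \<Rightarrow> (real \<Rightarrow> 'a measure) \<Rightarrow>
     (real \<Rightarrow> 'a \<Rightarrow> real) \<Rightarrow> (real \<Rightarrow> 'a \<Rightarrow> real) \<Rightarrow> (real \<Rightarrow> 'a \<Rightarrow> real) \<Rightarrow> bool" where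
  "driving_noise M F B B2 B3 \<longleftrightarrow>
     standard_brownian_motion M B \<and> standard_brownian_motion M B2 \<and>
     standard_brownian_motion M B3 \<and> independent_processes3 M B B2 B3 \<and>
     adapted F B \<and> adapted F B2 \<and> adapted F B3 \<and>
     (\<forall>s t. 0 \<le> s \<and> s < t \<longrightarrow>
        prob_space.indep_set M (sets (F s))
          (sets (vimage_algebra (space M)
             (\<lambda>\<omega>. (B t \<omega> - B s \<omega>, B2 t \<omega> - B2 s \<omega>, B3 t \<omega> - B3 s \<omega>)) borel)))"

definition complex_brownian ::
    "(real \<Rightarrow> 'a \<Rightarrow> real) \<Rightarrow> (real \<Rightarrow> 'a \<Rightarrow> real) \<Rightarrow> real \<Rightarrow> 'a \<Rightarrow> complex" where
  "complex_brownian B2 B3 t \<omega> =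
     (1 / complex_of_real (sqrt 2)) * (complex_of_real (B2 t \<omega>) + \<i> * complex_of_real (B3 t \<omega>))"

text \<open>Elementary integrands on \<open>[0,T]\<close>: the value on the interval from \<open>ts i\<close> to \<open>ts (Suc i)\<close> is
  the bounded, \<open>F (ts i)\<close>-measurable random variable \<open>e i\<close>.\<close>

definition elementary_data ::
    "(real \<Rightarrow> 'a measure) \<Rightarrow> real \<Rightarrow> nat \<Rightarrow> (nat \<Rightarrow> real) \<Rightarrow> (nat \<Rightarrow> 'a \<Rightarrow> complex) \<Rightarrow> bool" where
  "elementary_data F T n ts e \<longleftrightarrow>
     ts 0 = 0 \<and> ts n = T \<and> (\<forall>i<n. ts i < ts (Suc i)) \<and>
     (\<forall>i<n. e i \<in> borel_measurable (F (ts i))) \<and>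
     (\<exists>C. \<forall>i<n. \<forall>\<omega>\<in>space (F (ts i)). norm (e i \<omega>) \<le> C)"

definition elementary_process ::
    "nat \<Rightarrow> (nat \<Rightarrow> real) \<Rightarrow> (nat \<Rightarrow> 'a \<Rightarrow> complex) \<Rightarrow> real \<Rightarrow> 'a \<Rightarrow> complex" where
  "elementary_process n ts e s \<omega> = (\<Sum>i<n. e i \<omega> * indicator {ts i<..ts (Suc i)} s)"

definition elementary_integral ::
    "(real \<Rightarrow> 'a \<Rightarrow> complex) \<Rightarrow> nat \<Rightarrow> (nat \<Rightarrow> real) \<Rightarrow> (nat \<Rightarrow> 'a \<Rightarrow> complex) \<Rightarrow> 'a \<Rightarrow> complex" where
  "elementary_integral W n ts e \<omega> = (\<Sum>i<n. e i \<omega> * (W (ts (Suc i)) \<omega> - W (ts i) \<omega>))"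

definition progressively_measurable ::
    "(real \<Rightarrow> 'a measure) \<Rightarrow> (real \<Rightarrow> 'a \<Rightarrow> complex) \<Rightarrow> bool" where
  "progressively_measurable F H \<longleftrightarrow>
     (\<forall>t\<ge>0. (\<lambda>(s, \<omega>). H s \<omega>) \<in> borel_measurable (restrict_space borel {0..t} \<Otimes>\<^sub>M F t))"

text \<open>\<open>J\<close> is (a version of) the Ito integral of \<open>H\<close> with respect to \<open>W\<close> over \<open>[0,T]\<close>: elementary
  processes converge to \<open>H\<close> in \<open>L\<^sup>2\<close> of time and probability, and their integrals converge to \<open>J\<close>
  in \<open>L\<^sup>2\<close> of probability.  By the Ito isometry \<open>J\<close> is unique up to null sets.\<close>

definition ito_integral ::
    "'a measure \<Rightarrow> (real \<Rightarrow> 'a measure) \<Rightarrow> (real \<Rightarrow> 'a \<Rightarrow> complex) \<Rightarrow> (real \<Rightarrow> 'a \<Rightarrow> complex) \<Rightarrow>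
     real \<Rightarrow> ('a \<Rightarrow> complex) \<Rightarrow> bool" where
  "ito_integral M F W H T J \<longleftrightarrow>
     progressively_measurable F H \<and> J \<in> borel_measurable M \<and>
     (\<exists>n ts e.
        (\<forall>m::nat. elementary_data F T (n m) (ts m) (e m)) \<and>
        (\<lambda>m. \<integral>\<^sup>+\<omega>. (\<integral>\<^sup>+s\<in>{0..T}.
            ennreal ((norm (H s \<omega> - elementary_process (n m) (ts m) (e m) s \<omega>))\<^sup>2) \<partial>lborel) \<partial>M)
          \<longlonglongrightarrow> 0 \<and>
        (\<lambda>m. \<integral>\<^sup>+\<omega>. ennreal ((norm (J \<omega> - elementary_integral W (n m) (ts m) (e m) \<omega>))\<^sup>2) \<partial>M)
          \<longlonglongrightarrow> 0)"

definition phase_solution ::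
    "'a measure \<Rightarrow> (real \<Rightarrow> 'a measure) \<Rightarrow> (real \<Rightarrow> 'a \<Rightarrow> real) \<Rightarrow> (real \<Rightarrow> 'a \<Rightarrow> complex) \<Rightarrow>
     real \<Rightarrow> (real \<Rightarrow> 'a \<Rightarrow> real) \<Rightarrow> bool" where
  "phase_solution M F B W l \<phi> \<longleftrightarrow>
     adapted F \<phi> \<and>
     (\<forall>\<omega>\<in>space M. \<phi> 0 \<omega> = 0 \<and> continuous_on {0..} (\<lambda>t. \<phi> t \<omega>)) \<and>
     (\<forall>t\<ge>0. \<exists>J. ito_integral M F W (\<lambda>s \<omega>. exp (- \<i> * complex_of_real (\<phi> s \<omega>))) t J \<and>
        (AE \<omega> in M. \<phi> t \<omega> = l * t + B t \<omega> + Re (J \<omega>)))"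

definition real_analytic :: "(real \<Rightarrow> real) \<Rightarrow> bool" where
  "real_analytic f \<longleftrightarrow>
     (\<forall>x. \<exists>r>0. \<exists>a::nat \<Rightarrow> real. \<forall>y. \<bar>y - x\<bar> < r \<longrightarrow> (\<lambda>n. a n * (y - x) ^ n) sums f y)"

definition phase_family ::
    "'a measure \<Rightarrow> (real \<Rightarrow> 'a measure) \<Rightarrow> (real \<Rightarrow> 'a \<Rightarrow> real) \<Rightarrow> (real \<Rightarrow> 'a \<Rightarrow> complex) \<Rightarrow>
     (real \<Rightarrow> real \<Rightarrow> 'a \<Rightarrow> real) \<Rightarrow> bool" where
  "phase_family M F B W \<phi> \<longleftrightarrow>
     (\<forall>l. phase_solution M F B W l (\<phi> l)) \<and>
     (\<forall>\<omega>\<in>space M. \<forall>t>0. strict_mono (\<lambda>l. \<phi> l t \<omega>) \<and> real_analytic (\<lambda>l. \<phi> l t \<omega>))"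

definition Sch :: "(real \<Rightarrow> real \<Rightarrow> 'a \<Rightarrow> real) \<Rightarrow> real \<Rightarrow> 'a \<Rightarrow> real set" where
  "Sch \<phi> \<tau> \<omega> = {l. \<exists>n::int. \<phi> (l / \<tau>) \<tau> \<omega> = 2 * pi * of_int n}"

text \<open>For a strictly increasing phase function the set counted here is finite, so that \<open>card\<close> is
  the number of points.\<close>

definition Sch_count :: "(real \<Rightarrow> real \<Rightarrow> 'a \<Rightarrow> real) \<Rightarrow> real \<Rightarrow> real \<Rightarrow> real \<Rightarrow> 'a \<Rightarrow> nat" where
  "Sch_count \<phi> \<tau> a b \<omega> = card (Sch \<phi> \<tau> \<omega> \<inter> {a..b})"

text \<open>Convergence in distribution of random variables along an arbitrary filter and with values in
  an arbitrary topological space; \<open>weak_conv_m\<close> only covers sequences of real random variables,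
  where the two notions agree (see below).\<close>

definition converges_in_distribution ::
    "'a measure \<Rightarrow> ('i \<Rightarrow> 'a \<Rightarrow> 'c::topological_space) \<Rightarrow> 'b measure \<Rightarrow> ('b \<Rightarrow> 'c) \<Rightarrow> 'i filter \<Rightarrow> bool"
  where
  "converges_in_distribution M X N Y Fil \<longleftrightarrow>
     (\<forall>i. X i \<in> borel_measurable M) \<and> Y \<in> borel_measurable N \<and>
     (\<forall>f::'c \<Rightarrow> real. continuous_on UNIV f \<and> bounded (range f) \<longrightarrow>
        ((\<lambda>i. \<integral>\<omega>. f (X i \<omega>) \<partial>M) \<longlongrightarrow> (\<integral>\<omega>. f (Y \<omega>) \<partial>N)) Fil)"

lemma converges_in_distribution_iff_weak_conv_m:
  fixes X :: "nat \<Rightarrow> 'a \<Rightarrow> real" and Y :: "'b \<Rightarrow> real"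
  assumes M: "prob_space M" and N: "prob_space N"
    and X: "\<And>i. X i \<in> borel_measurable M" and Y: "Y \<in> borel_measurable N"
  shows "converges_in_distribution M X N Y sequentially \<longleftrightarrow>
    weak_conv_m (\<lambda>i. distr M borel (X i)) (distr N borel Y)"
proof -
  interpret M: prob_space M by fact
  interpret N: prob_space N by fact
  have dX: "real_distribution (distr M borel (X i))" for i
    using X by (rule M.real_distribution_distr)
  have dY: "real_distribution (distr N borel Y)"
    using Y by (rule N.real_distribution_distr)
  have iX: "(\<integral>x. f x \<partial>distr M borel (X i)) = (\<integral>\<omega>. f (X i \<omega>) \<partial>M)"
    and iY: "(\<integral>x. f x \<partial>distr N borel Y) = (\<integral>\<omega>. f (Y \<omega>) \<partial>N)"
    if "continuous_on UNIV f" for f :: "real \<Rightarrow> real" and i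
    using that X Y by (auto intro!: integral_distr borel_measurable_continuous_onI)
  show ?thesis
  proof
    assume L: "converges_in_distribution M X N Y sequentially"
    show "weak_conv_m (\<lambda>i. distr M borel (X i)) (distr N borel Y)"
    proof (rule integral_bdd_continuous_conv_imp_weak_conv[OF dX dY])
      fix f :: "real \<Rightarrow> real"
      assume f: "\<And>x. isCont f x" "\<And>x. \<bar>f x\<bar> \<le> 1"
      have c: "continuous_on UNIV f" using f(1) by (simp add: continuous_on_eq_continuous_at)
      have "bounded (range f)" using f(2) by (auto simp: bounded_iff)
      then show "(\<lambda>n. integral\<^sup>L (distr M borel (X n)) f) \<longlonglongrightarrow> integral\<^sup>L (distr N borel Y) f"
        using L c unfolding converges_in_distribution_def by (simp add: iX[OF c] iY[OF c])
    qed
  next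
    assume R: "weak_conv_m (\<lambda>i. distr M borel (X i)) (distr N borel Y)"
    show "converges_in_distribution M X N Y sequentially"
      unfolding converges_in_distribution_def
    proof (intro conjI allI impI X Y)
      fix f :: "real \<Rightarrow> real"
      assume f: "continuous_on UNIV f \<and> bounded (range f)"
      then obtain K where K: "\<And>x. norm (f x) \<le> K" by (auto simp: bounded_iff)
      have c: "\<And>x. isCont f x" using f by (simp add: continuous_on_eq_continuous_at)
      show "(\<lambda>i. \<integral>\<omega>. f (X i \<omega>) \<partial>M) \<longlonglongrightarrow> (\<integral>\<omega>. f (Y \<omega>) \<partial>N)"
        using weak_conv_imp_integral_bdd_continuous_conv[OF dX dY R c K] f
        by (simp add: iX iY)
    qed
  qed
qed

end

theory Submission
  imports Defs
begin

text \<open>The two phases are \<open>\<phi>\<^sup>0(\<tau>) = B(\<tau>) + Re J\<^sub>0\<close> and \<open>\<phi>\<^bsup>\<lambda>/\<tau>\<^esup>(\<tau>) - \<lambda> = B(\<tau>) + Re J\<^sub>\<lambda>\<close>, where \<open>J\<^sub>0\<close>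
  and \<open>J\<^sub>\<lambda>\<close> are stochastic integrals, over \<open>[0, \<tau>]\<close> and with respect to \<open>W\<close>, of the unimodular processes
  \<open>exp (-i \<phi>\<^sup>0)\<close> and \<open>exp (-i \<phi>\<^bsup>\<lambda>/\<tau>\<^esup>)\<close>.  Each real part has quadratic variation \<open>\<tau> / 2\<close> and is uncorrelated
  with \<open>B\<close>; the covariation of the two real parts is half the time integral of the cosine of the phase
  difference.  This difference rotates at speed of order \<open>\<lambda>\<close>, so the integral vanishes in the limit, and
  \<open>B(\<tau>)\<close>, \<open>Re J\<^sub>0\<close>, \<open>Re J\<^sub>\<lambda>\<close> become independent Gaussians with the variances of \<open>\<xi>\<^sub>0\<close>, \<open>\<xi>\<^sub>1\<close>, \<open>\<xi>\<^sub>2\<close>.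

  The argument is carried out with characteristic functions and without Ito's formula.  For integrands
  that are constant on the intervals of a grid, the exponential of \<open>i\<close> times a stochastic integral,
  compensated by half its quadratic variation, has expectation exactly one
  (\<open>exponential_martingale\<close>).  By the Ito isometry, in the form of the stability estimate
  \<open>ito_limit_stable\<close>, Riemann sums on the same grid converge to both stochastic integrals
  (\<open>riemann_sums_tendsto_ito\<close>), and increments of a stochastic integral over a time \<open>h\<close> are of size
  \<open>sqrt h\<close>.  The latter bounds the oscillating integral: shifting time by half a period of the drift
  reverses the sign of the exponential up to such an increment (\<open>phase_difference_oscillates\<close>).
  Together they give an explicit error bound for the joint characteristic function
  (\<open>phase_characteristic_function\<close>).

  Convergence of characteristic functions of pairs is turned into convergence in distribution by using
  Levy's one-dimensional theorem twice, with weights (\<open>joint_levy_continuity\<close>).  Finally, by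
  monotonicity and continuity of the phase in the spectral parameter, the counting variable is a
  difference of a floor and a ceiling of the two phases divided by \<open>2 \<pi>\<close>, and the continuous mapping
  theorem (\<open>continuous_mapping_off_zeros\<close>) applies because sums of the Gaussians almost surely avoid
  the jumps.\<close>

section \<open>Convergence in distribution of pairs\<close>

lemma integrable_prob_bounded:
  fixes f :: "'a \<Rightarrow> 'b::{banach, second_countable_topology}"
  assumes "prob_space P" "f \<in> borel_measurable P" "\<And>x. norm (f x) \<le> D"
  shows "integrable P f"
  using assms by (intro finite_measure.integrable_const_bound[where B=D]) (auto simp: prob_space_def)

text \<open>Levy's continuity theorem for measures with bounded densities: after normalisation they are
  probability measures, to which the unweighted theorem applies.  Weights are what makes the
  one-dimensional theorem usable for pairs.\<close>

lemma weighted_levy_continuity: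
  fixes X :: "nat \<Rightarrow> 'a \<Rightarrow> real" and U :: "'b \<Rightarrow> real"
    and w :: "nat \<Rightarrow> 'a \<Rightarrow> real" and v :: "'b \<Rightarrow> real"
  assumes "prob_space M" "prob_space N"
    and X[measurable]: "\<And>n. X n \<in> borel_measurable M" and U[measurable]: "U \<in> borel_measurable N"
    and w[measurable]: "\<And>n. w n \<in> borel_measurable M" and v[measurable]: "v \<in> borel_measurable N"
    and wb: "\<And>n x. 1 \<le> w n x" "\<And>n x. w n x \<le> C" and vb: "\<And>x. 1 \<le> v x" "\<And>x. v x \<le> C"
    and char: "\<And>t. (\<lambda>n. \<integral>x. w n x * iexp (t * X n x) \<partial>M) \<longlonglongrightarrow> (\<integral>x. v x * iexp (t * U x) \<partial>N)"
    and u: "continuous_on UNIV u" "\<And>x::real. \<bar>u x :: real\<bar> \<le> K"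
  shows "(\<lambda>n. \<integral>x. w n x * u (X n x) \<partial>M) \<longlonglongrightarrow> (\<integral>x. v x * u (U x) \<partial>N)"
proof -
  \<comment> \<open>Dividing a weight by its total mass gives a probability measure whose characteristic function and
    integrals are the weighted ones, up to that mass.  The lower bound \<open>1\<close> keeps the mass away from zero.\<close>
  have main: "prob_space (density P (\<lambda>x. ennreal (z x / integral\<^sup>L P z)))"
      "1 \<le> integral\<^sup>L P z"
      "char (distr (density P (\<lambda>x. ennreal (z x / integral\<^sup>L P z))) borel Z) t
          = (\<integral>x. z x * iexp (t * Z x) \<partial>P) / complex_of_real (integral\<^sup>L P z)"
      "(\<integral>x. u x \<partial>distr (density P (\<lambda>x. ennreal (z x / integral\<^sup>L P z))) borel Z)
          = (\<integral>x. z x * u (Z x) \<partial>P) / integral\<^sup>L P z"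
    if "prob_space P" and Z[measurable]: "Z \<in> borel_measurable P"
        and z[measurable]: "z \<in> borel_measurable P"
      and zb: "\<And>x. 1 \<le> z x" "\<And>x. z x \<le> C" for P :: "'c measure" and Z z t
  proof -
    interpret P: prob_space P by fact
    have um[measurable]: "u \<in> borel_measurable borel" using u(1) by (rule borel_measurable_continuous_onI)
    have zi: "integrable P z"
      by (rule P.integrable_const_bound[where B=C])
          (use zb in \<open>auto intro!: AE_I2 simp: abs_if split: if_splits, smt (verit, best)\<close>)
    have "(\<integral>x. 1 \<partial>P) \<le> integral\<^sup>L P z" using zi zb by (intro integral_mono) auto
    then show m: "1 \<le> integral\<^sup>L P z" by (simp add: P.prob_space)
    have nn: "0 \<le> z x / integral\<^sup>L P z" for x using m zb[of x] by auto
    have "(\<integral>\<^sup>+x. ennreal (z x / integral\<^sup>L P z) \<partial>P) = ennreal (\<integral>x. z x / integral\<^sup>L P z \<partial>P)"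
      using zi nn by (intro nn_integral_eq_integral) auto
    also have "\<dots> = 1" using m by simp
    finally show "prob_space (density P (\<lambda>x. ennreal (z x / integral\<^sup>L P z)))"
      by (intro prob_spaceI) (simp add: emeasure_density cong: nn_integral_cong)
    show "char (distr (density P (\<lambda>x. ennreal (z x / integral\<^sup>L P z))) borel Z) t
        = (\<integral>x. z x * iexp (t * Z x) \<partial>P) / complex_of_real (integral\<^sup>L P z)"
      unfolding char_def using nn
      by (subst integral_distr) (auto simp: integral_density scaleR_conv_of_real simp flip: integral_divide_zero)
    show "(\<integral>x. u x \<partial>distr (density P (\<lambda>x. ennreal (z x / integral\<^sup>L P z))) borel Z)
        = (\<integral>x. z x * u (Z x) \<partial>P) / integral\<^sup>L P z"
      using nn
      by (subst integral_distr) (auto simp: integral_density simp flip: integral_divide_zero)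
  qed
  note mM = main[OF assms(1) X w wb] and mN = main[OF assms(2) U v vb]
  have "(\<lambda>n. \<integral>x. complex_of_real (w n x) \<partial>M) \<longlonglongrightarrow> (\<integral>x. complex_of_real (v x) \<partial>N)"
    using char[of 0] by simp
  then have "(\<lambda>n. complex_of_real (integral\<^sup>L M (w n))) \<longlonglongrightarrow> complex_of_real (integral\<^sup>L N v)"
    by simp
  then have mass: "(\<lambda>n. integral\<^sup>L M (w n)) \<longlonglongrightarrow> integral\<^sup>L N v" by (simp add: tendsto_of_real_iff)
  define \<mu> where "\<mu> n = distr (density M (\<lambda>x. ennreal (w n x / integral\<^sup>L M (w n)))) borel (X n)" for n
  define \<nu> where "\<nu> = distr (density N (\<lambda>x. ennreal (v x / integral\<^sup>L N v))) borel U"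
  have d\<mu>: "real_distribution (\<mu> n)" for n
    unfolding \<mu>_def by (intro prob_space.real_distribution_distr mM(1)) auto
  have d\<nu>: "real_distribution \<nu>"
    unfolding \<nu>_def by (intro prob_space.real_distribution_distr mN(1)) auto
  have "weak_conv_m \<mu> \<nu>"
  proof (rule levy_continuity[OF d\<mu> d\<nu>])
    show "(\<lambda>n. char (\<mu> n) t) \<longlonglongrightarrow> char \<nu> t" for t
      unfolding \<mu>_def \<nu>_def mM(3) mN(3)
      using mN(2) by (intro tendsto_divide char tendsto_of_real mass) auto
  qed
  then have "(\<lambda>n. integral\<^sup>L (\<mu> n) u) \<longlonglongrightarrow> integral\<^sup>L \<nu> u"
    using u by (intro weak_conv_imp_integral_bdd_continuous_conv[OF d\<mu> d\<nu>, where B=K])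
      (auto simp: continuous_on_eq_continuous_at)
  then have "(\<lambda>n. integral\<^sup>L M (w n) * integral\<^sup>L (\<mu> n) u) \<longlonglongrightarrow> integral\<^sup>L N v * integral\<^sup>L \<nu> u"
    by (intro tendsto_mult mass)
  moreover have "integral\<^sup>L M (w n) * integral\<^sup>L (\<mu> n) u = (\<integral>x. w n x * u (X n x) \<partial>M)" for n
    unfolding \<mu>_def mM(4) using mM(2)[of n] by auto
  moreover have "integral\<^sup>L N v * integral\<^sup>L \<nu> u = (\<integral>x. v x * u (U x) \<partial>N)"
    unfolding \<nu>_def mN(4) using mN(2) by auto
  ultimately show ?thesis by simp
qed

text \<open>The one-dimensional theorem is used twice.  Weighting by a trigonometric function of \<open>Y\<close> and
  varying the frequency of \<open>X\<close> gives convergence for an arbitrary test function of \<open>X\<close> times a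
  trigonometric function of \<open>Y\<close>; weighting by the test function of \<open>X\<close> then frees the second factor.\<close>

lemma joint_char_imp_product_test_functions:
  fixes X Y :: "nat \<Rightarrow> 'a \<Rightarrow> real" and U V :: "'b \<Rightarrow> real"
  assumes pM: "prob_space M" and pN: "prob_space N"
    and X[measurable]: "\<And>n. X n \<in> borel_measurable M" and Y[measurable]: "\<And>n. Y n \<in> borel_measurable M"
    and U[measurable]: "U \<in> borel_measurable N" and V[measurable]: "V \<in> borel_measurable N"
    and char: "\<And>a b. (\<lambda>n. \<integral>x. iexp (a * X n x + b * Y n x) \<partial>M) \<longlonglongrightarrow> (\<integral>x. iexp (a * U x + b * V x) \<partial>N)"
    and u: "continuous_on UNIV u" "\<And>x::real. \<bar>u x :: real\<bar> \<le> K"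
    and v: "continuous_on UNIV v" "\<And>x::real. \<bar>v x :: real\<bar> \<le> K'"
  shows "(\<lambda>n. \<integral>x. u (X n x) * v (Y n x) \<partial>M) \<longlonglongrightarrow> (\<integral>x. u (U x) * v (V x) \<partial>N)"
proof -
  interpret M: prob_space M by fact
  interpret N: prob_space N by fact
  have um[measurable]: "u \<in> borel_measurable borel" using u(1) by (rule borel_measurable_continuous_onI)
  have vm[measurable]: "v \<in> borel_measurable borel" using v(1) by (rule borel_measurable_continuous_onI)
  \<comment> \<open>The first reweighting uses \<open>2 + cos (b Y + c)\<close>: it lies between \<open>1\<close> and \<open>3\<close>, and the weighted
    characteristic function of \<open>X\<close> is a combination of values of the joint one.\<close>
  have expand: "(\<integral>x. complex_of_real (2 + cos (b * Y x + c)) * iexp (t * X x) \<partial>P) =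
      2 * (\<integral>x. iexp (t * X x + 0 * Y x) \<partial>P) + (exp (\<i> * c) / 2) * (\<integral>x. iexp (t * X x + b * Y x) \<partial>P)
       + (exp (- (\<i> * c)) / 2) * (\<integral>x. iexp (t * X x + (-b) * Y x) \<partial>P)"
    if "prob_space P" and [measurable]: "X \<in> borel_measurable P" "Y \<in> borel_measurable P"
    for P :: "'c measure" and X Y :: "'c \<Rightarrow> real" and b c t :: real
  proof -
    have i: "integrable P (\<lambda>x. iexp (r * X x + s * Y x))" for r s
      by (rule integrable_prob_bounded[where D=1, OF that(1)]) auto
    have "complex_of_real (2 + cos (b * y + c)) * iexp (t * x) =
        2 * iexp (t * x + 0 * y) + exp (\<i> * c) / 2 * iexp (t * x + b * y)
         + exp (- (\<i> * c)) / 2 * iexp (t * x + (-b) * y)" for x y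
      by (simp add: cos_of_real[symmetric] cos_exp_eq exp_add exp_diff exp_minus field_simps)
    then have "(\<integral>x. complex_of_real (2 + cos (b * Y x + c)) * iexp (t * X x) \<partial>P) =
       (\<integral>x. 2 * iexp (t * X x + 0 * Y x) + exp (\<i> * c) / 2 * iexp (t * X x + b * Y x)
         + exp (- (\<i> * c)) / 2 * iexp (t * X x + (-b) * Y x) \<partial>P)" by simp
    also have "\<dots> = (\<integral>x. 2 * iexp (t * X x + 0 * Y x) \<partial>P) + (\<integral>x. exp (\<i> * c) / 2 * iexp (t * X x
        + b * Y x) \<partial>P)
         + (\<integral>x. exp (- (\<i> * c)) / 2 * iexp (t * X x + (-b) * Y x) \<partial>P)"
      using i by (subst Bochner_Integration.integral_add,
          (intro Bochner_Integration.integrable_add integrable_mult_right i)+)+ simp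
    finally show ?thesis using i by (simp only: integral_mult_right_zero)
  qed
  have cosw: "(\<lambda>n. \<integral>x. (2 + cos (b * Y n x + c)) * g (X n x) \<partial>M) \<longlonglongrightarrow> (\<integral>x. (2 + cos (b * V x
      + c)) * g (U x) \<partial>N)"
    if g: "continuous_on UNIV g" "\<And>x::real. \<bar>g x :: real\<bar> \<le> L" for g L b c
  proof (rule weighted_levy_continuity[OF pM pN _ _ _ _ _ _ _ _ _ g, where C=3])
    show "(\<lambda>n. \<integral>x. complex_of_real (2 + cos (b * Y n x + c)) * iexp (t * X n x) \<partial>M)
         \<longlonglongrightarrow> (\<integral>x. complex_of_real (2 + cos (b * V x + c)) * iexp (t * U x) \<partial>N)" for t
      unfolding expand[OF pM X Y] expand[OF pN U V]
      by (intro tendsto_intros char)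
    show "1 \<le> 2 + cos y" for y :: real using cos_ge_minus_one[of y] by linarith
    show "1 \<le> 2 + cos y" for y :: real using cos_ge_minus_one[of y] by linarith
  qed simp_all
  have coswt: "(\<lambda>n. \<integral>x. cos (b * Y n x + c) * g (X n x) \<partial>M) \<longlonglongrightarrow> (\<integral>x. cos (b * V x + c) * g (U x) \<partial>N)"
    if g: "continuous_on UNIV g" "\<And>x::real. \<bar>g x :: real\<bar> \<le> L" for g L b c
  proof -
    have gm[measurable]: "g \<in> borel_measurable borel" using g(1) by (rule borel_measurable_continuous_onI)
    have eq: "(\<integral>x. cos (b * Y x + c) * g (X x) \<partial>P) = (\<integral>x. (2 + cos (b * Y x + c)) * g (X x) \<partial>P)
      - 2/3 * (\<integral>x. (2 + cos (0 * Y x + 0)) * g (X x) \<partial>P)"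
      if "prob_space P" and [measurable]: "X \<in> borel_measurable P" "Y \<in> borel_measurable P"
      for P :: "'c measure" and X Y :: "'c \<Rightarrow> real"
    proof -
      have "integrable P (\<lambda>x. g (X x))" by (rule integrable_prob_bounded[where D=L, OF that(1)])
          (use g in auto)
      moreover have "integrable P (\<lambda>x. cos (b * Y x + c) * g (X x))"
      proof (rule integrable_prob_bounded[where D="1 * L", OF that(1)])
        show "norm (cos (b * Y x + c) * g (X x)) \<le> 1 * L" for x unfolding norm_mult
          by (rule mult_mono) (use g in auto)
      qed simp
      ultimately show ?thesis by (simp add: distrib_right)
    qed
    show ?thesis unfolding eq[OF pM X Y] eq[OF pN U V] by (intro tendsto_intros cosw[OF g])
  qed
  \<comment> \<open>The second reweighting uses a test function of \<open>X\<close>, at first one that is at least \<open>1\<close>.  The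
    weighted characteristic function of \<open>Y\<close> converges by the previous step, the phase \<open>c = -pi/2\<close>
    turning the cosine into the imaginary part.\<close>
  have pos: "(\<lambda>n. \<integral>x. g (X n x) * v (Y n x) \<partial>M) \<longlonglongrightarrow> (\<integral>x. g (U x) * v (V x) \<partial>N)"
    if g: "continuous_on UNIV g" "\<And>x::real. 1 \<le> (g x :: real)" "\<And>x. g x \<le> C" for g C
  proof (rule weighted_levy_continuity[OF pM pN _ _ _ _ _ _ _ _ _ v])
    have gm[measurable]: "g \<in> borel_measurable borel" using g(1) by (rule borel_measurable_continuous_onI)
    show "(\<lambda>x. g (X n x)) \<in> borel_measurable M" "(\<lambda>x. g (U x)) \<in> borel_measurable N" for n by measurable
    have gb: "\<bar>g x\<bar> \<le> C" for x using g(2,3)[of x] by auto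
    have eq: "(\<integral>x. complex_of_real (g (X x)) * iexp (t * Y x) \<partial>P) =
       complex_of_real (\<integral>x. cos (t * Y x + 0) * g (X x) \<partial>P) + \<i> * complex_of_real (\<integral>x. cos (t * Y x
           + (-pi/2)) * g (X x) \<partial>P)"
      if "prob_space P" and [measurable]: "X \<in> borel_measurable P" "Y \<in> borel_measurable P"
      for P :: "'c measure" and X Y :: "'c \<Rightarrow> real" and t
    proof -
      have i: "integrable P (\<lambda>x. cos (t * Y x + c) * g (X x))" for c
      proof (rule integrable_prob_bounded[where D="1 * C", OF that(1)])
        show "norm (cos (t * Y x + c) * g (X x)) \<le> 1 * C" for x unfolding norm_mult
          by (rule mult_mono) (use gb in auto)
      qed simp
      have c: "cos (y + - pi/2) = sin y" for y :: real
        by (simp add: cos_diff)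
      have "complex_of_real (g (X x)) * iexp (t * Y x) =
        complex_of_real (cos (t * Y x + 0) * g (X x)) + \<i> * complex_of_real (cos (t * Y x
            + (-pi/2)) * g (X x))" for x
        unfolding c by (simp add: exp_Euler[symmetric] cos_of_real sin_of_real complex_eq_iff Re_exp Im_exp)
      then show ?thesis using i[of 0] i[of "-pi/2"]
        by (simp only:, subst Bochner_Integration.integral_add) (auto simp del: of_real_mult)
    qed
    show "(\<lambda>n. \<integral>x. complex_of_real (g (X n x)) * iexp (t * Y n x) \<partial>M) \<longlonglongrightarrow>
       (\<integral>x. complex_of_real (g (U x)) * iexp (t * V x) \<partial>N)" for t
      unfolding eq[OF pM X Y] eq[OF pN U V]
      by (intro tendsto_intros coswt[OF g(1) gb])
  qed (use g in auto)
  have eq: "(\<integral>x. u (X x) * v (Y x) \<partial>P) = (\<integral>x. (u (X x) + K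
      + 1) * v (Y x) \<partial>P) - (K+1) * (\<integral>x. 1 * v (Y x) \<partial>P)"
    if "prob_space P" and [measurable]: "X \<in> borel_measurable P" "Y \<in> borel_measurable P"
    for P :: "'c measure" and X Y :: "'c \<Rightarrow> real"
  proof -
    have "integrable P (\<lambda>x. v (Y x))" by (rule integrable_prob_bounded[where D=K', OF that(1)])
        (use v in auto)
    moreover have "integrable P (\<lambda>x. u (X x) * v (Y x))"
    proof (rule integrable_prob_bounded[where D="K * K'", OF that(1)])
      show "norm (u (X x) * v (Y x)) \<le> K * K'" for x unfolding norm_mult
        using u(2)[of "X x"] v(2)[of "Y x"] by (intro mult_mono) auto
    qed simp
    ultimately show ?thesis by (simp add: algebra_simps)
  qed
  have "1 \<le> u x + K + 1" "u x + K + 1 \<le> 2 * K + 1" for x using u(2)[of x] by auto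
  then show ?thesis unfolding eq[OF pM X Y] eq[OF pN U V]
    by (intro tendsto_intros pos[of "\<lambda>x. u x + K + 1" "2 * K + 1"]
        pos[of "\<lambda>_. 1" 1] continuous_on_add u) auto
qed

text \<open>The algebra generated by continuous functions of one coordinate; its elements are finite sums of
  products, and the inductive form makes closure properties immediate.\<close>

inductive tensor_sum :: "(real \<times> real \<Rightarrow> real) \<Rightarrow> bool" where
  product: "continuous_on UNIV u \<Longrightarrow> continuous_on UNIV v \<Longrightarrow> tensor_sum (\<lambda>z. u (fst z) * v (snd z))"
| add: "tensor_sum f \<Longrightarrow> tensor_sum g \<Longrightarrow> tensor_sum (\<lambda>z. f z + g z)"

lemma tensor_sum_mult:
  assumes "tensor_sum f" "tensor_sum g" shows "tensor_sum (\<lambda>z. f z * g z)"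
  using assms(1)
proof induction
  case (product u v)
  show ?case using assms(2)
  proof induction
    case (product u' v')
    have "tensor_sum (\<lambda>z. (\<lambda>x. u x * u' x) (fst z) * (\<lambda>x. v x * v' x) (snd z))"
      using product \<open>continuous_on UNIV u\<close> \<open>continuous_on UNIV v\<close>
      by (intro tensor_sum.product continuous_on_mult)
    then show ?case by (simp add: ac_simps)
  next
    case (add f g)
    show ?case using tensor_sum.add[OF add.IH] by (simp add: distrib_left)
  qed
next
  case (add f h)
  show ?case using tensor_sum.add[OF add.IH] by (simp add: distrib_right)
qed

lemma tensor_sum_dense:
  fixes f :: "real \<times> real \<Rightarrow> real"
  assumes "compact S" "continuous_on S f" "0 < e"
  shows "\<exists>p. tensor_sum p \<and> (\<forall>z\<in>S. \<bar>f z - p z\<bar> < e)"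
proof (rule Stone_Weierstrass_HOL[OF assms(1) _ _ _ _ _ assms(2,3)])
  show "tensor_sum (\<lambda>x. c)" for c
    using tensor_sum.product[of "\<lambda>_. c" "\<lambda>_. 1"] by simp
  show "continuous_on S f" if "tensor_sum f" for f
    using that
  proof induction
    case (product u v)
    show ?case
      by (intro continuous_on_mult continuous_on_compose2[OF product(1)]
          continuous_on_compose2[OF product(2)]
        continuous_on_fst continuous_on_snd continuous_on_id) auto
  qed (intro continuous_on_add)
  show "\<exists>f. tensor_sum f \<and> f x \<noteq> f y" if "x \<in> S \<and> y \<in> S \<and> x \<noteq> y" for x y
  proof (cases "fst x = fst y")
    case True
    then have "snd x \<noteq> snd y" using that by (auto simp: prod_eq_iff)
    then show ?thesis using tensor_sum.product[of "\<lambda>_. 1" "\<lambda>x. x"] by auto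
  next
    case False
    then show ?thesis using tensor_sum.product[of "\<lambda>x. x" "\<lambda>_. 1"] by auto
  qed
qed (auto intro: tensor_sum.add tensor_sum_mult)

text \<open>Product test functions suffice: on a large square a continuous function is uniformly close to a
  sum of products (Stone--Weierstrass), and outside that square the limit has little mass, hence so do
  the approximating laws, because the cutoff is itself a product test function.\<close>

lemma joint_levy_continuity:
  fixes X Y :: "nat \<Rightarrow> 'a \<Rightarrow> real" and U V :: "'b \<Rightarrow> real"
  assumes pM: "prob_space M" and pN: "prob_space N"
    and X[measurable]: "\<And>n. X n \<in> borel_measurable M" and Y[measurable]: "\<And>n. Y n \<in> borel_measurable M"
    and U[measurable]: "U \<in> borel_measurable N" and V[measurable]: "V \<in> borel_measurable N"
    and char: "\<And>a b. (\<lambda>n. \<integral>x. iexp (a * X n x + b * Y n x) \<partial>M) \<longlonglongrightarrow> (\<integral>x. iexp (a * U x + b * V x) \<partial>N)"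
  shows "converges_in_distribution M (\<lambda>n x. (X n x, Y n x)) N (\<lambda>x. (U x, V x)) sequentially"
  unfolding converges_in_distribution_def
proof (intro conjI allI impI)
  fix f :: "real \<times> real \<Rightarrow> real"
  assume f: "continuous_on UNIV f \<and> bounded (range f)"
  then obtain C0 where C0: "\<And>z. \<bar>f z\<bar> \<le> C0" by (auto simp: bounded_iff)
  define C where "C = max C0 1"
  have C: "\<bar>f z\<bar> \<le> C" "1 \<le> C" for z using C0[of z] by (auto simp: C_def)
  have fm[measurable]: "f \<in> borel_measurable (borel \<Otimes>\<^sub>M borel)"
    using f by (subst borel_prod) (auto intro: borel_measurable_continuous_onI)
  interpret M: prob_space M by fact
  interpret N: prob_space N by fact
  \<comment> \<open>A continuous cutoff that is \<open>1\<close> on \<open>[-k, k]\<close> and vanishes outside \<open>[-(k+1), k+1]\<close>.\<close>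
  define cut where "cut k x = max 0 (min 1 (real (Suc k) - abs x))" for k and x :: real
  have cutc: "continuous_on UNIV (cut k)" for k unfolding cut_def by (intro continuous_intros)
  have cutm[measurable]: "cut k \<in> borel_measurable borel" for k using cutc
      by (rule borel_measurable_continuous_onI)
  have cutb: "0 \<le> cut k x" "cut k x \<le> 1" for k x by (auto simp: cut_def)
  have cut0: "cut k x = 0" if "\<bar>x\<bar> > real (Suc k)" for k x using that by (auto simp: cut_def)
  have cut1: "\<forall>\<^sub>F k in sequentially. cut k x = 1" for x
  proof -
    obtain k0 where "\<bar>x\<bar> \<le> real k0" using real_arch_simple by blast
    then show ?thesis unfolding eventually_sequentially by (intro exI[of _ k0]) (auto simp: cut_def)
  qed
  have cutcutb: "0 \<le> cut k x * cut k y" "cut k x * cut k y \<le> 1" for k x y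
    using cutb[of k x] cutb[of k y] by (auto intro: mult_le_one)
  have "(\<lambda>k. \<integral>x. 1 - cut k (U x) * cut k (V x) \<partial>N) \<longlonglongrightarrow> (\<integral>x. 0 \<partial>N)"
  proof (rule integral_dominated_convergence[where w="\<lambda>_. 1"])
    show "AE x in N. (\<lambda>k. 1 - cut k (U x) * cut k (V x)) \<longlonglongrightarrow> 0"
    proof (intro AE_I2 tendsto_eventually)
      fix x show "\<forall>\<^sub>F k in sequentially. 1 - cut k (U x) * cut k (V x) = 0"
        using cut1[of "U x"] cut1[of "V x"] by eventually_elim simp
    qed
  qed (use cutcutb in auto)
  then have cutN: "(\<lambda>k. \<integral>x. 1 - cut k (U x) * cut k (V x) \<partial>N) \<longlonglongrightarrow> 0" by simp
  show "(\<lambda>n. \<integral>x. f (X n x, Y n x) \<partial>M) \<longlonglongrightarrow> (\<integral>x. f (U x, V x) \<partial>N)"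
  proof (rule LIMSEQ_I)
    fix r :: real assume r: "0 < r"
    define e where "e = r / (8 * C)"
    have e: "0 < e" using r C by (auto simp: e_def)
    obtain k where k: "(\<integral>x. 1 - cut k (U x) * cut k (V x) \<partial>N) < e"
      using order_tendstoD(2)[OF cutN e] by (auto simp: eventually_sequentially)
    let ?S = "{-real (Suc k)..real (Suc k)}"
    obtain p where p: "tensor_sum p" "\<And>z. z \<in> ?S \<times> ?S \<Longrightarrow> \<bar>f z - p z\<bar> < e"
      using tensor_sum_dense[of "?S \<times> ?S" f e, OF compact_Times[OF compact_Icc compact_Icc]
          continuous_on_subset[OF conjunct1[OF f] subset_UNIV] e]
      by metis
    \<comment> \<open>Cutting off the approximation makes it a bounded function on the whole plane that is still a
      sum of products of functions of one variable.\<close>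
    define q where "q x y = p (x, y) * (cut k x * cut k y)" for x y
    define h where "h x y = cut k x * cut k y" for x y
    have qm0: "(\<lambda>z. q (fst z) (snd z)) \<in> borel_measurable (borel \<Otimes>\<^sub>M borel)
        \<and> (\<exists>K. \<forall>x y. \<bar>q x y\<bar> \<le> K)
        \<and> (\<lambda>n. \<integral>x. q (X n x) (Y n x) \<partial>M) \<longlonglongrightarrow> (\<integral>x. q (U x) (V x) \<partial>N)"
      unfolding q_def using p(1)
    proof induction
      case (product u v)
      have bd: "\<exists>K. \<forall>x. \<bar>g x * cut k x\<bar> \<le> K" if g: "continuous_on UNIV g" for g :: "real \<Rightarrow> real"
      proof -
        have "compact ((\<lambda>x. g x * cut k x) ` ?S)"
          by (intro compact_continuous_image continuous_intros continuous_on_subset[OF g]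
              continuous_on_subset[OF cutc]) auto
        then have "bounded ((\<lambda>x. g x * cut k x) ` ?S)" by (rule compact_imp_bounded)
        then obtain K where K: "\<And>x. x \<in> ?S \<Longrightarrow> \<bar>g x * cut k x\<bar> \<le> K"
          unfolding bounded_iff real_norm_def by blast
        have "\<bar>g x * cut k x\<bar> \<le> max K 0" for x
        proof (cases "\<bar>x\<bar> > real (Suc k)")
          case False
          then have "x \<in> ?S" by auto
          then show ?thesis using K[of x] by linarith
        qed (simp add: cut0)
        then show ?thesis by blast
      qed
      from bd[OF product(1)] bd[OF product(2)] obtain K K' where
        K: "\<And>x. \<bar>u x * cut k x\<bar> \<le> K" "\<And>x. \<bar>v x * cut k x\<bar> \<le> K'" by blast
      have [measurable]: "u \<in> borel_measurable borel" "v \<in> borel_measurable borel"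
        using product by (auto intro: borel_measurable_continuous_onI)
      have "(\<lambda>n. \<integral>x. (u (X n x) * cut k (X n x)) * (v (Y n x) * cut k (Y n x)) \<partial>M)
          \<longlonglongrightarrow> (\<integral>x. (u (U x) * cut k (U x)) * (v (V x) * cut k (V x)) \<partial>N)"
        by (rule joint_char_imp_product_test_functions[OF pM pN X Y U V char,
            where u="\<lambda>x. u x * cut k x" and v="\<lambda>x. v x * cut k x", OF _ K(1) _ K(2)])
          (intro continuous_on_mult product cutc)+
      moreover have "\<bar>(u x * cut k x) * (v y * cut k y)\<bar> \<le> K * K'" for x y
        unfolding abs_mult[of "u x * cut k x"] using K(1)[of x] K(2)[of y] by (intro mult_mono) auto
      ultimately show ?case by (auto simp: ac_simps intro!: exI[of _ "K * K'"])
    next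
      case (add p1 p2)
      then obtain K K' where K: "\<And>x y. \<bar>p1 (x, y) * (cut k x * cut k y)\<bar> \<le> K"
          "\<And>x y. \<bar>p2 (x, y) * (cut k x * cut k y)\<bar> \<le> K'" by blast
      have m[measurable]: "(\<lambda>z. p1 (fst z, snd z) * (cut k (fst z) * cut k (snd z))) \<in> borel_measurable (borel \<Otimes>\<^sub>M borel)"
        "(\<lambda>z. p2 (fst z, snd z) * (cut k (fst z) * cut k (snd z))) \<in> borel_measurable (borel \<Otimes>\<^sub>M borel)"
            using add by auto
      have i: "integrable P (\<lambda>x. p1 (X x, Y x) * (cut k (X x) * cut k (Y x)))"
          "integrable P (\<lambda>x. p2 (X x, Y x) * (cut k (X x) * cut k (Y x)))"
        if "prob_space P" and [measurable]: "X \<in> borel_measurable P" "Y \<in> borel_measurable P"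
        for P :: "'c measure" and X Y :: "'c \<Rightarrow> real"
        using measurable_compose[OF measurable_Pair[OF that(2,3)] m(1)]
            measurable_compose[OF measurable_Pair[OF that(2,3)] m(2)] K
        by (auto intro!: integrable_prob_bounded[OF that(1)])
      have "\<bar>p1 (x, y) * (cut k x * cut k y) + p2 (x, y) * (cut k x * cut k y)\<bar> \<le> K + K'" for x y
        using K(1)[of x y] K(2)[of x y] by linarith
      moreover have "(\<lambda>n. (\<integral>x. p1 (X n x, Y n x) * (cut k (X n x) * cut k (Y n x)) \<partial>M)
          + (\<integral>x. p2 (X n x, Y n x) * (cut k (X n x) * cut k (Y n x)) \<partial>M))
        \<longlonglongrightarrow> (\<integral>x. p1 (U x, V x) * (cut k (U x) * cut k (V x)) \<partial>N)
            + (\<integral>x. p2 (U x, V x) * (cut k (U x) * cut k (V x)) \<partial>N)"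
        using add by (intro tendsto_add) auto
      ultimately show ?case
        using i[OF pM X Y] i[OF pN U V] m by (auto simp: distrib_right intro!: exI[of _ "K + K'"])
    qed
    then obtain K where K: "\<And>x y. \<bar>q x y\<bar> \<le> K" by blast
    have qm[measurable]: "(\<lambda>x. q (X x) (Y x)) \<in> borel_measurable P"
      if [measurable]: "X \<in> borel_measurable P" "Y \<in> borel_measurable P" for P :: "'c measure" and X Y
      using measurable_compose[OF measurable_Pair[OF that] conjunct1[OF qm0]] by simp
    have hm[measurable]: "(\<lambda>x. h (X x) (Y x)) \<in> borel_measurable P"
      if [measurable]: "X \<in> borel_measurable P" "Y \<in> borel_measurable P" for P :: "'c measure" and X Y
      unfolding h_def by measurable
    have hlim: "(\<lambda>n. \<integral>x. 1 - h (X n x) (Y n x) \<partial>M) \<longlonglongrightarrow> (\<integral>x. 1 - h (U x) (V x) \<partial>N)"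
    proof -
      have "(\<lambda>n. \<integral>x. h (X n x) (Y n x) \<partial>M) \<longlonglongrightarrow> (\<integral>x. h (U x) (V x) \<partial>N)"
        unfolding h_def using cutb
        by (intro joint_char_imp_product_test_functions[OF pM pN X Y U V char, where K=1
            and K'=1] cutc) auto
      moreover have "integrable M (\<lambda>x. h (X n x) (Y n x))" for n
        using cutcutb by (intro integrable_prob_bounded[where D=1, OF pM]) (auto simp: h_def)
      moreover have "integrable N (\<lambda>x. h (U x) (V x))"
        using cutcutb by (intro integrable_prob_bounded[where D=1, OF pN]) (auto simp: h_def)
      ultimately show ?thesis by (auto simp: M.prob_space N.prob_space intro!: tendsto_intros)
    qed
    have close: "\<bar>(\<integral>x. f (X x, Y x) \<partial>P) - (\<integral>x. q (X x) (Y x) \<partial>P)\<bar> \<le> C * (\<integral>x. 1 - h (X x) (Y x) \<partial>P) + e"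
      if pP: "prob_space P" and [measurable]: "X \<in> borel_measurable P" "Y \<in> borel_measurable P"
      for P :: "'c measure" and X Y :: "'c \<Rightarrow> real"
    proof -
      interpret P: prob_space P by fact
      have i1: "integrable P (\<lambda>x. f (X x, Y x))" by (rule integrable_prob_bounded[where D=C, OF pP])
          (use C in auto)
      have i2: "integrable P (\<lambda>x. q (X x) (Y x))" by (rule integrable_prob_bounded[where D=K, OF pP])
          (use K in auto)
      have i3: "integrable P (\<lambda>x. 1 - h (X x) (Y x))"
        by (rule integrable_prob_bounded[where D=1, OF pP]) (use cutcutb in \<open>auto simp: h_def abs_le_iff\<close>)
      have pt: "\<bar>f (x, y) - q x y\<bar> \<le> C * (1 - h x y) + e" for x y
      proof -
        have "\<bar>f (x, y) - q x y\<bar> = \<bar>f (x, y) * (1 - h x y) + (f (x, y) - p (x, y)) * h x y\<bar>"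
          by (simp add: q_def h_def algebra_simps)
        also have "\<dots> \<le> \<bar>f (x, y)\<bar> * (1 - h x y) + \<bar>f (x, y) - p (x, y)\<bar> * h x y"
          using cutcutb[of k x y] abs_mult[of "f (x, y)" "1 - h x y"] abs_mult[of "f (x, y) - p (x, y)"
              "h x y"]
          by (intro order_trans[OF abs_triangle_ineq]) (simp add: h_def)
        also have "\<dots> \<le> C * (1 - h x y) + e"
        proof (intro add_mono mult_right_mono C)
          show "0 \<le> 1 - h x y" using cutcutb[of k x y] by (auto simp: h_def)
          show "\<bar>f (x, y) - p (x, y)\<bar> * h x y \<le> e"
          proof (cases "(x, y) \<in> ?S \<times> ?S")
            case True
            then have "\<bar>f (x, y) - p (x, y)\<bar> * h x y \<le> e * 1"
              using p(2)[OF True] cutcutb[of k x y] by (intro mult_mono) (auto simp: h_def)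
            then show ?thesis by simp
          next
            case False
            then have "\<bar>x\<bar> > real (Suc k) \<or> \<bar>y\<bar> > real (Suc k)" by auto
            then have "h x y = 0" using cut0[of k x] cut0[of k y] by (auto simp: h_def)
            then show ?thesis using e by simp
          qed
        qed
        finally show ?thesis .
      qed
      have "\<bar>(\<integral>x. f (X x, Y x) \<partial>P) - (\<integral>x. q (X x) (Y x) \<partial>P)\<bar> = \<bar>\<integral>x. f (X x, Y x) - q (X x) (Y x) \<partial>P\<bar>"
        using i1 i2 by simp
      also have "\<dots> \<le> (\<integral>x. \<bar>f (X x, Y x) - q (X x) (Y x)\<bar> \<partial>P)" by (rule integral_abs_bound)
      also have "\<dots> \<le> (\<integral>x. C * (1 - h (X x) (Y x)) + e \<partial>P)"
        using pt i1 i2 i3 by (intro integral_mono) auto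
      also have "\<dots> = C * (\<integral>x. 1 - h (X x) (Y x) \<partial>P) + e"
        using i3 by (subst Bochner_Integration.integral_add) (auto simp: P.prob_space)
      finally show ?thesis .
    qed
    have "\<forall>\<^sub>F n in sequentially. \<bar>(\<integral>x. q (X n x) (Y n x) \<partial>M) - (\<integral>x. q (U x) (V x) \<partial>N)\<bar> < e"
      using tendstoD[OF conjunct2[OF conjunct2[OF qm0]] e] by (simp add: dist_real_def)
    moreover have "\<forall>\<^sub>F n in sequentially. (\<integral>x. 1 - h (X n x) (Y n x) \<partial>M) < e"
      using order_tendstoD(2)[OF hlim] k by (auto simp: h_def)
    ultimately have "\<forall>\<^sub>F n in sequentially. \<bar>(\<integral>x. f (X n x, Y n x) \<partial>M) - (\<integral>x. f (U x, V x) \<partial>N)\<bar> < r"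
    proof eventually_elim
      case (elim n)
      have "C * (\<integral>x. 1 - h (X n x) (Y n x) \<partial>M) \<le> C * e" "C * (\<integral>x. 1 - h (U x) (V x) \<partial>N) \<le> C * e"
        using elim k C by (auto intro!: mult_left_mono simp: h_def)
      moreover have "e \<le> C * e" using C e by simp
      moreover have "C * e = r / 8" using C by (simp add: e_def)
      ultimately show ?case using close[OF pM X Y, of n n] close[OF pN U V] elim(1) r by linarith
    qed
    then show "\<exists>no. \<forall>n\<ge>no. norm ((\<integral>x. f (X n x, Y n x) \<partial>M) - (\<integral>x. f (U x, V x) \<partial>N)) < r"
      by (simp add: eventually_sequentially)
  qed
qed (simp_all add: borel_prod[symmetric])

lemma converges_in_distributionD:
  fixes f :: "'c::t2_space \<Rightarrow> real"
  assumes "converges_in_distribution M X N Y Fil" "\<And>z. isCont f z" "\<And>z. \<bar>f z\<bar> \<le> K"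
  shows "((\<lambda>i. \<integral>x. f (X i x) \<partial>M) \<longlongrightarrow> (\<integral>x. f (Y x) \<partial>N)) Fil"
proof -
  have "continuous_on UNIV f" "bounded (range f)"
    using assms(2,3) by (auto simp: continuous_on_eq_continuous_at bounded_iff)
  then show ?thesis using assms(1) unfolding converges_in_distribution_def by blast
qed

text \<open>The continuous mapping theorem for a function that may be discontinuous on a set that the limit
  does not charge.  The set is given as the zeros of a continuous function, which can be used
  directly as a cutoff.\<close>

lemma continuous_mapping_off_zeros:
  fixes X :: "'i \<Rightarrow> 'a \<Rightarrow> 'c::t2_space" and g :: "'c \<Rightarrow> 'd::t2_space" and s :: "'c \<Rightarrow> real"
  assumes pM: "prob_space M" and pN: "prob_space N"
    and conv: "converges_in_distribution M X N Y Fil"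
    and gm: "g \<in> borel_measurable borel"
    and s: "continuous_on UNIV s" "\<And>z. 0 \<le> s z"
    and g: "\<And>z. s z \<noteq> 0 \<Longrightarrow> isCont g z"
    and Y0: "AE x in N. s (Y x) \<noteq> 0"
  shows "converges_in_distribution M (\<lambda>i x. g (X i x)) N (\<lambda>x. g (Y x)) Fil"
  unfolding converges_in_distribution_def
proof (intro conjI allI impI)
  have X[measurable]: "X i \<in> borel_measurable M" and Y[measurable]: "Y \<in> borel_measurable N" for i
    using conv by (auto simp: converges_in_distribution_def)
  note gm[measurable]
  have sm[measurable]: "s \<in> borel_measurable borel" using s(1) by (rule borel_measurable_continuous_onI)
  show "(\<lambda>x. g (X i x)) \<in> borel_measurable M" "(\<lambda>x. g (Y x)) \<in> borel_measurable N" for i by measurable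
  interpret M: prob_space M by fact
  interpret N: prob_space N by fact
  fix f :: "'d \<Rightarrow> real"
  assume f: "continuous_on UNIV f \<and> bounded (range f)"
  then obtain C0 where C0: "\<And>z. \<bar>f z\<bar> \<le> C0" by (auto simp: bounded_iff)
  define C where "C = max C0 1"
  have C: "\<bar>f z\<bar> \<le> C" "1 \<le> C" for z using C0[of z] by (auto simp: C_def)
  have fm[measurable]: "f \<in> borel_measurable borel"
    using f by (auto intro: borel_measurable_continuous_onI)
  \<comment> \<open>The factor \<open>\<psi> m\<close> vanishes where \<open>g\<close> may jump, so it makes \<open>f \<circ> g\<close> continuous; as \<open>m\<close> grows it
    tends to \<open>1\<close> off the zeros of \<open>s\<close>, which the limit avoids almost surely.\<close>
  define \<psi> where "\<psi> m z = min 1 (real m * s z)" for m z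
  have \<psi>b: "0 \<le> \<psi> m z" "\<psi> m z \<le> 1" for m z using s(2)[of z] by (auto simp: \<psi>_def)
  have \<psi>c: "continuous_on UNIV (\<psi> m)" for m unfolding \<psi>_def by (intro continuous_intros s)
  then have \<psi>m[measurable]: "\<psi> m \<in> borel_measurable borel" for m by (rule borel_measurable_continuous_onI)
  have hc: "isCont (\<lambda>z. f (g z) * \<psi> m z) z" for m z
  proof (cases "s z = 0")
    case False
    have "isCont (\<lambda>z. f (g z)) z"
      using g[OF False] f isCont_o2[of z g f] by (auto simp: continuous_on_eq_continuous_at)
    then show ?thesis using \<psi>c[of m] by (intro continuous_mult) (auto simp: continuous_on_eq_continuous_at)
  next
    case True
    then have z: "\<psi> m z = 0" by (simp add: \<psi>_def)
    have "((\<lambda>z. C * \<psi> m z) \<longlongrightarrow> C * \<psi> m z) (at z)"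
      using \<psi>c[of m] by (intro tendsto_mult tendsto_const)
          (auto simp: continuous_on_eq_continuous_at isCont_def)
    then have "((\<lambda>z. f (g z) * \<psi> m z) \<longlongrightarrow> 0) (at z)"
      unfolding z mult_zero_right
    proof (rule Lim_null_comparison[rotated])
      have "norm (f (g y) * \<psi> m y) \<le> C * \<psi> m y" for y
        using mult_right_mono[OF C(1)[of "g y"] \<psi>b(1)[of m y]] \<psi>b(1)[of m y] by (simp add: abs_mult)
      then show "\<forall>\<^sub>F y in at z. norm (f (g y) * \<psi> m y) \<le> C * \<psi> m y" by (simp add: always_eventually)
    qed
    then show ?thesis by (simp add: isCont_def z)
  qed
  have lim1: "((\<lambda>i. \<integral>x. f (g (X i x)) * \<psi> m (X i x) \<partial>M) \<longlongrightarrow> (\<integral>x. f (g (Y x)) * \<psi> m (Y x) \<partial>N)) Fil" for m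
  proof -
    have b: "\<bar>f (g z) * \<psi> m z\<bar> \<le> C" for z
      using mult_mono[OF C(1)[of "g z"] \<psi>b(2)[of m z]] C(2) \<psi>b(1)[of m z] by (simp add: abs_mult)
    show ?thesis by (rule converges_in_distributionD[OF conv hc b])
  qed
  have lim2: "((\<lambda>i. \<integral>x. 1 - \<psi> m (X i x) \<partial>M) \<longlongrightarrow> (\<integral>x. 1 - \<psi> m (Y x) \<partial>N)) Fil" for m
    by (rule converges_in_distributionD[OF conv, where f="\<lambda>z. 1 - \<psi> m z" and K=1])
      (use \<psi>b \<psi>c in \<open>auto simp: continuous_on_eq_continuous_at abs_le_iff intro!: continuous_diff\<close>)
  have "(\<lambda>m. \<integral>x. 1 - \<psi> m (Y x) \<partial>N) \<longlonglongrightarrow> (\<integral>x. 0 \<partial>N)"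
  proof (rule integral_dominated_convergence[where w="\<lambda>_. 1"])
    show "AE x in N. (\<lambda>m. 1 - \<psi> m (Y x)) \<longlonglongrightarrow> 0"
      using Y0
    proof (eventually_elim, intro tendsto_eventually)
      fix x assume "s (Y x) \<noteq> 0"
      then have p: "0 < s (Y x)" using s(2)[of "Y x"] by simp
      obtain m0 where "1 / s (Y x) \<le> real m0" using real_arch_simple by blast
      then have "1 \<le> real m * s (Y x)" if "m0 \<le> m" for m
        using p that order_trans[of "1 / s (Y x)" "real m0" "real m"] by (auto simp: field_simps)
      then show "\<forall>\<^sub>F m in sequentially. 1 - \<psi> m (Y x) = 0"
        unfolding eventually_sequentially \<psi>_def by (intro exI[of _ m0]) auto
    qed
  qed (use \<psi>b in auto)
  then have small: "(\<lambda>m. \<integral>x. 1 - \<psi> m (Y x) \<partial>N) \<longlonglongrightarrow> 0" by simp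
  have close: "\<bar>(\<integral>x. f (g (Z x)) \<partial>P) - (\<integral>x. f (g (Z x)) * \<psi> m (Z x) \<partial>P)\<bar> \<le> C * (\<integral>x. 1 - \<psi> m (Z x) \<partial>P)"
    if "prob_space P" and [measurable]: "Z \<in> borel_measurable P" for P :: "'e measure" and Z m
  proof -
    interpret P: prob_space P by fact
    have i1: "integrable P (\<lambda>x. f (g (Z x)))" by (rule P.integrable_const_bound[where B=C]) (use C in auto)
    have b: "\<bar>f (g z) * \<psi> m z\<bar> \<le> C" for z
      using mult_mono[OF C(1)[of "g z"] \<psi>b(2)[of m z]] C(2) \<psi>b(1)[of m z] by (simp add: abs_mult)
    have i2: "integrable P (\<lambda>x. f (g (Z x)) * \<psi> m (Z x))"
      by (rule P.integrable_const_bound[where B=C]) (use b in auto)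
    have i3: "integrable P (\<lambda>x. 1 - \<psi> m (Z x))"
      by (rule P.integrable_const_bound[where B=1]) (use \<psi>b in auto)
    have "\<bar>(\<integral>x. f (g (Z x)) \<partial>P) - (\<integral>x. f (g (Z x)) * \<psi> m (Z x) \<partial>P)\<bar>
       = \<bar>\<integral>x. f (g (Z x)) * (1 - \<psi> m (Z x)) \<partial>P\<bar>"
      using i1 i2 by (simp add: right_diff_distrib)
    also have "\<dots> \<le> (\<integral>x. \<bar>f (g (Z x)) * (1 - \<psi> m (Z x))\<bar> \<partial>P)" by (rule integral_abs_bound)
    also have "\<dots> \<le> (\<integral>x. C * (1 - \<psi> m (Z x)) \<partial>P)"
    proof (rule integral_mono)
      show "integrable P (\<lambda>x. \<bar>f (g (Z x)) * (1 - \<psi> m (Z x))\<bar>)"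
        using i1 i2 by (simp add: right_diff_distrib)
      show "\<bar>f (g (Z x)) * (1 - \<psi> m (Z x))\<bar> \<le> C * (1 - \<psi> m (Z x))" for x
        using mult_right_mono[OF C(1)[of "g (Z x)"], of "1 - \<psi> m (Z x)"] \<psi>b(2)[of m "Z x"] by
            (simp add: abs_mult)
    qed (use i3 in simp)
    finally show ?thesis by simp
  qed
  show "((\<lambda>i. \<integral>x. f (g (X i x)) \<partial>M) \<longlongrightarrow> (\<integral>x. f (g (Y x)) \<partial>N)) Fil"
  proof (rule tendstoI)
    fix r :: real assume r: "0 < r"
    define e where "e = r / (4 * C)"
    have e: "0 < e" using r C by (auto simp: e_def)
    obtain m where m: "(\<integral>x. 1 - \<psi> m (Y x) \<partial>N) < e"
      using order_tendstoD(2)[OF small e] by (auto simp: eventually_sequentially)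
    have "\<forall>\<^sub>F i in Fil. \<bar>(\<integral>x. f (g (X i x)) * \<psi> m (X i x) \<partial>M) - (\<integral>x. f (g (Y x)) * \<psi> m (Y x) \<partial>N)\<bar> < e"
      using tendstoD[OF lim1 e] by (simp add: dist_real_def)
    moreover have "\<forall>\<^sub>F i in Fil. (\<integral>x. 1 - \<psi> m (X i x) \<partial>M) < e"
      using order_tendstoD(2)[OF lim2 m] .
    ultimately show "\<forall>\<^sub>F i in Fil. dist (\<integral>x. f (g (X i x)) \<partial>M) (\<integral>x. f (g (Y x)) \<partial>N) < r"
    proof eventually_elim
      case (elim i)
      have "C * (\<integral>x. 1 - \<psi> m (X i x) \<partial>M) \<le> C * e" "C * (\<integral>x. 1 - \<psi> m (Y x) \<partial>N) \<le> C * e"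
        using elim m C by (auto intro!: mult_left_mono)
      moreover have "e \<le> C * e" using C e by simp
      moreover have "C * e = r / 4" using C by (simp add: e_def)
      ultimately show ?case using close[OF pM X, of i m] close[OF pN Y, of m] elim(1) r
        unfolding dist_real_def by linarith
    qed
  qed
qed

lemma converges_in_distribution_eventually_cong:
  fixes X X' :: "'i \<Rightarrow> 'a \<Rightarrow> 'c::topological_space" and Y Y' :: "'b \<Rightarrow> 'c"
  assumes "converges_in_distribution M X N Y Fil"
    and "\<And>i. X' i \<in> borel_measurable M" "\<forall>\<^sub>F i in Fil. \<forall>x\<in>space M. X' i x = X i x"
    and "Y' \<in> borel_measurable N" "AE x in N. Y' x = Y x"
  shows "converges_in_distribution M X' N Y' Fil"
  unfolding converges_in_distribution_def
proof (intro conjI allI impI assms)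
  fix f :: "'c \<Rightarrow> real" assume f: "continuous_on UNIV f \<and> bounded (range f)"
  then have m[measurable]: "f \<in> borel_measurable borel" by (auto intro: borel_measurable_continuous_onI)
  note [measurable] = assms(4)
  have [measurable]: "Y \<in> borel_measurable N" using assms(1) by (auto simp: converges_in_distribution_def)
  have "(\<integral>x. f (Y' x) \<partial>N) = (\<integral>x. f (Y x) \<partial>N)"
    using assms(5) by (intro integral_cong_AE) auto
  moreover have "\<forall>\<^sub>F i in Fil. (\<integral>x. f (X i x) \<partial>M) = (\<integral>x. f (X' i x) \<partial>M)"
    using assms(3) by eventually_elim (auto intro!: Bochner_Integration.integral_cong)
  moreover have "((\<lambda>i. \<integral>x. f (X i x) \<partial>M) \<longlongrightarrow> (\<integral>x. f (Y x) \<partial>N)) Fil"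
    using assms(1) f by (auto simp: converges_in_distribution_def)
  ultimately show "((\<lambda>i. \<integral>x. f (X' i x) \<partial>M) \<longlongrightarrow> (\<integral>x. f (Y' x) \<partial>N)) Fil"
    using Lim_transform_eventually by metis
qed

section \<open>Gaussian variables\<close>

lemma (in prob_space) expectation_iexp_normal:
  assumes "distributed M lborel X (normal_density 0 \<sigma>)" "0 < \<sigma>"
  shows "(\<integral>x. iexp (t * X x) \<partial>M) = exp (- (\<sigma>\<^sup>2 * t\<^sup>2 / 2))"
proof -
  have d: "distributed M lborel (\<lambda>x. X x / \<sigma>) std_normal_density"
    using normal_standard_normal_convert[of \<sigma> X 0] assms by simp
  then have m: "(\<lambda>x. X x / \<sigma>) \<in> borel_measurable M"
    using distributed_measurable[OF d] by simp
  have "(\<integral>x. iexp (t * X x) \<partial>M) = (\<integral>x. iexp ((\<sigma> * t) * (X x / \<sigma>)) \<partial>M)"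
    using assms(2) by (simp add: field_simps)
  also have "\<dots> = (\<integral>x. iexp ((\<sigma> * t) * x) \<partial>distr M lborel (\<lambda>x. X x / \<sigma>))"
    using m by (subst integral_distr) auto
  also have "\<dots> = char std_normal_distribution (\<sigma> * t)"
    unfolding char_def distributed_distr_eq_density[OF d] by simp
  also have "\<dots> = exp (- (\<sigma>\<^sup>2 * t\<^sup>2 / 2))"
    by (simp add: char_std_normal_distribution power_mult_distrib)
  finally show ?thesis .
qed

lemma (in prob_space) distributed_lborel_AE_notin_countable:
  fixes X :: "'a \<Rightarrow> real"
  assumes "distributed M lborel X f" "countable A"
  shows "AE x in M. X x \<notin> A"
proof -
  have "AE x in lborel. x \<notin> A"
    using AE_not_in[OF countable_imp_null_set_lborel[OF assms(2)]] .
  then have "AE x in density lborel f. x \<notin> A"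
    using assms(1) by (subst AE_density) (auto simp: distributed_def)
  then have "AE x in distr M lborel X. x \<notin> A"
    unfolding distributed_distr_eq_density[OF assms(1)] .
  then show ?thesis
    by (rule AE_distrD[OF distributed_measurable[OF assms(1)]])
qed

lemma (in prob_space) normal_moments:
  assumes X: "distributed M lborel X (normal_density 0 \<sigma>)" and \<sigma>: "0 < \<sigma>"
  shows "integrable M X" "integrable M (\<lambda>\<omega>. (X \<omega>)\<^sup>2)" "(\<integral>\<omega>. X \<omega> \<partial>M) = 0" "(\<integral>\<omega>. (X \<omega>)\<^sup>2 \<partial>M) = \<sigma>\<^sup>2"
proof -
  show "integrable M X"
    using integrable_normal_moment[OF \<sigma>, of 0 1] distributed_integrable[OF X, of "\<lambda>x. x"] by simp
  show "integrable M (\<lambda>\<omega>. (X \<omega>)\<^sup>2)"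
    using integrable_normal_moment[OF \<sigma>, of 0 2] distributed_integrable[OF X, of "\<lambda>x. x\<^sup>2"] by simp
  show e: "(\<integral>\<omega>. X \<omega> \<partial>M) = 0" using normal_distributed_expectation[OF \<sigma> X] .
  show "(\<integral>\<omega>. (X \<omega>)\<^sup>2 \<partial>M) = \<sigma>\<^sup>2" using normal_distributed_variance[OF \<sigma> X] by (simp add: e)
qed

text \<open>The exponent is a linear combination of the three independent variables with coefficients \<open>a + b\<close>,
  \<open>a\<close> and \<open>b\<close>.  This is the target of the computation with the phases.\<close>

lemma (in prob_space) expectation_iexp_shared_normal:
  fixes \<xi> :: "nat \<Rightarrow> 'a \<Rightarrow> real"
  assumes \<tau>: "0 < \<tau>" and ind: "indep_vars (\<lambda>_. borel) \<xi> {0, 1, 2}"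
    and \<xi>: "distributed M lborel (\<xi> 0) (normal_density 0 (sqrt \<tau>))"
    "distributed M lborel (\<xi> 1) (normal_density 0 (sqrt (\<tau> / 2)))"
    "distributed M lborel (\<xi> 2) (normal_density 0 (sqrt (\<tau> / 2)))"
  shows "(\<integral>x. iexp (a * (\<xi> 0 x + \<xi> 1 x) + b * (\<xi> 0 x + \<xi> 2 x)) \<partial>M)
    = exp (- (((a + b)\<^sup>2 + (a\<^sup>2 + b\<^sup>2) / 2) / 2 * \<tau>))"
proof -
  define w where "w i = (if i = 0 then a + b else if i = 1 then a else b)" for i :: nat
  have ind': "indep_vars (\<lambda>_. borel) (\<lambda>i x. iexp (w i * \<xi> i x)) {0, 1, 2}"
    by (rule indep_vars_compose2[OF ind]) simp
  have "(\<integral>x. (\<Prod>i\<in>{0, 1, 2}. iexp (w i * \<xi> i x)) \<partial>M) = (\<Prod>i\<in>{0, 1, 2}. \<integral>x. iexp (w i * \<xi> i x) \<partial>M)"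
  proof (rule indep_vars_lebesgue_integral[OF _ ind'])
    fix i :: nat assume "i \<in> {0, 1, 2}"
    then have "\<xi> i \<in> borel_measurable M" using ind by (auto simp: indep_vars_def)
    then show "integrable M (\<lambda>x. iexp (w i * \<xi> i x))" by (intro integrable_const_bound[where B=1]) auto
  qed simp
  also have "\<dots> = (\<integral>x. iexp (w 0 * \<xi> 0 x) \<partial>M) * ((\<integral>x. iexp (w 1 * \<xi> 1 x) \<partial>M) * (\<integral>x. iexp (w 2 * \<xi> 2 x) \<partial>M))"
    by (subst prod.insert, simp, simp)+ simp
  also have "\<dots> = exp (- (\<tau> * (a + b)\<^sup>2 / 2)) * (exp (- (\<tau> / 2 * a\<^sup>2 / 2)) * exp (- (\<tau> / 2 * b\<^sup>2 / 2)))"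
    using \<tau> by (subst expectation_iexp_normal[OF \<xi>(1)] expectation_iexp_normal[OF \<xi>(2)]
        expectation_iexp_normal[OF \<xi>(3)],
      simp)+ (simp add: w_def)
  also have "\<dots> = exp (- (((a + b)\<^sup>2 + (a\<^sup>2 + b\<^sup>2) / 2) / 2 * \<tau>))"
    unfolding of_real_mult[symmetric] exp_add[symmetric] by (simp add: field_simps)
  finally show ?thesis
    by (simp add: w_def exp_add[symmetric] algebra_simps)
qed

lemma (in prob_space) indep_normal_sum_distributed:
  fixes \<xi> :: "nat \<Rightarrow> 'a \<Rightarrow> real"
  assumes ind: "indep_vars (\<lambda>_. borel) \<xi> I" and i: "i \<in> I" "j \<in> I" "i \<noteq> j" and s: "0 < s" "0 < r"
    and d: "distributed M lborel (\<xi> i) (normal_density 0 s)"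
        "distributed M lborel (\<xi> j) (normal_density 0 r)"
  shows "distributed M lborel (\<lambda>x. \<xi> i x + \<xi> j x) (normal_density 0 (sqrt (s\<^sup>2 + r\<^sup>2)))"
proof -
  have "indep_vars (\<lambda>_. borel) \<xi> {i, j}" by (rule indep_vars_subset[OF ind]) (use i in auto)
  then have "distributed M lborel (\<lambda>x. \<Sum>k\<in>{i, j}. \<xi> k x)
      (normal_density (\<Sum>k\<in>{i, j}. 0) (sqrt (\<Sum>k\<in>{i, j}. (if k = i then s else r)\<^sup>2)))"
    using i s d by (intro sum_indep_normal) auto
  then show ?thesis using i by simp
qed

section \<open>Increments of the driving noise\<close>

text \<open>Expressing the increment of \<open>W\<close> as a function of the three real increments makes it independent of
  the past.\<close>

definition complex_increment :: "real \<times> real \<times> real \<Rightarrow> complex" where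
  "complex_increment p = (1 / complex_of_real (sqrt 2)) * (complex_of_real (fst (snd p))
      + \<i> * complex_of_real (snd (snd p)))"

lemma borel_measurable_complex_increment [measurable]: "complex_increment \<in> borel_measurable borel"
  unfolding complex_increment_def[abs_def] by (intro borel_measurable_continuous_onI continuous_intros)

lemma integrable_bounded_mult:
  fixes X Y :: "'a \<Rightarrow> complex"
  assumes "X \<in> borel_measurable M" "\<And>\<omega>. \<omega> \<in> space M \<Longrightarrow> norm (X \<omega>) \<le> C" "integrable M Y"
  shows "integrable M (\<lambda>\<omega>. X \<omega> * Y \<omega>)"
proof (rule Bochner_Integration.integrable_bound[of M "\<lambda>\<omega>. C * norm (Y \<omega>)"])
  show "(\<lambda>\<omega>. X \<omega> * Y \<omega>) \<in> borel_measurable M" using assms by measurable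
  show "AE \<omega> in M. norm (X \<omega> * Y \<omega>) \<le> norm (C * norm (Y \<omega>))"
    using assms(2) by (intro AE_I2)
        (auto simp: norm_mult intro!: mult_right_mono order_trans[OF _ abs_ge_self])
qed (use assms in auto)

locale noise = prob_space M
  for M :: "'a measure" +
  fixes F :: "real \<Rightarrow> 'a measure" and B B2 B3 :: "real \<Rightarrow> 'a \<Rightarrow> real"
  assumes filt: "filtration_on M F" and drive: "driving_noise M F B B2 B3"

begin

abbreviation W :: "real \<Rightarrow> 'a \<Rightarrow> complex" where "W \<equiv> complex_brownian B2 B3"

abbreviation mean_abs :: "('a \<Rightarrow> complex) \<Rightarrow> ('a \<Rightarrow> complex) \<Rightarrow> ennreal" where
  "mean_abs X Y \<equiv> \<integral>\<^sup>+\<omega>. ennreal (norm (X \<omega> - Y \<omega>)) \<partial>M"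

abbreviation mean_square :: "('a \<Rightarrow> complex) \<Rightarrow> ('a \<Rightarrow> complex) \<Rightarrow> ennreal" where
  "mean_square X Y \<equiv> \<integral>\<^sup>+\<omega>. ennreal ((norm (X \<omega> - Y \<omega>))\<^sup>2) \<partial>M"

abbreviation energy :: "(real \<Rightarrow> 'a \<Rightarrow> complex) \<Rightarrow> (real \<Rightarrow> 'a \<Rightarrow> complex) \<Rightarrow> ennreal" where
  "energy H K \<equiv> \<integral>\<^sup>+\<omega>. (\<integral>\<^sup>+s. ennreal ((norm (H s \<omega> - K s \<omega>))\<^sup>2) \<partial>lborel) \<partial>M"

definition incr :: "real \<Rightarrow> real \<Rightarrow> 'a \<Rightarrow> real \<times> real \<times> real" where
  "incr s t \<omega> = (B t \<omega> - B s \<omega>, B2 t \<omega> - B2 s \<omega>, B3 t \<omega> - B3 s \<omega>)"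

lemma complex_increment_incr: "complex_increment (incr s t \<omega>) = W t \<omega> - W s \<omega>"
  by (simp add: complex_increment_def incr_def complex_brownian_def algebra_simps)

lemma measurable_F_M: "f \<in> measurable (F t) N \<Longrightarrow> f \<in> measurable M N"
  using filt by (intro measurable_from_subalg[of M "F t"]) (simp_all add: filtration_on_def)

lemma space_F: "space (F t) = space M"
  using filt by (simp add: filtration_on_def subalgebra_def)

lemma measurable_F_mono: "f \<in> measurable (F s) N \<Longrightarrow> s \<le> t \<Longrightarrow> f \<in> measurable (F t) N"
  using filt by (intro measurable_from_subalg[of "F t" "F s"])
    (auto simp: filtration_on_def subalgebra_def dest: filtration.sets_F_mono)

lemma brownian: "standard_brownian_motion M B" "standard_brownian_motion M B2"
    "standard_brownian_motion M B3"
  and independent: "independent_processes3 M B B2 B3"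
  and adapted_noise: "adapted F B" "adapted F B2" "adapted F B3"
  and indep_incr: "\<And>s t. 0 \<le> s \<Longrightarrow> s < t \<Longrightarrow>
    indep_set (sets (F s)) (sets (vimage_algebra (space M) (incr s t) borel))"
  using drive unfolding driving_noise_def incr_def[abs_def] by auto

lemma noise_measurable_F:
  assumes "0 \<le> s" "s \<le> t"
  shows "B s \<in> borel_measurable (F t)" "B2 s \<in> borel_measurable (F t)" "B3 s \<in> borel_measurable (F t)"
  using adapted_noise assms by (auto simp: adapted_def intro: measurable_F_mono)

lemma W_measurable_F: "0 \<le> s \<Longrightarrow> s \<le> t \<Longrightarrow> W s \<in> borel_measurable (F t)"
  unfolding complex_brownian_def[abs_def] using noise_measurable_F[of s t] by measurable

lemma W_measurable [measurable]: "0 \<le> s \<Longrightarrow> W s \<in> borel_measurable M"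
  using W_measurable_F[of s s] measurable_F_M by blast

lemma incr_measurable: "0 \<le> s \<Longrightarrow> s \<le> t \<Longrightarrow> incr s t \<in> borel_measurable M"
  unfolding incr_def[abs_def] using noise_measurable_F[of s t, THEN measurable_F_M]
    noise_measurable_F[of t t, THEN measurable_F_M] by measurable

text \<open>Independence of the past and of the increments, assumed for sigma-algebras, is transferred to random
  variables.\<close>

lemma indep_var_incr:
  assumes st: "0 \<le> s" "s < t" and X: "X \<in> measurable (F s) S" and g: "g \<in> measurable borel T"
  shows "indep_var S X T (\<lambda>\<omega>. g (incr s t \<omega>))"
  unfolding indep_var_eq
proof (intro conjI)
  show "X \<in> measurable M S" using X by (rule measurable_F_M)
  have im: "incr s t \<in> borel_measurable M" using st by (intro incr_measurable) auto
  show "(\<lambda>\<omega>. g (incr s t \<omega>)) \<in> measurable M T" using measurable_compose[OF im g] .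
  have iv: "incr s t \<in> measurable (vimage_algebra (space M) (incr s t) borel) borel"
    by (rule measurable_vimage_algebra1) auto
  have "sigma_sets (space M) {X -` A \<inter> space M |A. A \<in> sets S} \<subseteq> sets (F s)"
    using measurable_sets[OF X] space_F[of s] by
        (intro sets.sigma_sets_subset[of _ "F s", unfolded space_F]) auto
  moreover have "sigma_sets (space M) {(\<lambda>\<omega>. g (incr s t \<omega>)) -` A \<inter> space M |A. A \<in> sets T}
      \<subseteq> sets (vimage_algebra (space M) (incr s t) borel)"
    using measurable_sets[OF measurable_compose[OF iv g]]
    by (intro sets.sigma_sets_subset[of _ "vimage_algebra (space M) (incr s t) borel", unfolded space_vimage_algebra]) auto
  ultimately show "indep_set (sigma_sets (space M) {X -` A \<inter> space M |A. A \<in> sets S})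
    (sigma_sets (space M) {(\<lambda>\<omega>. g (incr s t \<omega>)) -` A \<inter> space M |A. A \<in> sets T})"
    using indep_incr[OF st] unfolding indep_set_def
    by (rule_tac indep_sets_mono_sets) (auto split: bool.split)
qed

lemma incr_normal:
  assumes "0 \<le> s" "s < t"
  shows "distributed M lborel (\<lambda>\<omega>. B t \<omega> - B s \<omega>) (normal_density 0 (sqrt (t - s)))"
    "distributed M lborel (\<lambda>\<omega>. B2 t \<omega> - B2 s \<omega>) (normal_density 0 (sqrt (t - s)))"
    "distributed M lborel (\<lambda>\<omega>. B3 t \<omega> - B3 s \<omega>) (normal_density 0 (sqrt (t - s)))"
  using brownian assms by (simp_all add: standard_brownian_motion_def)

text \<open>Independence of the three paths is inherited by their increments, which are measurable functions
  of the paths.\<close>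

lemma indep_incr_components:
  assumes "0 \<le> s" "0 \<le> t" and h: "\<And>i. h i \<in> measurable borel T"
  shows "indep_vars (\<lambda>_. T) (\<lambda>i \<omega>. h i (([B, B2, B3] ! i) t \<omega> - ([B, B2, B3] ! i) s \<omega>)) {..<3::nat}"
proof -
  have "indep_vars (\<lambda>_. T) (\<lambda>i \<omega>. (\<lambda>p. h i (p t - p s)) (\<lambda>t\<in>{0..}. ([B, B2, B3] ! i) t \<omega>)) {..<3::nat}"
  proof (rule indep_vars_compose2[where M'="\<lambda>_. Pi\<^sub>M {0..} (\<lambda>_. borel)"
        and X="\<lambda>i \<omega>. \<lambda>t\<in>{0..}. ([B, B2, B3] ! i) t \<omega>" and Y="\<lambda>i p. h i (p t - p s)"])
    show "indep_vars (\<lambda>_. Pi\<^sub>M {0..} (\<lambda>_. borel)) (\<lambda>i \<omega>. \<lambda>t\<in>{0..}. ([B, B2, B3] ! i) t \<omega>) {..<3::nat}"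
      using independent unfolding independent_processes3_def .
    fix i :: nat
    have "(\<lambda>p. p t - p s) \<in> borel_measurable (Pi\<^sub>M {0..} (\<lambda>_. borel :: real measure))"
      using assms by (intro borel_measurable_diff measurable_component_singleton) auto
    then show "(\<lambda>p. h i (p t - p s)) \<in> measurable (Pi\<^sub>M {0..} (\<lambda>_. borel)) T"
      using h by (rule measurable_compose)
  qed
  then show ?thesis using assms by simp
qed

lemma expectation_iexp_incr:
  assumes st: "0 \<le> s" "s < t"
  shows "(\<integral>\<omega>. iexp (x * (B t \<omega> - B s \<omega>) + y * (B2 t \<omega> - B2 s \<omega>) + z * (B3 t \<omega> - B3 s \<omega>)) \<partial>M)
    = exp (- ((x\<^sup>2 + y\<^sup>2 + z\<^sup>2) / 2 * (t - s)))"
proof -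
  let ?X = "\<lambda>i \<omega>. iexp (([x, y, z] ! i) * (([B, B2, B3] ! i) t \<omega> - ([B, B2, B3] ! i) s \<omega>))"
  have 3: "{..<3::nat} = {0, 1, 2}" by auto
  have ind: "indep_vars (\<lambda>_. borel) ?X {..<3::nat}"
    using st by (intro indep_incr_components[where h="\<lambda>i u. iexp (([x, y, z] ! i) * u)"]) auto
  have "?X i \<in> borel_measurable M" if "i < 3" for i
    using ind that unfolding indep_vars_def by auto
  then have int: "integrable M (?X i)" if "i \<in> {..<3}" for i
    using that by (intro integrable_const_bound[where B=1]) auto
  have "(\<integral>\<omega>. (\<Prod>i<3. ?X i \<omega>) \<partial>M) = (\<Prod>i<3. \<integral>\<omega>. ?X i \<omega> \<partial>M)"
    using ind int by (intro indep_vars_lebesgue_integral) auto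
  also have "\<dots> = exp (- (x\<^sup>2 / 2 * (t - s))) * exp (- (y\<^sup>2 / 2 * (t - s))) * exp (- (z\<^sup>2 / 2 * (t - s)))"
    unfolding 3 using expectation_iexp_normal[OF incr_normal(1)[OF st]]
        expectation_iexp_normal[OF incr_normal(2)[OF st]]
      expectation_iexp_normal[OF incr_normal(3)[OF st]] st
    by (simp add: ac_simps)
  also have "\<dots> = exp (- ((x\<^sup>2 + y\<^sup>2 + z\<^sup>2) / 2 * (t - s)))"
    by (simp add: exp_add[symmetric] field_simps)
  finally show ?thesis
    unfolding 3 by (simp add: exp_add[symmetric] algebra_simps)
qed

lemma expectation_mult_incr:
  fixes X :: "'a \<Rightarrow> complex" and g :: "real \<times> real \<times> real \<Rightarrow> complex"
  assumes st: "0 \<le> s" "s < t" and X: "X \<in> borel_measurable (F s)" "integrable M X"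
    and g: "g \<in> borel_measurable borel" "integrable M (\<lambda>\<omega>. g (incr s t \<omega>))"
  shows "integrable M (\<lambda>\<omega>. X \<omega> * g (incr s t \<omega>))"
    and "(\<integral>\<omega>. X \<omega> * g (incr s t \<omega>) \<partial>M) = (\<integral>\<omega>. X \<omega> \<partial>M) * (\<integral>\<omega>. g (incr s t \<omega>) \<partial>M)"
  by (rule indep_var_integrable[OF indep_var_incr[OF st X(1) g(1)] X(2) g(2)],
      rule indep_var_lebesgue_integral[OF indep_var_incr[OF st X(1) g(1)] X(2) g(2)])

lemma W_incr_moments:
  assumes st: "0 \<le> s" "s < t"
  shows "integrable M (\<lambda>\<omega>. W t \<omega> - W s \<omega>)" "(\<integral>\<omega>. W t \<omega> - W s \<omega> \<partial>M) = 0"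
    "integrable M (\<lambda>\<omega>. (W t \<omega> - W s \<omega>) * cnj (W t \<omega> - W s \<omega>))"
    "(\<integral>\<omega>. (W t \<omega> - W s \<omega>) * cnj (W t \<omega> - W s \<omega>) \<partial>M) = t - s"
proof -
  have \<sigma>: "0 < sqrt (t - s)" using st by simp
  note m2 = normal_moments[OF incr_normal(2)[OF st] \<sigma>] and m3 = normal_moments[OF incr_normal(3)[OF st] \<sigma>]
  have W: "W t \<omega> - W s \<omega> = complex_of_real (B2 t \<omega> - B2 s \<omega>) / complex_of_real (sqrt 2)
     + \<i> / complex_of_real (sqrt 2) * complex_of_real (B3 t \<omega> - B3 s \<omega>)" for \<omega>
    by (simp add: complex_brownian_def field_simps)
  have W2: "(W t \<omega> - W s \<omega>) * cnj (W t \<omega> - W s \<omega>) = complex_of_real (((B2 t \<omega> - B2 s \<omega>)\<^sup>2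
      + (B3 t \<omega> - B3 s \<omega>)\<^sup>2) / 2)" for \<omega>
    unfolding complex_norm_square[symmetric] W cmod_power2
    by (simp add: power_divide add_divide_distrib Re_divide_of_real Im_divide_of_real)
  show "integrable M (\<lambda>\<omega>. W t \<omega> - W s \<omega>)" "(\<integral>\<omega>. W t \<omega> - W s \<omega> \<partial>M) = 0"
    unfolding W using m2(1,3) m3(1,3)
    by (simp_all del: of_real_diff add: Bochner_Integration.integral_add)
  show "integrable M (\<lambda>\<omega>. (W t \<omega> - W s \<omega>) * cnj (W t \<omega> - W s \<omega>))"
    "(\<integral>\<omega>. (W t \<omega> - W s \<omega>) * cnj (W t \<omega> - W s \<omega>) \<partial>M) = t - s"
    unfolding W2 using m2(2,4) m3(2,4) st by (simp_all del: of_real_diff of_real_divide)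
qed

text \<open>By independence of the past, increments of \<open>W\<close> have conditional mean zero and conditional second
  moment \<open>t - s\<close>.\<close>

lemma expectation_mult_W_incr:
  fixes X :: "'a \<Rightarrow> complex"
  assumes st: "0 \<le> s" "s \<le> t" and X: "X \<in> borel_measurable (F s)" "integrable M X"
  shows "integrable M (\<lambda>\<omega>. X \<omega> * (W t \<omega> - W s \<omega>))" (is ?a)
    and "integrable M (\<lambda>\<omega>. X \<omega> * cnj (W t \<omega> - W s \<omega>))" (is ?b)
    and "integrable M (\<lambda>\<omega>. X \<omega> * ((W t \<omega> - W s \<omega>) * cnj (W t \<omega> - W s \<omega>)))" (is ?c)
    and "(\<integral>\<omega>. X \<omega> * (W t \<omega> - W s \<omega>) \<partial>M) = 0" (is ?d)
    and "(\<integral>\<omega>. X \<omega> * cnj (W t \<omega> - W s \<omega>) \<partial>M) = 0" (is ?e)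
    and "(\<integral>\<omega>. X \<omega> * ((W t \<omega> - W s \<omega>) * cnj (W t \<omega> - W s \<omega>)) \<partial>M) = (\<integral>\<omega>. X \<omega> \<partial>M) * (t - s)" (is ?f)
proof -
  have "?a \<and> ?b \<and> ?c \<and> ?d \<and> ?e \<and> ?f"
  proof (cases "s = t")
    case False
    then have st': "0 \<le> s" "s < t" using st by auto
    note w = W_incr_moments[OF st']
    have m[measurable]: "cnj \<in> borel_measurable borel"
      by (intro borel_measurable_continuous_onI continuous_intros)
    have c: "integrable M (\<lambda>\<omega>. cnj (W t \<omega> - W s \<omega>))" "(\<integral>\<omega>. cnj (W t \<omega> - W s \<omega>) \<partial>M) = 0"
      unfolding complex_integrable_cnj Bochner_Integration.integral_cnj w(2) using w(1) by simp_all
    show ?thesis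
      using expectation_mult_incr[OF st' X, of complex_increment]
          expectation_mult_incr[OF st' X, of "\<lambda>p. cnj (complex_increment p)"]
        expectation_mult_incr[OF st' X, of "\<lambda>p. complex_increment p * cnj (complex_increment p)"] w c
      by (simp add: complex_increment_incr)
  qed simp
  then show ?a ?b ?c ?d ?e ?f by auto
qed

end

section \<open>The Ito isometry\<close>

abbreviation cutoff :: "real \<Rightarrow> (real \<Rightarrow> 'a \<Rightarrow> complex) \<Rightarrow> real \<Rightarrow> 'a \<Rightarrow> complex" where
  "cutoff T H \<equiv> \<lambda>s \<omega>. indicator {0..T} s * H s \<omega>"

text \<open>The length of the intersection of the intervals from \<open>a\<close> to \<open>b\<close> and from \<open>c\<close> to \<open>d\<close>.\<close>

definition overlap :: "real \<Rightarrow> real \<Rightarrow> real \<Rightarrow> real \<Rightarrow> real" where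
  "overlap a b c d = max 0 (min b d - max a c)"

lemma integral_indicator_overlap:
  shows "integrable lborel (\<lambda>s. indicator {a<..b} s * indicator {c<..d} s :: complex)"
    and "(\<integral>s. indicator {a<..b} s * indicator {c<..d} s \<partial>lborel) = complex_of_real (overlap a b c d)"
proof -
  have e: "indicator {a<..b} s * indicator {c<..d} s
      = complex_of_real (indicator {max a c<..min b d} s)" for s
    by (auto simp: indicator_def)
  have fin: "emeasure lborel {max a c<..min b d} < \<infinity>"
    by (cases "max a c \<le> min b d") (auto simp: emeasure_lborel_Ioc)
  have "measure lborel {max a c<..min b d} = overlap a b c d"
    by (cases "max a c \<le> min b d") (auto simp: overlap_def)
  then show "integrable lborel (\<lambda>s. indicator {a<..b} s * indicator {c<..d} s :: complex)"
    and "(\<integral>s. indicator {a<..b} s * indicator {c<..d} s \<partial>lborel) = complex_of_real (overlap a b c d)"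
    unfolding e using fin by simp_all
qed

lemma nn_integral_complex_norm_square:
  assumes "integrable P (\<lambda>x. f x * cnj (f x))"
  shows "(\<integral>\<^sup>+x. ennreal ((norm (f x))\<^sup>2) \<partial>P) = ennreal (Re (\<integral>x. f x * cnj (f x) \<partial>P))"
proof -
  have i: "integrable P (\<lambda>x. (norm (f x))\<^sup>2)"
    using assms unfolding complex_norm_square[symmetric] complex_of_real_integrable_eq .
  have "(\<integral>x. f x * cnj (f x) \<partial>P) = complex_of_real (\<integral>x. (norm (f x))\<^sup>2 \<partial>P)"
    unfolding complex_norm_square[symmetric] by (simp flip: of_real_power)
  then show ?thesis using nn_integral_eq_integral[OF i] by simp
qed

lemma norm_diff_square_le3:
  fixes x y z w :: complex
  shows "ennreal ((norm (x - w))\<^sup>2) \<le> 3 * (ennreal ((norm (x - y))\<^sup>2) + ennreal ((norm (y - z))\<^sup>2)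
      + ennreal ((norm (w - z))\<^sup>2))"
proof -
  have 3: "(p + q + r)\<^sup>2 \<le> 3 * (p\<^sup>2 + q\<^sup>2 + r\<^sup>2)" for p q r :: real
    using sum_squares_ge_zero[of "p - q" "q - r"] zero_le_power2[of "p - r"]
    by (simp add: power2_eq_square algebra_simps)
  have "norm (x - w) \<le> norm (x - y) + norm (y - z) + norm (w - z)"
    using norm_triangle_ineq[of "(x - y) + (y - z)" "z - w"] norm_triangle_ineq[of "x - y" "y - z"]
    by (simp add: norm_minus_commute)
  then have "(norm (x - w))\<^sup>2 \<le> (norm (x - y) + norm (y - z) + norm (w - z))\<^sup>2" by (intro power_mono) auto
  also note 3
  finally have "ennreal ((norm (x - w))\<^sup>2) \<le> ennreal (3 * ((norm (x - y))\<^sup>2 + (norm (y - z))\<^sup>2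
      + (norm (w - z))\<^sup>2))"
    by (rule ennreal_leI)
  then show ?thesis by (simp add: ennreal_mult ennreal_plus)
qed

lemma nn_integral_norm_diff_square_le3:
  fixes x y z w :: "'x \<Rightarrow> complex"
  assumes [measurable]: "x \<in> borel_measurable P" "y \<in> borel_measurable P" "z \<in> borel_measurable P"
      "w \<in> borel_measurable P"
  shows "(\<integral>\<^sup>+u. ennreal ((norm (x u - w u))\<^sup>2) \<partial>P) \<le>
    3 * ((\<integral>\<^sup>+u. ennreal ((norm (x u - y u))\<^sup>2) \<partial>P) + (\<integral>\<^sup>+u. ennreal ((norm (y u - z u))\<^sup>2) \<partial>P)
        + (\<integral>\<^sup>+u. ennreal ((norm (w u - z u))\<^sup>2) \<partial>P))"
proof -
  have "(\<integral>\<^sup>+u. ennreal ((norm (x u - w u))\<^sup>2) \<partial>P) \<le> (\<integral>\<^sup>+u. 3 * (ennreal ((norm (x u - y u))\<^sup>2)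
      + ennreal ((norm (y u - z u))\<^sup>2) + ennreal ((norm (w u - z u))\<^sup>2)) \<partial>P)"
    by (intro nn_integral_mono norm_diff_square_le3)
  also have "\<dots> = 3 * ((\<integral>\<^sup>+u. ennreal ((norm (x u - y u))\<^sup>2) \<partial>P) + (\<integral>\<^sup>+u. ennreal ((norm (y u - z u))\<^sup>2) \<partial>P)
      + (\<integral>\<^sup>+u. ennreal ((norm (w u - z u))\<^sup>2) \<partial>P))"
    by (subst nn_integral_cmult) (auto simp: nn_integral_add)
  finally show ?thesis .
qed

context noise
begin

lemma cross_term_ordered:
  fixes Z :: "'a \<Rightarrow> complex"
  assumes ab: "0 \<le> a" "a \<le> b" and cd: "a \<le> c" "c \<le> d"
    and Z: "Z \<in> borel_measurable (F c)" "\<And>\<omega>. \<omega> \<in> space M \<Longrightarrow> norm (Z \<omega>) \<le> C"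
  shows "integrable M (\<lambda>\<omega>. Z \<omega> * ((W b \<omega> - W a \<omega>) * cnj (W d \<omega> - W c \<omega>)))" (is ?able)
    and "(\<integral>\<omega>. Z \<omega> * ((W b \<omega> - W a \<omega>) * cnj (W d \<omega> - W c \<omega>)) \<partial>M) = (\<integral>\<omega>. Z \<omega> \<partial>M) * overlap a b c d" (is ?int)
proof -
  have ZM: "Z \<in> borel_measurable M" using Z(1) by (rule measurable_F_M)
  have Zi: "integrable M Z" using ZM Z(2) by (intro integrable_const_bound[where B=C]) auto
  have Wi: "integrable M (\<lambda>\<omega>. W v \<omega> - W u \<omega>)" "integrable M (\<lambda>\<omega>. cnj (W v \<omega> - W u \<omega>))" if "0 \<le> u" "u
      \<le> v" for u v
    by (rule expectation_mult_W_incr(1)[OF that borel_measurable_const integrable_const, of 1, unfolded mult_1_left],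
        rule expectation_mult_W_incr(2)[OF that borel_measurable_const integrable_const, of 1, unfolded mult_1_left])
  have ZW: "integrable M (\<lambda>\<omega>. Z \<omega> * (W v \<omega> - W u \<omega>))" "integrable M (\<lambda>\<omega>. Z \<omega> * cnj (W v \<omega> - W u \<omega>))"
      if "0 \<le> u" "u \<le> v" for u v
    by (rule integrable_bounded_mult[OF ZM Z(2) Wi(1)[OF that]], assumption,
        rule integrable_bounded_mult[OF ZM Z(2) Wi(2)[OF that]], assumption)
  have [measurable]: "cnj \<in> borel_measurable borel"
    by (intro borel_measurable_continuous_onI continuous_intros)
  have ZWm: "(\<lambda>\<omega>. Z \<omega> * (W v \<omega> - W u \<omega>)) \<in> borel_measurable (F e)"
      "(\<lambda>\<omega>. Z \<omega> * cnj (W v \<omega> - W u \<omega>)) \<in> borel_measurable (F e)"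
    if "0 \<le> u" "u \<le> e" "0 \<le> v" "v \<le> e" "c \<le> e" for u v e
    using W_measurable_F[of u e] W_measurable_F[of v e] that measurable_F_mono[OF Z(1), of e] by measurable
  have "?able \<and> ?int"
  proof (cases "b \<le> c")
    case True
    then have "overlap a b c d = 0" using ab cd by (auto simp: overlap_def)
    then show ?thesis
      using expectation_mult_W_incr(2,5)[of c d "\<lambda>\<omega>. Z \<omega> * (W b \<omega> - W a \<omega>)"] ZW(1)[of a b]
          ZWm(1)[of a c b] True ab cd
      by (simp add: mult.assoc)
  next
    case False
    define m where "m = min b d"
    have m: "c \<le> m" "m \<le> b" "m \<le> d" "b = m \<or> d = m" "0 \<le> c" "0 \<le> m" using False ab cd by (auto simp: m_def)
    have ov: "overlap a b c d = m - c" using False ab cd by (auto simp: overlap_def m_def)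
    \<comment> \<open>Cut both increments at \<open>c\<close> and at \<open>m\<close>.  The square of the common part survives; in each other
      product the later factor has mean zero given the past.  The product of the two parts after \<open>m\<close>
      is absent because one of them is empty.\<close>
    have "Z \<omega> * ((W b \<omega> - W a \<omega>) * cnj (W d \<omega> - W c \<omega>)) =
      Z \<omega> * (W c \<omega> - W a \<omega>) * cnj (W d \<omega> - W c \<omega>)
      + Z \<omega> * ((W m \<omega> - W c \<omega>) * cnj (W m \<omega> - W c \<omega>))
      + Z \<omega> * (W m \<omega> - W c \<omega>) * cnj (W d \<omega> - W m \<omega>)
      + Z \<omega> * cnj (W m \<omega> - W c \<omega>) * (W b \<omega> - W m \<omega>)" for \<omega>
      using m(4) by (elim disjE) (simp_all add: algebra_simps)
    moreover note t1 = expectation_mult_W_incr(2,5)[of c d "\<lambda>\<omega>. Z \<omega> * (W c \<omega> - W a \<omega>)",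
        OF m(5) cd(2) ZWm(1)[of a c c] ZW(1)[of a c]]
    moreover note t2 = expectation_mult_W_incr(3,6)[of c m Z, OF m(5,1) Z(1) Zi]
    moreover note t3 = expectation_mult_W_incr(2,5)[of m d "\<lambda>\<omega>. Z \<omega> * (W m \<omega> - W c \<omega>)",
        OF m(6,3) ZWm(1)[of c m m] ZW(1)[of c m]]
    moreover note t4 = expectation_mult_W_incr(1,4)[of m b "\<lambda>\<omega>. Z \<omega> * cnj (W m \<omega> - W c \<omega>)",
        OF m(6,2) ZWm(2)[of c m m] ZW(2)[of c m]]
    ultimately show ?thesis
      using ab cd m unfolding ov by (simp del: of_real_diff complex_cnj_diff)
  qed
  then show ?able ?int by auto
qed

text \<open>The isometry is bilinear, so it suffices to treat one interval in each factor.  Allowing the two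
  intervals to be in arbitrary position removes the need for a common refinement of partitions.\<close>

lemma cross_term:
  fixes X Y :: "'a \<Rightarrow> complex"
  assumes ab: "0 \<le> a" "a \<le> b" and cd: "0 \<le> c" "c \<le> d"
    and X: "X \<in> borel_measurable (F a)" "\<And>\<omega>. \<omega> \<in> space M \<Longrightarrow> norm (X \<omega>) \<le> C"
    and Y: "Y \<in> borel_measurable (F c)" "\<And>\<omega>. \<omega> \<in> space M \<Longrightarrow> norm (Y \<omega>) \<le> D"
  shows "integrable M (\<lambda>\<omega>. X \<omega> * cnj (Y \<omega>) * ((W b \<omega> - W a \<omega>) * cnj (W d \<omega> - W c \<omega>)))" (is ?a)
    and "(\<integral>\<omega>. X \<omega> * cnj (Y \<omega>) * ((W b \<omega> - W a \<omega>) * cnj (W d \<omega> - W c \<omega>)) \<partial>M)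
       = (\<integral>\<omega>. X \<omega> * cnj (Y \<omega>) \<partial>M) * overlap a b c d" (is ?b)
proof -
  have [measurable]: "cnj \<in> borel_measurable borel"
    by (intro borel_measurable_continuous_onI continuous_intros)
  have bd: "norm (X \<omega> * cnj (Y \<omega>)) \<le> C * D" "norm (Y \<omega> * cnj (X \<omega>)) \<le> C * D" if "\<omega> \<in> space M" for \<omega>
  proof -
    have "norm (X \<omega>) * norm (Y \<omega>) \<le> C * D"
      using X(2)[OF that] Y(2)[OF that] order_trans[OF norm_ge_zero X(2)[OF that]] by (intro mult_mono) auto
    then show "norm (X \<omega> * cnj (Y \<omega>)) \<le> C * D" "norm (Y \<omega> * cnj (X \<omega>)) \<le> C * D"
      by (auto simp: norm_mult mult.commute)
  qed
  have "?a \<and> ?b"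
  proof (cases "a \<le> c")
    case True
    have "(\<lambda>\<omega>. X \<omega> * cnj (Y \<omega>)) \<in> borel_measurable (F c)"
      using measurable_F_mono[OF X(1) True] Y(1) by measurable
    then show ?thesis using cross_term_ordered[OF ab True cd(2) _ bd(1)] by auto
  next
    case False
    then have ca: "c \<le> a" by simp
    have "(\<lambda>\<omega>. Y \<omega> * cnj (X \<omega>)) \<in> borel_measurable (F a)"
      using measurable_F_mono[OF Y(1) ca] X(1) by measurable
    note * = cross_term_ordered[OF cd ca ab(2) this bd(2)]
    have e: "X \<omega> * cnj (Y \<omega>) * ((W b \<omega> - W a \<omega>) * cnj (W d \<omega> - W c \<omega>))
       = cnj (Y \<omega> * cnj (X \<omega>) * ((W d \<omega> - W c \<omega>) * cnj (W b \<omega> - W a \<omega>)))" for \<omega> by (simp add: ac_simps)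
    have e2: "X \<omega> * cnj (Y \<omega>) = cnj (Y \<omega> * cnj (X \<omega>))" for \<omega> by (simp add: ac_simps)
    have ov: "overlap a b c d = overlap c d a b" by (simp add: overlap_def ac_simps)
    show ?thesis unfolding e unfolding e2 Bochner_Integration.integral_cnj complex_integrable_cnj ov
        using * by simp
  qed
  then show ?a ?b by auto
qed

text \<open>A finite family of half-open intervals, possibly overlapping or empty, each with a bounded value
  known at its left end.  Unlike the partitions of elementary integrands, such families can be added
  by taking the disjoint union of the index sets.\<close>

definition simple_data :: "'i set \<Rightarrow> ('i \<Rightarrow> real) \<Rightarrow> ('i \<Rightarrow> real) \<Rightarrow> ('i \<Rightarrow> 'a \<Rightarrow> complex) \<Rightarrow> bool" where
  "simple_data I a b c \<longleftrightarrow> finite I \<and> (\<forall>i\<in>I. 0 \<le> a i \<and> a i \<le> b i \<and> c i \<in> borel_measurable (F (a i)) \<and>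
     (\<exists>C. \<forall>\<omega>\<in>space M. norm (c i \<omega>) \<le> C))"

definition simple_process :: "'i set \<Rightarrow> ('i \<Rightarrow> real) \<Rightarrow> ('i \<Rightarrow> real) \<Rightarrow> ('i \<Rightarrow> 'a \<Rightarrow> complex) \<Rightarrow> real \<Rightarrow> 'a \<Rightarrow> complex" where
  "simple_process I a b c s \<omega> = (\<Sum>i\<in>I. c i \<omega> * indicator {a i<..b i} s)"

definition simple_integral :: "'i set \<Rightarrow> ('i \<Rightarrow> real) \<Rightarrow> ('i \<Rightarrow> real) \<Rightarrow> ('i \<Rightarrow> 'a \<Rightarrow> complex) \<Rightarrow> 'a \<Rightarrow> complex" where
  "simple_integral I a b c \<omega> = (\<Sum>i\<in>I. c i \<omega> * (W (b i) \<omega> - W (a i) \<omega>))"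

lemma simple_integral_measurable:
  "simple_data I a b c \<Longrightarrow> simple_integral I a b c \<in> borel_measurable M"
  unfolding simple_integral_def[abs_def] simple_data_def
  by (intro borel_measurable_sum borel_measurable_times borel_measurable_diff W_measurable)
     (auto intro: measurable_F_M)

lemma simple_process_measurable:
  assumes "simple_data I a b c"
  shows "(\<lambda>(s, \<omega>). simple_process I a b c s \<omega>) \<in> borel_measurable (lborel \<Otimes>\<^sub>M M)"
  unfolding simple_process_def split_beta'
proof (intro borel_measurable_sum borel_measurable_times)
  fix i assume i: "i \<in> I"
  have [measurable]: "c i \<in> borel_measurable M" using assms i by
      (auto simp: simple_data_def intro: measurable_F_M)
  show "(\<lambda>x. c i (snd x)) \<in> borel_measurable (lborel \<Otimes>\<^sub>M M)" by measurable
  show "(\<lambda>x. indicator {a i<..b i} (fst x) :: complex) \<in> borel_measurable (lborel \<Otimes>\<^sub>M M)" by measurable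
qed

text \<open>Both sides expand into double sums over the index set, which agree term by term.\<close>

theorem ito_isometry:
  assumes sd: "simple_data I a b c"
  shows "(\<integral>\<^sup>+\<omega>. ennreal ((norm (simple_integral I a b c \<omega>))\<^sup>2) \<partial>M)
    = (\<integral>\<^sup>+\<omega>. (\<integral>\<^sup>+s. ennreal ((norm (simple_process I a b c s \<omega>))\<^sup>2) \<partial>lborel) \<partial>M)"
proof -
  define ov where "ov i j = complex_of_real (overlap (a i) (b i) (a j) (b j))" for i j
  define Q where "Q \<omega> = (\<Sum>i\<in>I. \<Sum>j\<in>I. c i \<omega> * cnj (c j \<omega>) * ov i j)" for \<omega>
  have fin: "finite I" and ab: "\<And>i. i \<in> I \<Longrightarrow> 0 \<le> a i" "\<And>i. i \<in> I \<Longrightarrow> a i \<le> b i"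
    and cF: "\<And>i. i \<in> I \<Longrightarrow> c i \<in> borel_measurable (F (a i))"
    and cb: "\<And>i. i \<in> I \<Longrightarrow> \<exists>C. \<forall>\<omega>\<in>space M. norm (c i \<omega>) \<le> C"
    using sd by (auto simp: simple_data_def)
  have "\<forall>i\<in>I. \<exists>C. \<forall>\<omega>\<in>space M. norm (c i \<omega>) \<le> C" using cb by blast
  then obtain C where C: "\<And>i \<omega>. i \<in> I \<Longrightarrow> \<omega> \<in> space M \<Longrightarrow> norm (c i \<omega>) \<le> C i"
    unfolding bchoice_iff by blast
  have tm: "integrable M (\<lambda>\<omega>. c i \<omega> * cnj (c j \<omega>) * ((W (b i) \<omega> - W (a i) \<omega>) * cnj (W (b j) \<omega> - W (a j) \<omega>)))"
    "(\<integral>\<omega>. c i \<omega> * cnj (c j \<omega>) * ((W (b i) \<omega> - W (a i) \<omega>) * cnj (W (b j) \<omega> - W (a j) \<omega>)) \<partial>M)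
       = (\<integral>\<omega>. c i \<omega> * cnj (c j \<omega>) \<partial>M) * ov i j" if "i \<in> I" "j \<in> I" for i j
    unfolding ov_def
    by (rule cross_term[OF ab(1)[OF that(1)] ab(2)[OF that(1)] ab(1)[OF that(2)] ab(2)[OF that(2)]
          cF[OF that(1)] C[OF that(1)] cF[OF that(2)] C[OF that(2)]], assumption+)+
  have [measurable]: "cnj \<in> borel_measurable borel"
    by (intro borel_measurable_continuous_onI continuous_intros)
  have cM: "c i \<in> borel_measurable M" if "i \<in> I" for i using cF[OF that] by (rule measurable_F_M)
  have ci: "integrable M (\<lambda>\<omega>. c i \<omega> * cnj (c j \<omega>))" if "i \<in> I" "j \<in> I" for i j
  proof (rule integrable_const_bound[where B="C i * C j"])
    show "AE \<omega> in M. norm (c i \<omega> * cnj (c j \<omega>)) \<le> C i * C j"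
    proof (rule AE_I2)
      fix \<omega> assume w: "\<omega> \<in> space M"
      show "norm (c i \<omega> * cnj (c j \<omega>)) \<le> C i * C j"
        unfolding norm_mult complex_mod_cnj
        using C[OF that(1) w] C[OF that(2) w] order_trans[OF norm_ge_zero C[OF that(1) w]] by
            (intro mult_mono) auto
    qed
    show "(\<lambda>\<omega>. c i \<omega> * cnj (c j \<omega>)) \<in> borel_measurable M" using cM that by measurable
  qed
  have Qi: "integrable M Q" "(\<integral>\<omega>. Q \<omega> \<partial>M) = (\<Sum>i\<in>I. \<Sum>j\<in>I. (\<integral>\<omega>. c i \<omega> * cnj (c j \<omega>) \<partial>M) * ov i j)"
    unfolding Q_def using ci by (simp_all add: Bochner_Integration.integral_sum integrable_mult_left)
  let ?S = "simple_integral I a b c"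
  have S2: "?S \<omega> * cnj (?S \<omega>)
      = (\<Sum>i\<in>I. \<Sum>j\<in>I. c i \<omega> * cnj (c j \<omega>) * ((W (b i) \<omega> - W (a i) \<omega>) * cnj (W (b j) \<omega> - W (a j) \<omega>)))" for \<omega>
    unfolding simple_integral_def cnj_sum sum_product complex_cnj_mult
    by (intro sum.cong refl) (simp only: mult.assoc mult.left_commute)
  have Si: "integrable M (\<lambda>\<omega>. ?S \<omega> * cnj (?S \<omega>))"
    unfolding S2 by (intro Bochner_Integration.integrable_sum tm)
  have SE: "(\<integral>\<omega>. ?S \<omega> * cnj (?S \<omega>) \<partial>M) = (\<integral>\<omega>. Q \<omega> \<partial>M)"
    unfolding S2 Qi(2)
    by (subst Bochner_Integration.integral_sum, intro Bochner_Integration.integrable_sum tm, assumption+, intro sum.cong refl,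
        subst Bochner_Integration.integral_sum, intro tm, assumption+, intro sum.cong refl tm(2), assumption+)
  let ?P = "simple_process I a b c"
  have P2: "?P s \<omega> * cnj (?P s \<omega>)
      = (\<Sum>i\<in>I. \<Sum>j\<in>I. c i \<omega> * cnj (c j \<omega>) * (indicator {a i<..b i} s * indicator {a j<..b j} s))" for s \<omega>
    unfolding simple_process_def cnj_sum sum_product complex_cnj_mult
    by (intro sum.cong refl) (auto simp: indicator_def)
  have Pi: "integrable lborel (\<lambda>s. ?P s \<omega> * cnj (?P s \<omega>))" "(\<integral>s. ?P s \<omega> * cnj (?P s \<omega>) \<partial>lborel) = Q \<omega>" for \<omega>
  proof -
    note t = integrable_mult_right[OF integral_indicator_overlap(1)]
    show "integrable lborel (\<lambda>s. ?P s \<omega> * cnj (?P s \<omega>))"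
      unfolding P2 by (intro Bochner_Integration.integrable_sum t)
    show "(\<integral>s. ?P s \<omega> * cnj (?P s \<omega>) \<partial>lborel) = Q \<omega>"
      unfolding P2 Q_def ov_def integral_indicator_overlap(2)[symmetric] integral_mult_right_zero[symmetric]
      by (subst Bochner_Integration.integral_sum, intro Bochner_Integration.integrable_sum t, intro sum.cong refl,
        subst Bochner_Integration.integral_sum, intro t, intro sum.cong refl)
  qed
  have Qnn: "0 \<le> Re (Q \<omega>)" for \<omega>
  proof -
    have "Q \<omega> = complex_of_real (\<integral>s. (norm (?P s \<omega>))\<^sup>2 \<partial>lborel)"
      unfolding Pi(2)[symmetric] complex_norm_square[symmetric] by (simp flip: of_real_power)
    then show ?thesis by simp
  qed
  have "(\<integral>\<^sup>+\<omega>. ennreal ((norm (?S \<omega>))\<^sup>2) \<partial>M) = ennreal (Re (\<integral>\<omega>. Q \<omega> \<partial>M))"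
    unfolding nn_integral_complex_norm_square[OF Si] SE ..
  also have "\<dots> = ennreal (\<integral>\<omega>. Re (Q \<omega>) \<partial>M)" using Qi(1) by simp
  also have "\<dots> = (\<integral>\<^sup>+\<omega>. ennreal (Re (Q \<omega>)) \<partial>M)"
    using Qi(1) Qnn by (intro nn_integral_eq_integral[symmetric]) auto
  also have "\<dots> = (\<integral>\<^sup>+\<omega>. (\<integral>\<^sup>+s. ennreal ((norm (?P s \<omega>))\<^sup>2) \<partial>lborel) \<partial>M)"
    unfolding nn_integral_complex_norm_square[OF Pi(1)] Pi(2) ..
  finally show ?thesis .
qed

lemma ito_isometry_diff:
  assumes s: "simple_data I a b c" "simple_data I' a' b' c'"
  shows "mean_square (simple_integral I a b c) (simple_integral I' a' b' c')
    = energy (simple_process I a b c) (simple_process I' a' b' c')"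
proof -
  let ?I = "I <+> I'" and ?a = "case_sum a a'" and ?b = "case_sum b b'" and ?c
      = "case_sum c (\<lambda>i \<omega>. - c' i \<omega>)"
  have "simple_data ?I ?a ?b ?c" using s by (auto simp: simple_data_def)
  note ito_isometry[OF this]
  moreover have "simple_integral ?I ?a ?b ?c \<omega>
      = simple_integral I a b c \<omega> - simple_integral I' a' b' c' \<omega>" for \<omega>
    using s by (simp add: simple_integral_def simple_data_def sum.Plus sum_negf)
  moreover have "simple_process ?I ?a ?b ?c t \<omega>
      = simple_process I a b c t \<omega> - simple_process I' a' b' c' t \<omega>" for t \<omega>
    using s by (simp only: simple_process_def simple_data_def sum.Plus sum.case mult_minus_left sum_negf o_def
        diff_conv_add_uminus)
  ultimately show ?thesis by simp
qed

text \<open>The pairs (integrand on the whole time axis, stochastic integral) that are limits of simple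
  ones.  Integration over \<open>[0, T]\<close> is expressed by cutting off the integrand, so that integrals up to
  different times, and simple integrals, can be compared within one notion.\<close>

definition ito_limit :: "(real \<Rightarrow> 'a \<Rightarrow> complex) \<Rightarrow> ('a \<Rightarrow> complex) \<Rightarrow> bool" where
  "ito_limit H J \<longleftrightarrow> (\<lambda>(s, \<omega>). H s \<omega>) \<in> borel_measurable (lborel \<Otimes>\<^sub>M M) \<and> J \<in> borel_measurable M \<and>
     (\<exists>n a b c. (\<forall>m::nat. simple_data {..<n m::nat} (a m) (b m) (c m)) \<and>
       (\<lambda>m. energy H (simple_process {..<n m} (a m) (b m) (c m))) \<longlonglongrightarrow> 0 \<and>
       (\<lambda>m. mean_square J (simple_integral {..<n m} (a m) (b m) (c m))) \<longlonglongrightarrow> 0)"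

lemma lborel_pair_measurable_swap:
  assumes "(\<lambda>(s, \<omega>). H s \<omega>) \<in> borel_measurable (lborel \<Otimes>\<^sub>M M)"
  shows "(\<lambda>(\<omega>, s). H s \<omega>) \<in> borel_measurable (M \<Otimes>\<^sub>M lborel)"
proof -
  have "(\<lambda>x. (\<lambda>(s, \<omega>). H s \<omega>) (snd x, fst x)) \<in> borel_measurable (M \<Otimes>\<^sub>M lborel)"
    by (rule measurable_compose[OF _ assms]) measurable
  then show ?thesis by (simp add: split_beta')
qed

lemma iterated_nn_integral_eq_product:
  fixes f :: "real \<Rightarrow> 'a \<Rightarrow> ennreal"
  assumes "(\<lambda>(\<omega>, s). f s \<omega>) \<in> borel_measurable (M \<Otimes>\<^sub>M lborel)"
  shows "(\<integral>\<^sup>+\<omega>. (\<integral>\<^sup>+s. f s \<omega> \<partial>lborel) \<partial>M) = (\<integral>\<^sup>+p. f (snd p) (fst p) \<partial>(M \<Otimes>\<^sub>M lborel))"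
  using lborel.nn_integral_fst[OF assms] by (simp add: split_beta')

text \<open>The isometry passes to limits up to a constant, which is enough: it yields uniqueness of the
  integral, the size of its increments and the convergence of Riemann sums.\<close>

theorem ito_limit_stable:
  assumes "ito_limit H J" "ito_limit K L"
  shows "mean_square J L \<le> 9 * energy H K"
proof -
  have Hm: "(\<lambda>(s, \<omega>). H s \<omega>) \<in> borel_measurable (lborel \<Otimes>\<^sub>M M)" and J[measurable]: "J \<in> borel_measurable M"
    and Km: "(\<lambda>(s, \<omega>). K s \<omega>) \<in> borel_measurable (lborel \<Otimes>\<^sub>M M)" and L[measurable]: "L \<in> borel_measurable M"
    using assms by (auto simp: ito_limit_def)
  obtain n a b c where p: "\<And>m::nat. simple_data {..<n m::nat} (a m) (b m) (c m)"
     "(\<lambda>m. energy H (simple_process {..<n m} (a m) (b m) (c m))) \<longlonglongrightarrow> 0"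
     "(\<lambda>m. mean_square J (simple_integral {..<n m} (a m) (b m) (c m))) \<longlonglongrightarrow> 0"
    using assms(1) unfolding ito_limit_def by blast
  obtain n' a' b' c' where q: "\<And>m::nat. simple_data {..<n' m::nat} (a' m) (b' m) (c' m)"
     "(\<lambda>m. energy K (simple_process {..<n' m} (a' m) (b' m) (c' m))) \<longlonglongrightarrow> 0"
     "(\<lambda>m. mean_square L (simple_integral {..<n' m} (a' m) (b' m) (c' m))) \<longlonglongrightarrow> 0"
    using assms(2) unfolding ito_limit_def by blast
  define P where "P m = simple_process {..<n m} (a m) (b m) (c m)" for m
  define P' where "P' m = simple_process {..<n' m} (a' m) (b' m) (c' m)" for m
  define S where "S m = simple_integral {..<n m} (a m) (b m) (c m)" for m
  define S' where "S' m = simple_integral {..<n' m} (a' m) (b' m) (c' m)" for m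
  note p = p[folded P_def S_def] and q = q[folded P'_def S'_def]
  have [measurable]: "S m \<in> borel_measurable M" "S' m \<in> borel_measurable M" for m
    unfolding S_def S'_def by (auto intro: simple_integral_measurable p q)
  have iso: "mean_square (S m) (S' m) = energy (P m) (P' m)" for m
    unfolding S_def S'_def P_def P'_def by (rule ito_isometry_diff[OF p(1) q(1)])
  have Pm: "(\<lambda>(s, \<omega>). P m s \<omega>) \<in> borel_measurable (lborel \<Otimes>\<^sub>M M)"
      "(\<lambda>(s, \<omega>). P' m s \<omega>) \<in> borel_measurable (lborel \<Otimes>\<^sub>M M)" for m
    unfolding P_def P'_def by (auto intro: simple_process_measurable p q)
  have E3: "energy X V \<le> 3 * (energy X Y + energy Y Z + energy V Z)"
    if "(\<lambda>(s, \<omega>). X s \<omega>) \<in> borel_measurable (lborel \<Otimes>\<^sub>M M)"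
        "(\<lambda>(s, \<omega>). Y s \<omega>) \<in> borel_measurable (lborel \<Otimes>\<^sub>M M)"
      "(\<lambda>(s, \<omega>). Z s \<omega>) \<in> borel_measurable (lborel \<Otimes>\<^sub>M M)"
          "(\<lambda>(s, \<omega>). V s \<omega>) \<in> borel_measurable (lborel \<Otimes>\<^sub>M M)" for X Y Z V
  proof -
    note m[measurable] = that[THEN lborel_pair_measurable_swap, unfolded split_beta']
    have E: "energy A D = (\<integral>\<^sup>+p. ennreal ((norm (A (snd p) (fst p) - D (snd p) (fst p)))\<^sup>2) \<partial>(M \<Otimes>\<^sub>M lborel))"
      if [measurable]: "(\<lambda>x. A (snd x) (fst x)) \<in> borel_measurable (M \<Otimes>\<^sub>M lborel)"
          "(\<lambda>x. D (snd x) (fst x)) \<in> borel_measurable (M \<Otimes>\<^sub>M lborel)"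
      for A D :: "real \<Rightarrow> 'a \<Rightarrow> complex"
      by (rule iterated_nn_integral_eq_product) (unfold split_beta', measurable)
    show ?thesis unfolding E[OF m(1,4)] E[OF m(1,2)] E[OF m(2,3)] E[OF m(4,3)]
      by (rule nn_integral_norm_diff_square_le3) (use m in auto)
  qed
  have Esym: "energy X Y = energy Y X" for X Y by (simp add: norm_minus_commute)
  \<comment> \<open>The constant \<open>9\<close> is \<open>3 * 3\<close>: one triangle inequality for the integrals, one for the integrands.\<close>
  have bound: "mean_square J L \<le>
      3 * (mean_square J (S m) + 3 * (energy H (P m) + energy H K + energy K (P' m))
         + mean_square L (S' m))" for m
  proof -
    have "energy (P m) (P' m) \<le> 3 * (energy H (P m) + energy H K + energy K (P' m))"
      using E3[OF Pm(1) Hm Km Pm(2), of m m] Esym[of "P m" H] Esym[of "P' m" K] by simp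
    then show ?thesis
      by (intro order_trans[OF nn_integral_norm_diff_square_le3[of J M "S m"
          "S' m" L]] mult_left_mono add_mono order_refl)
        (auto simp: iso)
  qed
  have "(\<lambda>m. 3 * (mean_square J (S m) + 3 * (energy H (P m) + energy H K + energy K (P' m))
         + mean_square L (S' m))) \<longlonglongrightarrow> 3 * (0 + 3 * (0 + energy H K + 0) + 0)"
    using p(2) q(2)
    by (intro ennreal_tendsto_cmult tendsto_add tendsto_const p(3) q(3)) auto
  then have "mean_square J L \<le> 3 * (0 + 3 * (0 + energy H K + 0) + 0)"
    by (rule LIMSEQ_le_const) (use bound in auto)
  then show ?thesis by (simp add: mult.assoc[symmetric])
qed

lemma ito_limit_simple:
  assumes "simple_data {..<n::nat} a b c"
  shows "ito_limit (simple_process {..<n} a b c) (simple_integral {..<n} a b c)"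
  unfolding ito_limit_def
proof (intro conjI exI allI)
  show "simple_data {..<n} a b c" for m :: nat by fact
qed (use assms in \<open>auto intro: simple_process_measurable simple_integral_measurable\<close>)

text \<open>Progressive measurability gives joint measurability on \<open>[0, T]\<close>; projecting time onto this interval
  extends it to the whole axis.\<close>

lemma ito_integral_cutoff_measurable:
  assumes pm: "progressively_measurable F H" and T: "0 \<le> T"
  shows "(\<lambda>(s, \<omega>). indicator {0..T} s * H s \<omega>) \<in> borel_measurable (lborel \<Otimes>\<^sub>M M)"
proof -
  have h: "(\<lambda>(s, \<omega>). H s \<omega>) \<in> borel_measurable (restrict_space borel {0..T} \<Otimes>\<^sub>M F T)"
    using pm T by (auto simp: progressively_measurable_def)
  have id: "(\<lambda>\<omega>. \<omega>) \<in> measurable M (F T)" by (rule measurable_F_M[of _ T]) auto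
  have "(\<lambda>s. max 0 (min T s)) \<in> measurable lborel (restrict_space borel {0..T})"
    using T by (intro measurable_restrict_space2) auto
  then have "(\<lambda>p. max 0 (min T (fst p))) \<in> measurable (lborel \<Otimes>\<^sub>M M) (restrict_space borel {0..T})"
    by (rule measurable_compose[OF measurable_fst])
  moreover have "snd \<in> measurable (lborel \<Otimes>\<^sub>M M) (F T)"
    by (rule measurable_compose[OF measurable_snd id, simplified])
  ultimately have "(\<lambda>p. (max 0 (min T (fst p)), snd p)) \<in> measurable (lborel \<Otimes>\<^sub>M M) (restrict_space borel {0..T} \<Otimes>\<^sub>M F T)"
    by (intro measurable_Pair)
  note m[measurable] = measurable_compose[OF this h, unfolded split_beta' fst_conv snd_conv]
  have "(\<lambda>p. indicator {0..T} (fst p) * H (max 0 (min T (fst p))) (snd p)) \<in> borel_measurable (lborel \<Otimes>\<^sub>M M)"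
    by measurable
  also have "(\<lambda>p. indicator {0..T} (fst p) * H (max 0 (min T (fst p))) (snd p))
      = (\<lambda>p. indicator {0..T} (fst p) * H (fst p) (snd p))"
    by (auto simp: indicator_def max_def min_def)
  finally show ?thesis by (simp add: split_beta')
qed

lemma elementary_data_simple_data:
  assumes e: "elementary_data F T n ts e"
  shows "simple_data {..<n} ts (\<lambda>i. ts (Suc i)) e"
    and "0 \<le> T"
    and "s \<notin> {0..T} \<Longrightarrow> elementary_process n ts e s \<omega> = 0"
proof -
  have mono: "ts i \<le> ts j" if "i \<le> j" "j \<le> n" for i j
    using that
  proof (induction j)
    case (Suc j)
    show ?case
    proof (cases "i = Suc j")
      case False
      then have "ts i \<le> ts j" using Suc by auto
      also have "ts j < ts (Suc j)" using e Suc.prems by (auto simp: elementary_data_def)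
      finally show ?thesis by simp
    qed simp
  qed simp
  have b: "0 \<le> ts i" "ts i \<le> T" if "i \<le> n" for i
    using mono[of 0 i] mono[of i n] that e by (auto simp: elementary_data_def)
  show "0 \<le> T" using b[of 0] by simp
  show "simple_data {..<n} ts (\<lambda>i. ts (Suc i)) e"
    unfolding simple_data_def
  proof (intro conjI ballI)
    fix i assume "i \<in> {..<n}"
    then have i: "i < n" by simp
    then show "0 \<le> ts i" "ts i \<le> ts (Suc i)" "e i \<in> borel_measurable (F (ts i))"
      using e b(1)[of i] unfolding elementary_data_def by (auto intro: less_imp_le)
    from e obtain C where "\<forall>i<n. \<forall>\<omega>\<in>space M. norm (e i \<omega>) \<le> C"
      unfolding elementary_data_def space_F by blast
    with i show "\<exists>C. \<forall>\<omega>\<in>space M. norm (e i \<omega>) \<le> C" by blast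
  qed simp
  show "elementary_process n ts e s \<omega> = 0" if "s \<notin> {0..T}"
  proof -
    have "indicator {ts i<..ts (Suc i)} s = (0 :: complex)" if "i < n" for i
      using b[of i] b[of "Suc i"] that \<open>s \<notin> {0..T}\<close> by (auto simp: indicator_def)
    then show ?thesis by (simp add: elementary_process_def)
  qed
qed

lemma ito_integral_imp_ito_limit:
  assumes I: "ito_integral M F W H T J"
  shows "ito_limit (cutoff T H) J"
proof -
  obtain n ts e where e: "\<And>m::nat. elementary_data F T (n m) (ts m) (e m)"
    and H: "(\<lambda>m. \<integral>\<^sup>+\<omega>. (\<integral>\<^sup>+s\<in>{0..T}. ennreal ((norm (H s \<omega> - elementary_process (n m) (ts m) (e m) s \<omega>))\<^sup>2) \<partial>lborel) \<partial>M) \<longlonglongrightarrow> 0"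
    and J: "(\<lambda>m. mean_square J (elementary_integral W (n m) (ts m) (e m))) \<longlonglongrightarrow> 0"
    and pm: "progressively_measurable F H" and Jm: "J \<in> borel_measurable M"
    using I unfolding ito_integral_def by blast
  have eq: "ennreal ((norm (H s \<omega> - elementary_process (n m) (ts m) (e m) s \<omega>))\<^sup>2) * indicator {0..T} s
     = ennreal ((norm (indicator {0..T} s * H s \<omega> - simple_process {..<n m} (ts m) (\<lambda>i. ts m (Suc i)) (e m) s \<omega>))\<^sup>2)" for m s \<omega>
    using elementary_data_simple_data(3)[OF e, of s m \<omega>]
    by (auto simp: indicator_def simple_process_def elementary_process_def)
  show ?thesis
    unfolding ito_limit_def
  proof (intro conjI exI allI)
    show "simple_data {..<n m} (ts m) (\<lambda>i. ts m (Suc i)) (e m)" for m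
      by (rule elementary_data_simple_data[OF e])
    show "(\<lambda>(s, \<omega>). indicator {0..T} s * H s \<omega>) \<in> borel_measurable (lborel \<Otimes>\<^sub>M M)"
      using pm elementary_data_simple_data(2)[OF e] by (rule ito_integral_cutoff_measurable)
    show "(\<lambda>m. energy (cutoff T H) (simple_process {..<n m} (ts m) (\<lambda>i. ts m (Suc i)) (e m))) \<longlonglongrightarrow> 0"
      using H unfolding eq .
    show "(\<lambda>m. mean_square J (simple_integral {..<n m} (ts m) (\<lambda>i. ts m (Suc i)) (e m))) \<longlonglongrightarrow> 0"
      using J unfolding elementary_integral_def simple_integral_def .
  qed fact
qed

lemma first_moment_square_le_second_moment:
  fixes X :: "'a \<Rightarrow> complex"
  assumes [measurable]: "X \<in> borel_measurable M"
  shows "(\<integral>\<^sup>+\<omega>. ennreal (norm (X \<omega>)) \<partial>M)\<^sup>2 \<le> (\<integral>\<^sup>+\<omega>. ennreal ((norm (X \<omega>))\<^sup>2) \<partial>M)"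
  using Cauchy_Schwarz_nn_integral[of "\<lambda>\<omega>. ennreal (norm (X \<omega>))" M "\<lambda>_. 1"]
  by (simp add: ennreal_power emeasure_space_1)

lemma first_moment_le_of_second_moment_le:
  fixes X :: "'a \<Rightarrow> complex"
  assumes X: "X \<in> borel_measurable M" and b: "(\<integral>\<^sup>+\<omega>. ennreal ((norm (X \<omega>))\<^sup>2) \<partial>M) \<le> ennreal (c\<^sup>2)"
      and c: "0 \<le> c"
  shows "(\<integral>\<^sup>+\<omega>. ennreal (norm (X \<omega>)) \<partial>M) \<le> ennreal c"
proof (rule ccontr)
  let ?E = "\<integral>\<^sup>+\<omega>. ennreal (norm (X \<omega>)) \<partial>M"
  assume "\<not> ?thesis"
  then have less: "ennreal c < ?E" by simp
  \<comment> \<open>A finite number strictly in between is needed, because the expectation could be infinite.\<close>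
  then obtain r where r: "ennreal c < r" "r < ?E" using dense by blast
  then obtain r' where r': "r = ennreal r'" "0 \<le> r'" by (cases r) auto
  have "c < r'" using r(1) c unfolding r'(1) by (simp add: ennreal_less_iff)
  then have "c\<^sup>2 < r'\<^sup>2" using c by (intro power_strict_mono) auto
  then have "ennreal (c\<^sup>2) < ennreal (r'\<^sup>2)" by (simp add: ennreal_less_iff)
  also have "\<dots> = r\<^sup>2" using r' by (simp add: ennreal_power)
  also have "\<dots> \<le> ?E\<^sup>2" using r(2) by (intro power_mono) auto
  also have "\<dots> \<le> ennreal (c\<^sup>2)" using first_moment_square_le_second_moment[OF X] b by (rule order_trans)
  finally show False by simp
qed

lemma ito_increment_first_moment_le:
  assumes J: "ito_limit (cutoff t H) J"
    and L: "ito_limit (cutoff u H) L"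
    and H: "\<And>s \<omega>. norm (H s \<omega>) \<le> 1" and ut: "0 \<le> u" "u \<le> t"
  shows "mean_abs J L \<le> ennreal (3 * sqrt (t - u))"
proof (rule first_moment_le_of_second_moment_le)
  show "(\<lambda>\<omega>. J \<omega> - L \<omega>) \<in> borel_measurable M"
    using J L by (auto simp: ito_limit_def)
  have "mean_square J L
     \<le> 9 * energy (cutoff t H) (cutoff u H)"
    by (rule ito_limit_stable[OF J L])
  also have "\<dots> \<le> 9 * (\<integral>\<^sup>+\<omega>. (\<integral>\<^sup>+s. indicator {u<..t} s \<partial>lborel) \<partial>M)"
  proof (intro mult_left_mono nn_integral_mono)
    fix s \<omega>
    have "(norm (H s \<omega>))\<^sup>2 \<le> 1" using H[of s \<omega>] by (simp add: power_le_one)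
    then have "ennreal ((norm (H s \<omega>))\<^sup>2) \<le> ennreal 1" by (rule ennreal_leI)
    then show "ennreal ((norm (indicator {0..t} s * H s \<omega> - indicator {0..u} s * H s \<omega>))\<^sup>2)
        \<le> indicator {u<..t} s"
      using ut by (auto simp: indicator_def)
  qed simp
  also have "\<dots> = 9 * ennreal (t - u)"
    using ut by (simp add: emeasure_space_1)
  also have "\<dots> = ennreal 9 * ennreal (t - u)" by simp
  also have "\<dots> = ennreal (9 * (t - u))" using ut by (intro ennreal_mult[symmetric]) auto
  also have "9 * (t - u) = (3 * sqrt (t - u))\<^sup>2" using ut by (simp add: power_mult_distrib)
  finally show "mean_square J L \<le> ennreal ((3 * sqrt (t - u))\<^sup>2)" .
qed (use ut in auto)

end

section \<open>Riemann sums on a grid\<close>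

text \<open>Dividing \<open>[0, T]\<close> into \<open>n + 1\<close> rather than \<open>n\<close> equal parts makes every \<open>n\<close> admissible.\<close>

definition grid :: "real \<Rightarrow> nat \<Rightarrow> nat \<Rightarrow> real" where
  "grid T n i = T * real i / real (Suc n)"

definition grid_step :: "real \<Rightarrow> nat \<Rightarrow> (real \<Rightarrow> complex) \<Rightarrow> real \<Rightarrow> complex" where
  "grid_step T n f s = (\<Sum>i<Suc n. f (grid T n i) * indicator {grid T n i<..grid T n (Suc i)} s)"

lemma grid_bounds: "0 < T \<Longrightarrow> 0 \<le> grid T n i" "0 < T \<Longrightarrow> grid T n i < grid T n (Suc i)" "grid T n 0 = 0"
    "grid T n (Suc n) = T"
  "grid T n (Suc i) - grid T n i = T / real (Suc n)"
  by (auto simp: grid_def divide_simps distrib_left simp del: of_nat_Suc) (auto simp: algebra_simps)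

lemma grid_mono: "0 < T \<Longrightarrow> i \<le> j \<Longrightarrow> grid T n i \<le> grid T n j"
  by (auto simp: grid_def divide_simps)

lemma grid_step_outside:
  assumes T: "0 < T" and s: "s \<notin> {0<..T}"
  shows "grid_step T n f s = 0"
  unfolding grid_step_def
proof (intro sum.neutral ballI)
  fix i assume "i \<in> {..<Suc n}"
  then have "0 \<le> grid T n i" "grid T n (Suc i) \<le> T"
    using grid_bounds(1)[OF T] grid_mono[OF T, of "Suc i" "Suc n" n] by (auto simp: grid_bounds(4))
  then show "f (grid T n i) * indicator {grid T n i<..grid T n (Suc i)} s = 0"
    using s by (auto simp: indicator_def)
qed

text \<open>One grid point serves all functions \<open>f\<close> at once, which is what allows passing to the limit.\<close>

lemma grid_step_inside:
  assumes T: "0 < T" and s: "s \<in> {0<..T}"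
  shows "\<exists>t. 0 \<le> t \<and> t \<le> s \<and> s - t \<le> T / real (Suc n) \<and> (\<forall>f. grid_step T n f s = f t)"
proof -
  have "\<exists>i<Suc n. grid T n i < s \<and> s \<le> grid T n (Suc i)"
  proof -
    define i where "i = (LEAST i. s \<le> grid T n (Suc i))"
    have ex: "s \<le> grid T n (Suc n)" using s by (simp add: grid_bounds(4))
    have 1: "s \<le> grid T n (Suc i)" unfolding i_def using ex by (rule LeastI)
    have 2: "i \<le> n" unfolding i_def using ex by (rule Least_le)
    have "grid T n i < s"
    proof (cases i)
      case 0
      then show ?thesis using s by (simp add: grid_bounds(3))
    next
      case (Suc j)
      then have "\<not> s \<le> grid T n (Suc j)" using not_less_Least[of j "\<lambda>i. s \<le> grid T n (Suc i)"] by
          (simp add: i_def)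
      then show ?thesis using Suc by simp
    qed
    then show ?thesis using 1 2 by (intro exI[of _ i]) auto
  qed
  then obtain i where i: "i < Suc n" "grid T n i < s" "s \<le> grid T n (Suc i)" by blast
  have "grid_step T n f s = f (grid T n i)" for f
  proof -
    have "f (grid T n j) * indicator {grid T n j<..grid T n (Suc j)} s = 0" if "j \<noteq> i" for j
    proof (cases "j < i")
      case True
      then have "grid T n (Suc j) \<le> grid T n i" using grid_mono[OF T, of "Suc j" i n] by simp
      then show ?thesis using i by (auto simp: indicator_def)
    next
      case False
      then have "grid T n (Suc i) \<le> grid T n j" using grid_mono[OF T, of "Suc i" j n] that by simp
      then show ?thesis using i by (auto simp: indicator_def)
    qed
    then have "grid_step T n f s = (\<Sum>j\<in>{i}. f (grid T n j) * indicator {grid T n j<..grid T n (Suc j)} s)"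
      unfolding grid_step_def using i(1) by (intro sum.mono_neutral_right) auto
    then show ?thesis using i by simp
  qed
  then show ?thesis
    using i grid_bounds(1)[OF T, of n i] grid_bounds(5)[of T n i] by (intro exI[of _ "grid T n i"]) auto
qed

lemma grid_step_tendsto:
  assumes T: "0 < T" and f: "continuous_on {0..} f" and s: "s \<noteq> 0"
  shows "(\<lambda>n. grid_step T n f s) \<longlonglongrightarrow> indicator {0..T} s * f s"
proof (cases "s \<in> {0<..T}")
  case False
  then have "s \<notin> {0..T}" using s by auto
  then show ?thesis using grid_step_outside[OF T False] by (auto simp: indicator_def)
next
  case True
  obtain t where t: "\<And>n. 0 \<le> t n" "\<And>n. t n \<le> s" "\<And>n. s - t n \<le> T / real (Suc n)"
      "\<And>n f. grid_step T n f s = f (t n)"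
    using grid_step_inside[OF T True] by metis
  have lim0: "(\<lambda>n. T / real (Suc n)) \<longlonglongrightarrow> 0"
    using tendsto_mult_right_zero[OF LIMSEQ_inverse_real_of_nat, of T] by (simp add: divide_inverse)
  have "(\<lambda>n. s - t n) \<longlonglongrightarrow> 0"
    by (rule tendsto_sandwich[OF _ _ tendsto_const lim0]) (use t(2,3) in \<open>auto intro!: always_eventually\<close>)
  then have "(\<lambda>n. s - (s - t n)) \<longlonglongrightarrow> s - 0" by (intro tendsto_diff tendsto_const)
  then have "t \<longlonglongrightarrow> s" by simp
  then have "(\<lambda>n. f (t n)) \<longlonglongrightarrow> f s"
    using f t True by (intro continuous_on_tendsto_compose[OF f]) auto
  then show ?thesis using True t(4) by simp
qed

lemma grid_step_norm_le:
  assumes T: "0 < T" and f: "\<And>s. norm (f s) \<le> K"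
  shows "norm (grid_step T n f s) \<le> K * indicator {0..T} s"
proof (cases "s \<in> {0<..T}")
  case False
  have "0 \<le> K" using f[of 0] norm_ge_zero order_trans by blast
  then show ?thesis using grid_step_outside[OF T False] by simp
next
  case True
  then show ?thesis using grid_step_inside[OF T True, of n] f by (auto simp: indicator_def)
qed

lemma grid_sum_tendsto_integral:
  fixes f :: "real \<Rightarrow> real"
  assumes T: "0 < T" and f: "continuous_on {0..} f" "\<And>s. \<bar>f s\<bar> \<le> 1"
  shows "(\<lambda>n. \<Sum>i<Suc n. f (grid T n i) * (grid T n (Suc i) - grid T n i)) \<longlonglongrightarrow> (LINT s:{0..T}|lborel. f s)"
    and "\<bar>\<Sum>i<Suc n. f (grid T n i) * (grid T n (Suc i) - grid T n i)\<bar> \<le> T"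
proof -
  let ?f = "\<lambda>s. complex_of_real (f s)"
  have "grid_step T n ?f s = (\<Sum>i<Suc n. ?f (grid T n i) * complex_of_real (indicator {grid T n i<..grid T n (Suc i)} s))" for n s
    unfolding grid_step_def by (intro sum.cong refl) (auto simp: indicator_def)
  then have gs: "grid_step T n ?f
      = (\<lambda>s. \<Sum>i<Suc n. ?f (grid T n i) * complex_of_real (indicator {grid T n i<..grid T n (Suc i)} s))"
      for n
    by auto
  have ii: "integrable lborel (\<lambda>s. ?f (grid T n i) * complex_of_real (indicator {grid T n i<..grid T n (Suc i)} s))" for n i
    using grid_bounds(2)[OF T, of n i] by
        (intro integrable_mult_right integrable_of_real integrable_real_indicator) auto
  have gi: "(\<integral>s. grid_step T n ?f s \<partial>lborel)
      = complex_of_real (\<Sum>i<Suc n. f (grid T n i) * (grid T n (Suc i) - grid T n i))" for n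
    unfolding gs using grid_bounds(2)[OF T, of n]
    by (subst Bochner_Integration.integral_sum[OF ii]) (simp add: less_imp_le)
  have fc: "continuous_on {0..T} ?f" using f(1) by
      (intro continuous_intros continuous_on_subset[OF f(1)]) auto
  have fsi: "set_integrable lborel {0..T} ?f" using fc by (rule borel_integrable_atLeastAtMost')
  have "(\<lambda>n. \<integral>s. grid_step T n ?f s \<partial>lborel) \<longlonglongrightarrow> (\<integral>s. indicator {0..T} s *\<^sub>R ?f s \<partial>lborel)"
  proof (rule integral_dominated_convergence[where w="\<lambda>s. indicator {0..T} s"])
    show "(\<lambda>s. indicator {0..T} s *\<^sub>R ?f s) \<in> borel_measurable lborel"
      using fsi unfolding set_integrable_def by (rule borel_measurable_integrable)
    show "grid_step T n ?f \<in> borel_measurable lborel" for n unfolding gs by measurable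
    show "integrable lborel (indicat_real {0..T})" by (rule integrable_real_indicator) (use T in auto)
    show "AE s in lborel. (\<lambda>n. grid_step T n ?f s) \<longlonglongrightarrow> indicator {0..T} s *\<^sub>R ?f s"
      using AE_lborel_singleton[of "0::real"]
    proof eventually_elim
      case (elim s)
      have "continuous_on {0..} ?f" by (intro continuous_intros f)
      from grid_step_tendsto[OF T this elim] show ?case by (cases "s \<in> {0..T}") simp_all
    qed
    show "AE s in lborel. norm (grid_step T n ?f s) \<le> indicator {0..T} s" for n
      using grid_step_norm_le[OF T, of ?f 1 n] f(2) by (intro AE_I2) simp
  qed
  also have "(\<integral>s. indicator {0..T} s *\<^sub>R ?f s \<partial>lborel) = complex_of_real (LINT s:{0..T}|lborel. f s)"
    by (simp add: set_lebesgue_integral_def scaleR_conv_of_real flip: of_real_mult)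
  finally show "(\<lambda>n. \<Sum>i<Suc n. f (grid T n i) * (grid T n (Suc i) - grid T n i))
      \<longlonglongrightarrow> (LINT s:{0..T}|lborel. f s)"
    unfolding gi by (simp only: tendsto_of_real_iff)
  have "\<bar>\<Sum>i<Suc n. f (grid T n i) * (grid T n (Suc i) - grid T n i)\<bar>
      \<le> (\<Sum>i<Suc n. \<bar>f (grid T n i) * (grid T n (Suc i) - grid T n i)\<bar>)"
    by (rule sum_abs)
  also have "\<dots> \<le> (\<Sum>i<Suc n. 1 * (grid T n (Suc i) - grid T n i))"
  proof (intro sum_mono)
    fix i
    have "0 < grid T n (Suc i) - grid T n i" using grid_bounds(2)[OF T, of n i] by simp
    then show "\<bar>f (grid T n i) * (grid T n (Suc i) - grid T n i)\<bar> \<le> 1 * (grid T n (Suc i) - grid T n i)"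
      unfolding abs_mult using f(2)[of "grid T n i"] by (intro mult_mono) auto
  qed
  also have "\<dots> = T" using sum_lessThan_telescope[of "grid T n" "Suc n"] by (simp add: grid_bounds(3,4))
  finally show "\<bar>\<Sum>i<Suc n. f (grid T n i) * (grid T n (Suc i) - grid T n i)\<bar> \<le> T" .
qed

context noise
begin

lemma riemann_simple_data:
  assumes T: "0 < T" and H: "\<And>s. 0 \<le> s \<Longrightarrow> H s \<in> borel_measurable (F s)" "\<And>s \<omega>. norm (H s \<omega>) \<le> 1"
  shows "simple_data {..<Suc n} (grid T n) (\<lambda>i. grid T n (Suc i)) (\<lambda>i. H (grid T n i))"
  unfolding simple_data_def using grid_bounds(1,2)[OF T] H by (auto simp: less_imp_le intro!: exI[of _ 1])

text \<open>For a continuous integrand of modulus at most one, left-endpoint Riemann sums converge to the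
  stochastic integral, whichever approximating sequence was used to define it: the step functions
  converge in mean square by dominated convergence, and the integral is stable.  All integrals can
  therefore be computed on the same grid.\<close>

lemma riemann_sums_tendsto_ito:
  assumes T: "0 < T" and H: "\<And>s. 0 \<le> s \<Longrightarrow> H s \<in> borel_measurable (F s)" "\<And>s \<omega>. norm (H s \<omega>) \<le> 1"
    and cont: "\<And>\<omega>. \<omega> \<in> space M \<Longrightarrow> continuous_on {0..} (\<lambda>s. H s \<omega>)"
    and J: "ito_limit (cutoff T H) J"
  shows "(\<lambda>n. \<integral>\<^sup>+\<omega>. ennreal (norm (J \<omega> - (\<Sum>i<Suc n. H (grid T n i) \<omega> * (W (grid T n (Suc i)) \<omega> - W (grid T n i) \<omega>)))) \<partial>M) \<longlonglongrightarrow> 0"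
proof -
  define S where "S n = simple_integral {..<Suc n} (grid T n) (\<lambda>i. grid T n (Suc i)) (\<lambda>i. H (grid T n i))" for n
  define P where "P n = simple_process {..<Suc n} (grid T n) (\<lambda>i. grid T n (Suc i)) (\<lambda>i. H (grid T n i))" for n
  have sd: "simple_data {..<Suc n} (grid T n) (\<lambda>i. grid T n (Suc i)) (\<lambda>i. H (grid T n i))" for n
    by (rule riemann_simple_data[OF T H])
  have Pg: "P n s \<omega> = grid_step T n (\<lambda>s. H s \<omega>) s" for n s \<omega>
    by (simp add: P_def simple_process_def grid_step_def)
  have lim: "ito_limit (P n) (S n)" for n unfolding P_def S_def by (rule ito_limit_simple[OF sd])
  define h where "h s \<omega> = indicator {0..T} s * H s \<omega>" for s \<omega>
  have hm: "(\<lambda>p. h (snd p) (fst p)) \<in> borel_measurable (M \<Otimes>\<^sub>M lborel)"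
    using lborel_pair_measurable_swap[of h] J by (simp add: ito_limit_def h_def split_beta')
  have Pm: "(\<lambda>p. P n (snd p) (fst p)) \<in> borel_measurable (M \<Otimes>\<^sub>M lborel)" for n
    using lborel_pair_measurable_swap[of "P n"] lim[of n] by (simp add: ito_limit_def split_beta')
  note [measurable] = hm Pm
  define E where "E n \<omega> = (\<integral>\<^sup>+s. ennreal ((norm (h s \<omega> - P n s \<omega>))\<^sup>2) \<partial>lborel)" for n \<omega>
  have Em[measurable]: "E n \<in> borel_measurable M" for n
    unfolding E_def[abs_def]
    by (rule lborel.borel_measurable_nn_integral_fst[of "\<lambda>p. ennreal ((norm (h (snd p) (fst p) - P n (snd p) (fst p)))\<^sup>2)" M, unfolded fst_conv snd_conv]) measurable
  have bnd: "ennreal ((norm (h s \<omega> - P n s \<omega>))\<^sup>2) \<le> 4 * indicator {0..T} s" for n s \<omega>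
  proof -
    have "norm (h s \<omega> - P n s \<omega>) \<le> norm (h s \<omega>) + norm (P n s \<omega>)" by (rule norm_triangle_ineq4)
    also have "\<dots> \<le> 2 * indicator {0..T} s"
      using grid_step_norm_le[OF T, of "\<lambda>s. H s \<omega>" 1 n s, OF H(2)] H(2)[of s \<omega>] unfolding Pg h_def
      by (auto simp: norm_mult indicator_def split: if_splits)
    finally have "(norm (h s \<omega> - P n s \<omega>))\<^sup>2 \<le> (2 * indicator {0..T} s)\<^sup>2" by (intro power_mono) auto
    then have "ennreal ((norm (h s \<omega> - P n s \<omega>))\<^sup>2) \<le> ennreal ((2 * indicator {0..T} s)\<^sup>2)"
        by (rule ennreal_leI)
    also have "\<dots> = 4 * indicator {0..T} s" by (auto simp: indicator_def)
    finally show ?thesis .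
  qed
  have Ebnd: "E n \<omega> \<le> ennreal (4 * T)" for n \<omega>
  proof -
    have "E n \<omega> \<le> (\<integral>\<^sup>+s. 4 * indicator {0..T} s \<partial>lborel)" unfolding E_def by (intro nn_integral_mono bnd)
    also have "\<dots> = ennreal (4 * T)" using T by (simp add: nn_integral_cmult ennreal_mult)
    finally show ?thesis .
  qed
  have Elim: "(\<lambda>n. E n \<omega>) \<longlonglongrightarrow> 0" if w: "\<omega> \<in> space M" for \<omega>
  proof -
    have "(\<lambda>n. \<integral>\<^sup>+s. ennreal ((norm (h s \<omega> - P n s \<omega>))\<^sup>2) \<partial>lborel) \<longlonglongrightarrow> (\<integral>\<^sup>+s. 0 \<partial>(lborel :: real measure))"
    proof (rule nn_integral_dominated_convergence[where w="\<lambda>s. 4 * indicator {0..T} s"])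
      show "(\<lambda>s. ennreal ((norm (h s \<omega> - P n s \<omega>))\<^sup>2)) \<in> borel_measurable lborel" for n
        using measurable_compose[OF measurable_Pair1'[OF w] hm]
            measurable_compose[OF measurable_Pair1'[OF w] Pm[of n]] by simp
      show "(\<integral>\<^sup>+s. 4 * indicator {0..T} s \<partial>lborel) < \<infinity>" using T by
          (simp add: nn_integral_cmult ennreal_mult_less_top)
      show "AE s in lborel. (\<lambda>n. ennreal ((norm (h s \<omega> - P n s \<omega>))\<^sup>2)) \<longlonglongrightarrow> 0"
        using AE_lborel_singleton[of "0::real"]
      proof eventually_elim
        case (elim s)
        have "(\<lambda>n. (norm (h s \<omega> - P n s \<omega>))\<^sup>2) \<longlonglongrightarrow> (norm (h s \<omega> - h s \<omega>))\<^sup>2"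
          unfolding Pg using grid_step_tendsto[OF T cont[OF w] elim] by (intro tendsto_intros)
              (simp add: h_def)
        then have "(\<lambda>n. ennreal ((norm (h s \<omega> - P n s \<omega>))\<^sup>2)) \<longlonglongrightarrow> ennreal 0"
          by (intro tendsto_ennrealI) simp
        then show ?case by simp
      qed
    qed (use bnd in \<open>auto intro!: AE_I2\<close>)
    then show ?thesis by (simp add: E_def)
  qed
  have "(\<lambda>n. \<integral>\<^sup>+\<omega>. E n \<omega> \<partial>M) \<longlonglongrightarrow> (\<integral>\<^sup>+\<omega>. 0 \<partial>M)"
    by (rule nn_integral_dominated_convergence[where w="\<lambda>_. ennreal (4 * T)"])
      (use Ebnd Elim T in \<open>auto intro!: AE_I2 simp: emeasure_space_1\<close>)
  then have E0: "(\<lambda>n. 9 * (\<integral>\<^sup>+\<omega>. E n \<omega> \<partial>M)) \<longlonglongrightarrow> 9 * 0"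
    by (intro ennreal_tendsto_cmult) auto
  have L2: "(\<lambda>n. mean_square J (S n)) \<longlonglongrightarrow> 0"
  proof (rule tendsto_sandwich[OF _ _ tendsto_const])
    show "(\<lambda>n. 9 * (\<integral>\<^sup>+\<omega>. E n \<omega> \<partial>M)) \<longlonglongrightarrow> 0" using E0 by simp
    show "\<forall>\<^sub>F n in sequentially. mean_square J (S n) \<le> 9 * (\<integral>\<^sup>+\<omega>. E n \<omega> \<partial>M)"
      using ito_limit_stable[OF J lim] by (auto simp: E_def h_def)
  qed simp
  have Jm: "J \<in> borel_measurable M" and Sm: "S n \<in> borel_measurable M" for n
    using J lim[of n] by (auto simp: ito_limit_def)
  have "(\<lambda>n. mean_abs J (S n)) \<longlonglongrightarrow> 0"
  proof (rule order_tendstoI)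
    fix e :: ennreal assume "0 < e"
    then obtain e' where e': "0 < e'" "ennreal e' < e"
      by (metis dense ennreal_cases ennreal_less_zero_iff infinity_ennreal_def top.not_eq_extremum order_less_trans)
    then have "0 < ennreal (e'\<^sup>2)" by simp
    from order_tendstoD(2)[OF L2 this] show "\<forall>\<^sub>F n in sequentially. mean_abs J (S n) < e"
    proof eventually_elim
      case (elim n)
      then have "mean_abs J (S n) \<le> ennreal e'"
        using e'(1) Jm Sm[of n] by (intro first_moment_le_of_second_moment_le) auto
      then show ?case using e'(2) by (rule order_le_less_trans)
    qed
  qed simp
  then show ?thesis by (simp only: S_def simple_integral_def)
qed

end

section \<open>The exponential identity\<close>

context noise
begin

text \<open>Given the past at time \<open>s\<close> the increments are independent centred Gaussians and \<open>Y\<close> and \<open>k\<close> are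
  constants; Fubini's theorem for the product of the laws of past and increment makes this precise.\<close>

lemma expectation_iexp_given_past:
  fixes Y k :: "'a \<Rightarrow> complex"
  assumes st: "0 \<le> s" "s \<le> t" and Y: "Y \<in> borel_measurable (F s)" "\<And>\<omega>. norm (Y \<omega>) \<le> C"
      and k: "k \<in> borel_measurable (F s)"
  shows "(\<integral>\<omega>. Y \<omega> * iexp (\<alpha> * (B t \<omega> - B s \<omega>) + Re (k \<omega> * (W t \<omega> - W s \<omega>))) \<partial>M)
    = (\<integral>\<omega>. Y \<omega> * exp (- ((\<alpha>\<^sup>2 + (norm (k \<omega>))\<^sup>2 / 2) / 2 * (t - s))) \<partial>M)"
proof (cases "s = t")
  case False
  then have st: "0 \<le> s" "s < t" using st by auto
  \<comment> \<open>Past and increment are both encoded as pairs of complex numbers, since independence of two random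
    variables is stated for variables with values in the same type.\<close>
  let ?Z = "\<lambda>\<omega>. (Y \<omega>, k \<omega>)" and ?D
      = "\<lambda>\<omega>. (complex_of_real (fst (incr s t \<omega>)), complex_increment (incr s t \<omega>))"
  define g where "g p = fst (fst p) * iexp (\<alpha> * Re (fst (snd p)) + Re (snd (fst p) * snd (snd p)))"
    for p :: "(complex \<times> complex) \<times> (complex \<times> complex)"
  have gm[measurable]: "g \<in> borel_measurable (borel \<Otimes>\<^sub>M borel)"
    unfolding g_def[abs_def] borel_prod
    by (intro borel_measurable_continuous_onI continuous_intros)
  have Zm: "?Z \<in> measurable (F s) borel" using Y(1) k by (simp add: borel_prod[symmetric])
  have ind: "indep_var borel ?Z borel ?D"
  proof (rule indep_var_incr[OF st Zm, where g="\<lambda>p. (complex_of_real (fst p), complex_increment p)"])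
    show "(\<lambda>p. (complex_of_real (fst p), complex_increment p)) \<in> borel_measurable borel"
      unfolding complex_increment_def by (intro borel_measurable_continuous_onI continuous_intros)
  qed
  then have ZM[measurable]: "?Z \<in> measurable M borel" and DM[measurable]: "?D \<in> measurable M borel"
    and eq: "distr M borel ?Z \<Otimes>\<^sub>M distr M borel ?D = distr M (borel \<Otimes>\<^sub>M borel) (\<lambda>x. (?Z x, ?D x))"
    unfolding indep_var_distribution_eq by auto
  interpret Z: prob_space "distr M borel ?Z" by (rule prob_space_distr) simp
  interpret D: prob_space "distr M borel ?D" by (rule prob_space_distr) simp
  interpret P: pair_prob_space "distr M borel ?Z" "distr M borel ?D" ..
  have gi: "integrable (distr M borel ?Z \<Otimes>\<^sub>M distr M borel ?D) g"
    unfolding eq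
  proof (subst integrable_distr_eq)
    show "integrable M (\<lambda>x. g (?Z x, ?D x))"
    proof (rule integrable_const_bound[where B=C])
      show "AE \<omega> in M. norm (g (?Z \<omega>, ?D \<omega>)) \<le> C" using Y(2) by (simp add: g_def norm_mult)
    qed measurable
  qed measurable
  have inner: "(\<integral>d. g ((y, c), d) \<partial>distr M borel ?D) = y * exp (- ((\<alpha>\<^sup>2 + (norm c)\<^sup>2 / 2) / 2 * (t - s)))"
      for y c
  proof -
    have "(\<integral>d. g ((y, c), d) \<partial>distr M borel ?D) = (\<integral>\<omega>. g ((y, c), ?D \<omega>) \<partial>M)"
      by (subst integral_distr) auto
    also have "\<dots> = (\<integral>\<omega>. y * iexp (\<alpha> * (B t \<omega> - B s \<omega>) + (Re c / sqrt 2) * (B2 t \<omega> - B2 s \<omega>)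
        + (- Im c / sqrt 2) * (B3 t \<omega> - B3 s \<omega>)) \<partial>M)"
    proof (rule Bochner_Integration.integral_cong[OF refl])
      fix \<omega>
      have "Re (c * complex_increment (incr s t \<omega>)) = (Re c / sqrt 2) * (B2 t \<omega> - B2 s \<omega>)
          + (- Im c / sqrt 2) * (B3 t \<omega> - B3 s \<omega>)"
        by (simp add: complex_increment_def incr_def field_simps)
      then show "g ((y, c), ?D \<omega>) = y * iexp (\<alpha> * (B t \<omega> - B s \<omega>) + (Re c / sqrt 2) * (B2 t \<omega> - B2 s \<omega>)
          + (- Im c / sqrt 2) * (B3 t \<omega> - B3 s \<omega>))"
        unfolding g_def fst_conv snd_conv by (simp only: add.assoc incr_def fst_conv Re_complex_of_real)
    qed
    also have "\<dots> = y * exp (- ((\<alpha>\<^sup>2 + (Re c / sqrt 2)\<^sup>2 + (- Im c / sqrt 2)\<^sup>2) / 2 * (t - s)))"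
      unfolding integral_mult_right_zero expectation_iexp_incr[OF st] ..
    also have "\<alpha>\<^sup>2 + (Re c / sqrt 2)\<^sup>2 + (- Im c / sqrt 2)\<^sup>2 = \<alpha>\<^sup>2 + (norm c)\<^sup>2 / 2"
      by (simp add: power_divide cmod_power2 add_divide_distrib)
    finally show ?thesis .
  qed
  have "(\<integral>\<omega>. Y \<omega> * iexp (\<alpha> * (B t \<omega> - B s \<omega>) + Re (k \<omega> * (W t \<omega> - W s \<omega>))) \<partial>M) = (\<integral>\<omega>. g (?Z \<omega>, ?D \<omega>) \<partial>M)"
    unfolding g_def fst_conv snd_conv complex_increment_incr by
        (simp only: incr_def fst_conv Re_complex_of_real)
  also have "\<dots> = (\<integral>p. g p \<partial>(distr M borel ?Z \<Otimes>\<^sub>M distr M borel ?D))"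
    unfolding eq by (subst integral_distr) auto
  also have "\<dots> = (\<integral>z. (\<integral>d. g (z, d) \<partial>distr M borel ?D) \<partial>distr M borel ?Z)"
    by (rule P.integral_fst'[OF gi, symmetric])
  also have "\<dots> = (\<integral>z. fst z * exp (- ((\<alpha>\<^sup>2 + (norm (snd z))\<^sup>2 / 2) / 2 * (t - s))) \<partial>distr M borel ?Z)"
    using inner by (intro Bochner_Integration.integral_cong refl) (auto simp: split_beta')
  also have "\<dots> = (\<integral>\<omega>. Y \<omega> * exp (- ((\<alpha>\<^sup>2 + (norm (k \<omega>))\<^sup>2 / 2) / 2 * (t - s))) \<partial>M)"
  proof (subst integral_distr)
    show "(\<lambda>z. fst z * complex_of_real (exp (- ((\<alpha>\<^sup>2
        + (norm (snd z))\<^sup>2 / 2) / 2 * (t - s))))) \<in> borel_measurable (borel :: (complex \<times> complex) measure)"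
      by (intro borel_measurable_continuous_onI continuous_intros) auto
  qed simp_all
  finally show ?thesis .
qed simp

text \<open>On a grid the stochastic exponential has expectation one without error, since each factor has
  conditional expectation one.  This replaces Ito's formula.\<close>

lemma exponential_martingale:
  fixes ts :: "nat \<Rightarrow> real" and k :: "nat \<Rightarrow> 'a \<Rightarrow> complex"
  assumes ts: "0 \<le> ts 0" "\<And>i. ts i \<le> ts (Suc i)" and k: "\<And>i. k i \<in> borel_measurable (F (ts i))"
      "\<And>i \<omega>. norm (k i \<omega>) \<le> K"
  shows "(\<integral>\<omega>. exp (\<Sum>i<n. \<i> * complex_of_real (\<alpha> * (B (ts (Suc i)) \<omega> - B (ts i) \<omega>)
      + Re (k i \<omega> * (W (ts (Suc i)) \<omega> - W (ts i) \<omega>)))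
      + complex_of_real ((\<alpha>\<^sup>2 + (norm (k i \<omega>))\<^sup>2 / 2) / 2 * (ts (Suc i) - ts i))) \<partial>M) = 1"
proof -
  define u where "u i \<omega> = \<alpha> * (B (ts (Suc i)) \<omega> - B (ts i) \<omega>)
      + Re (k i \<omega> * (W (ts (Suc i)) \<omega> - W (ts i) \<omega>))" for i \<omega>
  define v where "v i \<omega> = (\<alpha>\<^sup>2 + (norm (k i \<omega>))\<^sup>2 / 2) / 2 * (ts (Suc i) - ts i)" for i \<omega>
  define G where "G n \<omega> = exp (\<Sum>i<n. \<i> * complex_of_real (u i \<omega>) + complex_of_real (v i \<omega>))" for n \<omega>
  have mono: "ts i \<le> ts j" if "i \<le> j" for i j using that ts(2) by (rule lift_Suc_mono_le[rotated])
  have pos: "0 \<le> ts i" for i using mono[of 0 i] ts(1) by simp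
  have uF: "u i \<in> borel_measurable (F (ts n))" and vF: "v i \<in> borel_measurable (F (ts n))" if "i < n"
      for i n
  proof -
    have le: "ts i \<le> ts n" "ts (Suc i) \<le> ts n" using mono that by auto
    note [measurable] = noise_measurable_F(1)[OF pos le(1)] noise_measurable_F(1)[OF pos le(2)]
      W_measurable_F[OF pos le(1)] W_measurable_F[OF pos le(2)] measurable_F_mono[OF k(1) le(1)]
    show "u i \<in> borel_measurable (F (ts n))" "v i \<in> borel_measurable (F (ts n))"
      unfolding u_def[abs_def] v_def[abs_def] by measurable
  qed
  have GF: "G n \<in> borel_measurable (F (ts n))" for n
    unfolding G_def[abs_def] using uF vF by measurable
  have vb: "v i \<omega> \<le> (\<alpha>\<^sup>2 + K\<^sup>2 / 2) / 2 * (ts (Suc i) - ts i)" for i \<omega>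
    unfolding v_def using k(2)[of i \<omega>] ts(2)[of i] by
        (intro mult_right_mono divide_right_mono add_mono power_mono order_refl) auto
  have Gb: "norm (G n \<omega>) \<le> exp (\<Sum>i<n. (\<alpha>\<^sup>2 + K\<^sup>2 / 2) / 2 * (ts (Suc i) - ts i))" for n \<omega>
    unfolding G_def norm_exp_eq_Re using vb by (auto intro!: sum_mono)
  have "(\<integral>\<omega>. G n \<omega> \<partial>M) = 1" for n
  proof (induction n)
    case 0
    then show ?case by (simp add: G_def prob_space)
  next
    case (Suc n)
    define Y where "Y \<omega> = G n \<omega> * complex_of_real (exp (v n \<omega>))" for \<omega>
    have "v n \<in> borel_measurable (F (ts n))"
      unfolding v_def[abs_def] using k(1)[of n] by measurable
    then have YF: "Y \<in> borel_measurable (F (ts n))" unfolding Y_def[abs_def] using GF[of n] by measurable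
    have Yb: "norm (Y \<omega>) \<le> exp (\<Sum>i<n. (\<alpha>\<^sup>2 + K\<^sup>2 / 2) / 2 * (ts (Suc i) - ts i)) * exp ((\<alpha>\<^sup>2
        + K\<^sup>2 / 2) / 2 * (ts (Suc n) - ts n))" for \<omega>
      unfolding Y_def norm_mult using Gb[of n \<omega>] vb[of n \<omega>] by (intro mult_mono) auto
    have "(\<integral>\<omega>. G (Suc n) \<omega> \<partial>M) = (\<integral>\<omega>. Y \<omega> * iexp (u n \<omega>) \<partial>M)"
      by (simp add: G_def Y_def exp_add exp_of_real ac_simps)
    also have "\<dots> = (\<integral>\<omega>. Y \<omega> * exp (- v n \<omega>) \<partial>M)"
      unfolding u_def v_def by (rule expectation_iexp_given_past[OF pos ts(2) YF Yb k(1)])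
    also have "\<dots> = (\<integral>\<omega>. G n \<omega> \<partial>M)"
      by (simp add: Y_def mult.assoc flip: of_real_mult exp_add)
    finally show ?case using Suc by simp
  qed
  then show ?thesis unfolding G_def u_def v_def .
qed

end

section \<open>Oscillation of the phase difference\<close>

lemma norm_iexp_diff_le: "norm (iexp x - iexp y) \<le> \<bar>x - y\<bar>"
proof -
  have "norm (iexp x - iexp y) = norm (iexp y * (iexp (x - y) - 1))"
    by (simp add: right_diff_distrib exp_add[symmetric] distrib_left[symmetric])
  also have "\<dots> = norm (iexp (x - y) - 1)" by (simp add: norm_mult)
  also have "\<dots> \<le> \<bar>x - y\<bar>" using iexp_approx1[of "x - y" 0] by simp
  finally show ?thesis .
qed

text \<open>If shifting time by \<open>\<delta>\<close> nearly reverses the sign of \<open>exp (i \<theta>)\<close>, then twice its integral is nearly the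
  integral of a small function; the error consists of the two end pieces of length \<open>\<delta>\<close>.\<close>

lemma cos_integral_half_period_shift:
  fixes \<theta> :: "real \<Rightarrow> real"
  assumes \<theta>: "continuous_on {0..} \<theta>" and T: "0 \<le> T" and \<delta>: "0 \<le> \<delta>"
  shows "ennreal \<bar>LINT s:{0..T}|lborel. cos (\<theta> s)\<bar>
    \<le> ennreal (1/2) * (\<integral>\<^sup>+s. ennreal (norm (indicator {0..T} s * (iexp (\<theta> s) + iexp (\<theta> (s
        + \<delta>))))) \<partial>lborel) + ennreal \<delta>"
proof -
  define G where "G s = iexp (\<theta> s)" for s
  have G: "continuous_on S G" if "S \<subseteq> {0..}" for S
    unfolding G_def by (intro continuous_intros continuous_on_subset[OF \<theta> that])
  have Gs: "continuous_on {0..T} (\<lambda>s. G (s + \<delta>))"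
    using \<delta> by (intro continuous_on_compose2[OF G[of "{0..}"]] continuous_intros) auto
  have Gi: "G integrable_on {a..b}" if "0 \<le> a" for a b
    using that by (intro integrable_continuous_real G) auto
  have Gb: "norm (integral {a..b} G) \<le> b - a" if "0 \<le> a" "a \<le> b" for a b
    using integral_bound[of a b G 1] that G[of "{a..b}"] by (auto simp: G_def)
  define h where "h s = norm (G s + G (s + \<delta>))" for s
  have hc: "continuous_on {0..T} h"
    unfolding h_def by (intro continuous_intros G Gs) auto
  \<comment> \<open>The integrals of \<open>G\<close> and of its shift over \<open>[0, T]\<close> differ by end pieces of length \<open>\<delta>\<close>.\<close>
  have "integral {0..T} (\<lambda>s. G (s + \<delta>)) = integral {0 + \<delta>..T + \<delta>} G"
    using integral_shift_Icc_real[of 0 T G \<delta>] by (simp add: o_def add.commute)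
  moreover have "integral {0..\<delta>} G + integral {\<delta>..T + \<delta>} G = integral {0..T + \<delta>} G"
    using T \<delta> by (intro Henstock_Kurzweil_Integration.integral_combine Gi) auto
  moreover have "integral {0..T} G + integral {T..T + \<delta>} G = integral {0..T + \<delta>} G"
    using T \<delta> by (intro Henstock_Kurzweil_Integration.integral_combine Gi) auto
  moreover have "integral {0..T} (\<lambda>s. G s + G (s + \<delta>)) = integral {0..T} G + integral {0..T} (\<lambda>s. G (s
      + \<delta>))"
    by (intro integral_add Gi integrable_continuous_real Gs) auto
  ultimately have "2 * integral {0..T} G = integral {0..T} (\<lambda>s. G s + G (s + \<delta>))
      + (integral {0..\<delta>} G - integral {T..T + \<delta>} G)"
    by (simp add: algebra_simps)
  then have "2 * norm (integral {0..T} G) = norm (integral {0..T} (\<lambda>s. G s + G (s + \<delta>))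
      + (integral {0..\<delta>} G - integral {T..T + \<delta>} G))"
    by (metis norm_mult norm_numeral)
  also have "\<dots> \<le> norm (integral {0..T} (\<lambda>s. G s + G (s + \<delta>))) + (norm (integral {0..\<delta>} G)
      + norm (integral {T..T + \<delta>} G))"
    by (intro order_trans[OF norm_triangle_ineq] add_mono norm_triangle_ineq4 order_refl)
  also have "\<dots> \<le> integral {0..T} h + (\<delta> + \<delta>)"
  proof (intro add_mono)
    show "norm (integral {0..T} (\<lambda>s. G s + G (s + \<delta>))) \<le> integral {0..T} h"
      by (rule integral_norm_bound_integral)
        (auto simp: h_def intro!: integrable_continuous_real continuous_intros G Gs)
  qed (use Gb[of 0 \<delta>] Gb[of T "T + \<delta>"] T \<delta> in auto)
  finally have main: "norm (integral {0..T} G) \<le> 1/2 * integral {0..T} h + \<delta>" by simp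
  have "continuous_on {0..T} (\<lambda>s. cos (\<theta> s))"
    using T by (intro continuous_intros continuous_on_subset[OF \<theta>]) auto
  from set_borel_integral_eq_integral(2)[OF borel_integrable_atLeastAtMost'[OF this]]
  have "(LINT s:{0..T}|lborel. cos (\<theta> s)) = integral {0..T} (\<lambda>s. cos (\<theta> s))" .
  also have "\<dots> = integral {0..T} (Re \<circ> G)" by (simp add: o_def G_def Re_exp)
  also have "\<dots> = Re (integral {0..T} G)" by (rule integral_linear[OF Gi bounded_linear_Re]) simp
  finally have "\<bar>LINT s:{0..T}|lborel. cos (\<theta> s)\<bar> \<le> 1/2 * integral {0..T} h + \<delta>"
    using abs_Re_le_cmod[of "integral {0..T} G"] main by simp
  then have "ennreal \<bar>LINT s:{0..T}|lborel. cos (\<theta> s)\<bar> \<le> ennreal (1/2 * integral {0..T} h + \<delta>)"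
      by (rule ennreal_leI)
  also have "\<dots> = ennreal (1/2) * ennreal (integral {0..T} h) + ennreal \<delta>"
  proof -
    have "0 \<le> integral {0..T} h"
      by (rule integral_nonneg[OF integrable_continuous_real[OF hc]]) (simp add: h_def)
    then show ?thesis
      using \<delta> ennreal_plus[of "1/2 * integral {0..T} h" \<delta>] ennreal_mult[of "1/2" "integral {0..T} h"]
          by simp
  qed
  also have "ennreal (integral {0..T} h) = (\<integral>\<^sup>+s. ennreal (norm (indicator {0..T} s * (iexp (\<theta> s)
      + iexp (\<theta> (s + \<delta>))))) \<partial>lborel)"
  proof -
    have si: "set_integrable lborel {0..T} h" using hc by (rule borel_integrable_atLeastAtMost')
    have "(\<integral>\<^sup>+s. ennreal (indicator {0..T} s *\<^sub>R h s) \<partial>lborel) = ennreal (LINT s:{0..T}|lborel. h s)"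
      using si unfolding set_integrable_def set_lebesgue_integral_def
      by (rule nn_integral_eq_integral) (auto simp: h_def)
    also have "(LINT s:{0..T}|lborel. h s) = integral {0..T} h"
        by (rule set_borel_integral_eq_integral(2)[OF si])
    finally have "ennreal (integral {0..T} h) = (\<integral>\<^sup>+s. ennreal (indicator {0..T} s *\<^sub>R h s) \<partial>lborel)" ..
    then show ?thesis
      by (auto simp: h_def G_def norm_mult indicator_def intro!: nn_integral_cong)
  qed
  finally show ?thesis .
qed

abbreviation unit_phase :: "(real \<Rightarrow> 'a \<Rightarrow> real) \<Rightarrow> real \<Rightarrow> 'a \<Rightarrow> complex" where
  "unit_phase \<phi> s \<omega> \<equiv> exp (- \<i> * complex_of_real (\<phi> s \<omega>))"

lemma norm_unit_phase: "norm (unit_phase \<phi> s \<omega>) = 1"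
  by (simp add: norm_exp_eq_Re)

context noise
begin

lemma phase_solution_ito:
  assumes "phase_solution M F B W l \<phi>"
  shows "\<exists>J. \<forall>t\<ge>0. ito_limit (cutoff t (unit_phase \<phi>)) (J t) \<and>
     (AE \<omega> in M. \<phi> t \<omega> = l * t + B t \<omega> + Re (J t \<omega>))"
proof -
  have "\<forall>t. \<exists>J. 0 \<le> t \<longrightarrow> ito_limit (cutoff t (unit_phase \<phi>)) J \<and>
     (AE \<omega> in M. \<phi> t \<omega> = l * t + B t \<omega> + Re (J \<omega>))"
    using assms ito_integral_imp_ito_limit unfolding phase_solution_def by blast
  then show ?thesis by (rule choice)
qed

lemma phase_measurable_F: "phase_solution M F B W l \<phi> \<Longrightarrow> 0 \<le> t \<Longrightarrow> \<phi> t \<in> borel_measurable (F t)"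
  by (simp add: phase_solution_def adapted_def)

lemma phase_measurable: "phase_solution M F B W l \<phi> \<Longrightarrow> 0 \<le> t \<Longrightarrow> \<phi> t \<in> borel_measurable M"
  using phase_measurable_F measurable_F_M by blast

lemma phase_continuous: "phase_solution M F B W l \<phi> \<Longrightarrow> \<omega> \<in> space M \<Longrightarrow> continuous_on {0..} (\<lambda>t. \<phi> t \<omega>)"
  by (simp add: phase_solution_def)

text \<open>The common noise \<open>B\<close> cancels in the difference, and what remains besides the drift are increments of
  two stochastic integrals of size \<open>sqrt (t - u)\<close>.\<close>

lemma phase_difference_increment:
  assumes \<phi>: "phase_solution M F B W l \<phi>" and \<psi>: "phase_solution M F B W m \<psi>" and ut: "0 \<le> u" "u \<le> t"
  shows "(\<integral>\<^sup>+\<omega>. ennreal \<bar>(\<psi> t \<omega> - \<phi> t \<omega>) - (\<psi> u \<omega> - \<phi> u \<omega>) - (m - l) * (t - u)\<bar> \<partial>M)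
      \<le> ennreal (6 * sqrt (t - u))"
proof -
  from phase_solution_ito[OF \<phi>] obtain J where "\<forall>t\<ge>0. ito_limit (cutoff t (unit_phase \<phi>)) (J t)
    \<and> (AE \<omega> in M. \<phi> t \<omega> = l * t + B t \<omega> + Re (J t \<omega>))" ..
  note J = this[rule_format, THEN conjunct1] this[rule_format, THEN conjunct2]
  from phase_solution_ito[OF \<psi>] obtain K where "\<forall>t\<ge>0. ito_limit (cutoff t (unit_phase \<psi>)) (K t)
    \<and> (AE \<omega> in M. \<psi> t \<omega> = m * t + B t \<omega> + Re (K t \<omega>))" ..
  note K = this[rule_format, THEN conjunct1] this[rule_format, THEN conjunct2]
  have t: "0 \<le> t" using ut by simp
  have [measurable]: "J t \<in> borel_measurable M" "J u \<in> borel_measurable M" "K t \<in> borel_measurable M"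
      "K u \<in> borel_measurable M"
    using J(1) K(1) ut t by (auto simp: ito_limit_def)
  have "(\<integral>\<^sup>+\<omega>. ennreal \<bar>(\<psi> t \<omega> - \<phi> t \<omega>) - (\<psi> u \<omega> - \<phi> u \<omega>) - (m - l) * (t - u)\<bar> \<partial>M)
     \<le> (\<integral>\<^sup>+\<omega>. ennreal (norm (K t \<omega> - K u \<omega>)) + ennreal (norm (J t \<omega> - J u \<omega>)) \<partial>M)"
  proof (rule nn_integral_mono_AE)
    show "AE \<omega> in M. ennreal \<bar>(\<psi> t \<omega> - \<phi> t \<omega>) - (\<psi> u \<omega> - \<phi> u \<omega>) - (m - l) * (t - u)\<bar>
       \<le> ennreal (norm (K t \<omega> - K u \<omega>)) + ennreal (norm (J t \<omega> - J u \<omega>))"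
      using J(2)[OF t] J(2)[OF ut(1)] K(2)[OF t] K(2)[OF ut(1)]
    proof eventually_elim
      case (elim \<omega>)
      have "(\<psi> t \<omega> - \<phi> t \<omega>) - (\<psi> u \<omega> - \<phi> u \<omega>) - (m - l) * (t - u) = Re (K t \<omega> - K u \<omega>) - Re (J t \<omega> - J u \<omega>)"
        using elim by (simp add: algebra_simps)
      then have "\<bar>(\<psi> t \<omega> - \<phi> t \<omega>) - (\<psi> u \<omega> - \<phi> u \<omega>) - (m - l) * (t - u)\<bar> \<le> norm (K t \<omega> - K u \<omega>)
          + norm (J t \<omega> - J u \<omega>)"
        using abs_Re_le_cmod[of "K t \<omega> - K u \<omega>"] abs_Re_le_cmod[of "J t \<omega> - J u \<omega>"] by linarith
      then show ?case by (simp flip: ennreal_plus)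
    qed
  qed
  also have "\<dots> = mean_abs (K t) (K u) + mean_abs (J t) (J u)"
    by (rule nn_integral_add) auto
  also have "\<dots> \<le> ennreal (3 * sqrt (t - u)) + ennreal (3 * sqrt (t - u))"
    using norm_unit_phase by (intro add_mono ito_increment_first_moment_le[OF K(1)[OF t]
        K(1)[OF ut(1)] _ ut] ito_increment_first_moment_le[OF J(1)[OF t] J(1)[OF ut(1)] _ ut]) auto
  also have "\<dots> = ennreal (6 * sqrt (t - u))" using ut by (simp flip: ennreal_plus)
  finally show ?thesis .
qed

text \<open>The difference of the phases turns at speed \<open>m - l\<close>.  During half a turn, of duration \<open>pi / (m - l)\<close>, its
  random part moves by an amount of the order of the square root of this duration, so the cosine averages out.\<close>

lemma phase_difference_oscillates:
  assumes \<phi>: "phase_solution M F B W l \<phi>" and \<psi>: "phase_solution M F B W m \<psi>" and lm: "l < m" and T: "0 \<le> T"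
  shows "(\<integral>\<^sup>+\<omega>. ennreal \<bar>LINT s:{0..T}|lborel. cos (\<psi> s \<omega> - \<phi> s \<omega>)\<bar> \<partial>M)
    \<le> ennreal (3 * T * sqrt (pi / (m - l)) + pi / (m - l))"
proof -
  \<comment> \<open>Half a period of the drift \<open>(m - l) t\<close> of the difference.\<close>
  define \<delta> where "\<delta> = pi / (m - l)"
  have \<delta>: "0 < \<delta>" "(m - l) * \<delta> = pi" using lm by (auto simp: \<delta>_def)
  from phase_solution_ito[OF \<phi>] obtain J where "\<forall>t\<ge>0. ito_limit (cutoff t (unit_phase \<phi>)) (J t)
    \<and> (AE \<omega> in M. \<phi> t \<omega> = l * t + B t \<omega> + Re (J t \<omega>))" ..
  note J = this[rule_format, THEN conjunct1]
  from phase_solution_ito[OF \<psi>] obtain K where "\<forall>t\<ge>0. ito_limit (cutoff t (unit_phase \<psi>)) (K t)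
    \<and> (AE \<omega> in M. \<psi> t \<omega> = m * t + B t \<omega> + Re (K t \<omega>))" ..
  note K = this[rule_format, THEN conjunct1]
  \<comment> \<open>Cut off in time, the unit phases are jointly measurable, as the exchange of integrals requires.\<close>
  define h where "h s \<omega> = indicator {0..T + \<delta>} s * unit_phase \<phi> s \<omega>" for s \<omega>
  define k where "k s \<omega> = indicator {0..T + \<delta>} s * unit_phase \<psi> s \<omega>" for s \<omega>
  have hm: "(\<lambda>p. h (fst p) (snd p)) \<in> borel_measurable (lborel \<Otimes>\<^sub>M M)"
    and km: "(\<lambda>p. k (fst p) (snd p)) \<in> borel_measurable (lborel \<Otimes>\<^sub>M M)"
    using J[of "T + \<delta>"] K[of "T + \<delta>"] T \<delta>(1) by (auto simp: ito_limit_def h_def k_def split_beta')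
  have sh: "(\<lambda>p. (fst p + \<delta>, snd p)) \<in> measurable (lborel \<Otimes>\<^sub>M M) (lborel \<Otimes>\<^sub>M M)" by measurable
  have hs: "(\<lambda>p. h (fst p + \<delta>) (snd p)) \<in> borel_measurable (lborel \<Otimes>\<^sub>M M)"
    and ks: "(\<lambda>p. k (fst p + \<delta>) (snd p)) \<in> borel_measurable (lborel \<Otimes>\<^sub>M M)"
    using measurable_compose[OF sh hm] measurable_compose[OF sh km] by simp_all
  have [measurable]: "cnj \<in> borel_measurable borel"
    by (intro borel_measurable_continuous_onI continuous_intros)
  define f where "f s \<omega> = norm (indicator {0..T} s * (h s \<omega> * cnj (k s \<omega>) + h (s + \<delta>) \<omega> * cnj (k (s
      + \<delta>) \<omega>)))" for s \<omega>
  have fm: "(\<lambda>p. f (fst p) (snd p)) \<in> borel_measurable (lborel \<Otimes>\<^sub>M M)"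
    unfolding f_def using hm km hs ks by measurable
  have f: "f s \<omega> = norm (indicator {0..T} s * (iexp (\<psi> s \<omega> - \<phi> s \<omega>) + iexp (\<psi> (s + \<delta>) \<omega> - \<phi> (s
      + \<delta>) \<omega>)))" for s \<omega>
  proof -
    have "unit_phase \<phi> u \<omega> * cnj (unit_phase \<psi> u \<omega>) = iexp (\<psi> u \<omega> - \<phi> u \<omega>)" for u
      by (simp add: exp_cnj exp_add[symmetric] algebra_simps)
    then show ?thesis using T \<delta>(1) by (auto simp: f_def h_def k_def indicator_def simp del: of_real_diff)
  qed
  interpret LM: pair_sigma_finite lborel M ..
  have fm2[measurable]: "(\<lambda>\<omega>. \<integral>\<^sup>+s. ennreal (f s \<omega>) \<partial>lborel) \<in> borel_measurable M"
    using measurable_compose[OF measurable_compose[OF measurable_Pair[OF measurable_snd measurable_fst] fm] measurable_ennreal]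
    by (intro lborel.borel_measurable_nn_integral) (simp add: split_beta')
  have "(\<integral>\<^sup>+\<omega>. ennreal \<bar>LINT s:{0..T}|lborel. cos (\<psi> s \<omega> - \<phi> s \<omega>)\<bar> \<partial>M)
     \<le> (\<integral>\<^sup>+\<omega>. ennreal (1/2) * (\<integral>\<^sup>+s. ennreal (f s \<omega>) \<partial>lborel) + ennreal \<delta> \<partial>M)"
    unfolding f using T \<delta>(1)
    by (intro nn_integral_mono cos_integral_half_period_shift continuous_on_diff phase_continuous[OF \<phi>]
        phase_continuous[OF \<psi>]) auto
  also have "\<dots> = ennreal (1/2) * (\<integral>\<^sup>+\<omega>. (\<integral>\<^sup>+s. ennreal (f s \<omega>) \<partial>lborel) \<partial>M) + ennreal \<delta>"
    by (subst nn_integral_add) (auto simp: nn_integral_cmult emeasure_space_1 simp del: ennreal_half)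
  also have "(\<integral>\<^sup>+\<omega>. (\<integral>\<^sup>+s. ennreal (f s \<omega>) \<partial>lborel) \<partial>M) = (\<integral>\<^sup>+s. (\<integral>\<^sup>+\<omega>. ennreal (f s \<omega>) \<partial>M) \<partial>lborel)"
    using fm by (intro LM.Fubini') (simp add: split_beta')
  also have "\<dots> \<le> (\<integral>\<^sup>+s. ennreal (6 * sqrt \<delta>) * indicator {0..T} s \<partial>lborel)"
  proof (intro nn_integral_mono)
    fix s
    show "(\<integral>\<^sup>+\<omega>. ennreal (f s \<omega>) \<partial>M) \<le> ennreal (6 * sqrt \<delta>) * indicator {0..T} s"
    proof (cases "s \<in> {0..T}")
      case True
      have "f s \<omega> \<le> \<bar>(\<psi> (s + \<delta>) \<omega> - \<phi> (s + \<delta>) \<omega>) - (\<psi> s \<omega> - \<phi> s \<omega>) - (m - l) * (s + \<delta> - s)\<bar>" for \<omega>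
      proof -
        let ?x = "\<psi> s \<omega> - \<phi> s \<omega>" and ?y = "\<psi> (s + \<delta>) \<omega> - \<phi> (s + \<delta>) \<omega>"
        have "iexp y = - iexp (y - pi)" for y
          by (simp add: complex_eq_iff Re_exp Im_exp)
        from this[of ?y] have "f s \<omega> = norm (iexp ?x - iexp (?y - pi))"
          using True unfolding f by (simp only:) (simp del: of_real_diff)
        also have "\<dots> \<le> \<bar>?x - (?y - pi)\<bar>" by (rule norm_iexp_diff_le)
        also have "\<dots> = \<bar>?y - ?x - (m - l) * (s + \<delta> - s)\<bar>" using \<delta>(2) by simp
        finally show ?thesis .
      qed
      then have "(\<integral>\<^sup>+\<omega>. ennreal (f s \<omega>) \<partial>M) \<le> ennreal (6 * sqrt (s + \<delta> - s))"
        using True \<delta>(1) by (intro order_trans[OF nn_integral_mono phase_difference_increment[OF \<phi> \<psi>]] ennreal_leI) auto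
      then show ?thesis using True by simp
    next
      case False
      then show ?thesis by (simp add: f_def)
    qed
  qed
  also have "\<dots> = ennreal (6 * T * sqrt \<delta>)"
    using T \<delta>(1) by (subst nn_integral_cmult_indicator) (auto simp: ennreal_mult[symmetric] ac_simps)
  finally have "(\<integral>\<^sup>+\<omega>. ennreal \<bar>LINT s:{0..T}|lborel. cos (\<psi> s \<omega> - \<phi> s \<omega>)\<bar> \<partial>M)
     \<le> ennreal (1/2) * ennreal (6 * T * sqrt \<delta>) + ennreal \<delta>"
    by (simp add: mult_left_mono add_mono)
  also have "\<dots> = ennreal (1/2 * (6 * T * sqrt \<delta>) + \<delta>)"
    using T \<delta>(1) ennreal_plus[of "1/2 * (6 * T * sqrt \<delta>)" \<delta>] ennreal_mult[of "1/2" "6 * T * sqrt \<delta>"] by simp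
  finally show ?thesis by (simp add: \<delta>_def mult.assoc)
qed

end

section \<open>The joint characteristic function of two phases\<close>

lemma norm_unit_phase_combination:
  "(norm (complex_of_real a * exp (- \<i> * complex_of_real x)
      + complex_of_real b * exp (- \<i> * complex_of_real y)))\<^sup>2
    = a\<^sup>2 + b\<^sup>2 + 2 * a * b * cos (y - x)"
proof -
  have "(norm (complex_of_real a * exp (- \<i> * complex_of_real x)
      + complex_of_real b * exp (- \<i> * complex_of_real y)))\<^sup>2
    = (a * cos x + b * cos y)\<^sup>2 + (a * sin x + b * sin y)\<^sup>2"
    unfolding cmod_power2 by (simp add: Re_exp Im_exp power2_eq_square algebra_simps)
  also have "\<dots> = a\<^sup>2 * ((sin x)\<^sup>2 + (cos x)\<^sup>2) + b\<^sup>2 * ((sin y)\<^sup>2 + (cos y)\<^sup>2) + 2 * a * b * cos (y - x)"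
    unfolding cos_diff power2_eq_square by (simp only: algebra_simps)
  finally show ?thesis by simp
qed

lemma abs_exp_minus_one_le: "\<bar>exp x - 1\<bar> \<le> \<bar>x\<bar> * exp \<bar>x\<bar>" for x :: real
proof -
  have "1 - exp (- \<bar>x\<bar>) \<le> \<bar>x\<bar>" using exp_ge_add_one_self[of "- \<bar>x\<bar>"] by simp
  then have "exp \<bar>x\<bar> * (1 - exp (- \<bar>x\<bar>)) \<le> exp \<bar>x\<bar> * \<bar>x\<bar>" by (intro mult_left_mono) auto
  then have pos: "exp \<bar>x\<bar> - 1 \<le> \<bar>x\<bar> * exp \<bar>x\<bar>" by (simp add: right_diff_distrib exp_minus mult.commute)
  show ?thesis
  proof (cases "0 \<le> x")
    case False
    have "1 - exp x \<le> - x" using exp_ge_add_one_self[of x] by linarith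
    also have "\<dots> \<le> \<bar>x\<bar> * exp \<bar>x\<bar>" using False mult_left_mono[of 1 "exp (-x)" "-x"] by simp
    finally show ?thesis using False by simp
  qed (use pos in simp)
qed

context noise
begin

text \<open>The cross variation of the two centred phases is, up to a deterministic part, half the time
  integral of the cosine of their difference.  The exponential identity therefore says that the characteristic
  function is Gaussian, with the two stochastic integrals uncorrelated, up to the mean of that
  integral, which is small by oscillation.\<close>

theorem phase_characteristic_function:
  assumes \<phi>: "phase_solution M F B W l \<phi>" and \<psi>: "phase_solution M F B W m \<psi>" and lm: "l < m" and T: "0 < T"
    and v: "v = ((a + b)\<^sup>2 + (a\<^sup>2 + b\<^sup>2) / 2) / 2 * T" and c: "c = \<bar>a * b\<bar> / 2"
  shows "norm ((\<integral>\<omega>. iexp (a * (\<phi> T \<omega> - l * T) + b * (\<psi> T \<omega> - m * T)) \<partial>M) * exp v - 1)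
    \<le> exp v * (c * exp (c * T)) * (3 * T * sqrt (pi / (m - l)) + pi / (m - l))"
proof -
  have T0: "0 \<le> T" using T by simp
  from phase_solution_ito[OF \<phi>] obtain J where "\<forall>t\<ge>0. ito_limit (cutoff t (unit_phase \<phi>)) (J t)
    \<and> (AE \<omega> in M. \<phi> t \<omega> = l * t + B t \<omega> + Re (J t \<omega>))" ..
  note J = this[rule_format, OF T0, THEN conjunct1] this[rule_format, OF T0, THEN conjunct2]
  from phase_solution_ito[OF \<psi>] obtain K where "\<forall>t\<ge>0. ito_limit (cutoff t (unit_phase \<psi>)) (K t)
    \<and> (AE \<omega> in M. \<psi> t \<omega> = m * t + B t \<omega> + Re (K t \<omega>))" ..
  note K = this[rule_format, OF T0, THEN conjunct1] this[rule_format, OF T0, THEN conjunct2]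
  define t where "t n i = grid T n i" for n i
  define dW where "dW n i \<omega> = W (t n (Suc i)) \<omega> - W (t n i) \<omega>" for n i \<omega>
  define R where "R n \<omega> = (\<Sum>i<Suc n. unit_phase \<phi> (t n i) \<omega> * dW n i \<omega>)" for n \<omega>
  define S where "S n \<omega> = (\<Sum>i<Suc n. unit_phase \<psi> (t n i) \<omega> * dW n i \<omega>)" for n \<omega>
  define A where "A n \<omega> = (\<Sum>i<Suc n. cos (\<psi> (t n i) \<omega> - \<phi> (t n i) \<omega>) * (t n (Suc i) - t n i))" for n \<omega>
  define A' where "A' \<omega> = (LINT s:{0..T}|lborel. cos (\<psi> s \<omega> - \<phi> s \<omega>))" for \<omega>
  \<comment> \<open>\<open>Zn n\<close> is \<open>Z\<close> with Riemann sums in place of the stochastic integrals.\<close>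
  define Z where "Z \<omega> = a * (\<phi> T \<omega> - l * T) + b * (\<psi> T \<omega> - m * T)" for \<omega>
  define Zn where "Zn n \<omega> = (a + b) * (B T \<omega> - B 0 \<omega>) + Re (a * R n \<omega> + b * S n \<omega>)" for n \<omega>
  have t: "0 \<le> t n i" "t n i \<le> t n (Suc i)" "t n 0 = 0" "t n (Suc n) = T" for n i
    using grid_bounds(1,2)[OF T] grid_bounds(3,4)[of T n] by (auto simp: t_def less_imp_le)
  have up\<phi>: "unit_phase \<phi> s \<in> borel_measurable (F s)" and up\<psi>: "unit_phase \<psi> s \<in> borel_measurable (F s)"
      if "0 \<le> s" for s
    using phase_measurable_F[OF \<phi> that] phase_measurable_F[OF \<psi> that] by measurable
  have [measurable]: "\<phi> T \<in> borel_measurable M" "\<psi> T \<in> borel_measurable M"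
      "\<phi> (t n i) \<in> borel_measurable M" "\<psi> (t n i) \<in> borel_measurable M"
    "W (t n i) \<in> borel_measurable M" "B T \<in> borel_measurable M" "B 0 \<in> borel_measurable M" for n i
    using phase_measurable[OF \<phi>] phase_measurable[OF \<psi>] t(1) T0
      noise_measurable_F(1)[OF T0 order_refl, THEN measurable_F_M]
          noise_measurable_F(1)[OF order_refl T0, THEN measurable_F_M]
    by auto
  have [measurable]: "R n \<in> borel_measurable M" "S n \<in> borel_measurable M" "A n \<in> borel_measurable M"
      "Z \<in> borel_measurable M" for n
    unfolding R_def[abs_def] S_def[abs_def] A_def[abs_def] Z_def[abs_def] dW_def by measurable
  have [measurable]: "Zn n \<in> borel_measurable M" for n unfolding Zn_def[abs_def] by measurable
  have [measurable]: "J T \<in> borel_measurable M" "K T \<in> borel_measurable M" using J(1) K(1) by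
      (auto simp: ito_limit_def)
  have cc: "continuous_on {0..} (\<lambda>s. cos (\<psi> s \<omega> - \<phi> s \<omega>))" if "\<omega> \<in> space M" for \<omega>
    using that by (intro continuous_intros phase_continuous[OF \<phi>] phase_continuous[OF \<psi>])
  have A_lim: "(\<lambda>n. A n \<omega>) \<longlonglongrightarrow> A' \<omega>" and A_le: "\<bar>A n \<omega>\<bar> \<le> T" if "\<omega> \<in> space M" for \<omega> n
    unfolding A_def A'_def t_def using grid_sum_tendsto_integral[OF T cc[OF that]] by auto
  have A'm[measurable]: "A' \<in> borel_measurable M"
    by (rule borel_measurable_LIMSEQ_metric[of A]) (use A_lim in auto)
  have A'_le: "\<bar>A' \<omega>\<bar> \<le> T" if "\<omega> \<in> space M" for \<omega>
    using LIMSEQ_le_const2[OF tendsto_rabs[OF A_lim[OF that]]] A_le[OF that] by auto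
  \<comment> \<open>The exponential identity for the integrand \<open>a exp (-i \<phi>) + b exp (-i \<psi>)\<close> sampled on the grid; its
    squared modulus contributes the constant \<open>v\<close> and the oscillating sum \<open>A n\<close>.\<close>
  have identity: "(\<integral>\<omega>. iexp (Zn n \<omega>) * exp (v + a * b / 2 * A n \<omega>) \<partial>M) = 1" for n
  proof -
    define k where "k i \<omega> = a * unit_phase \<phi> (t n i) \<omega> + b * unit_phase \<psi> (t n i) \<omega>" for i \<omega>
    have kF: "k i \<in> borel_measurable (F (t n i))" for i
      unfolding k_def[abs_def] using up\<phi>[OF t(1)] up\<psi>[OF t(1)] by measurable
    have kb: "norm (k i \<omega>) \<le> \<bar>a\<bar> + \<bar>b\<bar>" for i \<omega>
      unfolding k_def by (rule order_trans[OF norm_triangle_ineq]) (simp add: norm_mult norm_exp_eq_Re)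
    have k2: "(norm (k i \<omega>))\<^sup>2 = a\<^sup>2 + b\<^sup>2 + 2 * a * b * cos (\<psi> (t n i) \<omega> - \<phi> (t n i) \<omega>)" for i \<omega>
      unfolding k_def by (rule norm_unit_phase_combination)
    have tele: "(\<Sum>i<Suc n. f (t n (Suc i)) - f (t n i)) = f T - f 0" for f :: "real \<Rightarrow> real"
      using sum_lessThan_telescope[of "\<lambda>i. f (t n i)" "Suc n"] t by simp
    have 1: "(\<Sum>i<Suc n. (a + b) * (B (t n (Suc i)) \<omega> - B (t n i) \<omega>) + Re (k i \<omega> * dW n i \<omega>)) = Zn n \<omega>" for \<omega>
    proof -
      have "(\<Sum>i<Suc n. k i \<omega> * dW n i \<omega>) = a * R n \<omega> + b * S n \<omega>"
        by (simp only: k_def R_def S_def distrib_right sum.distrib sum_distrib_left mult.assoc)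
      then have "(\<Sum>i<Suc n. Re (k i \<omega> * dW n i \<omega>)) = Re (a * R n \<omega> + b * S n \<omega>)" by
          (simp only: Re_sum[symmetric])
      then show ?thesis unfolding Zn_def sum.distrib sum_distrib_left[symmetric] tele[of "\<lambda>s. B s \<omega>"]
          by simp
    qed
    have 2: "(\<Sum>i<Suc n. ((a + b)\<^sup>2 + (norm (k i \<omega>))\<^sup>2 / 2) / 2 * (t n (Suc i) - t n i)) = v
        + a * b / 2 * A n \<omega>" for \<omega>
    proof -
      have "((a + b)\<^sup>2 + (norm (k i \<omega>))\<^sup>2 / 2) / 2 * (t n (Suc i) - t n i) =
         ((a + b)\<^sup>2 + (a\<^sup>2 + b\<^sup>2) / 2) / 2 * (t n (Suc i) - t n i)
             + a * b / 2 * (cos (\<psi> (t n i) \<omega> - \<phi> (t n i) \<omega>) * (t n (Suc i) - t n i))" for i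
        unfolding k2 by (simp add: field_simps)
      then show ?thesis
        by (simp only: sum.distrib sum_distrib_left[symmetric] tele[of "\<lambda>s. s"] A_def v) simp
    qed
    have split: "(\<Sum>i<Suc n. \<i> * complex_of_real (p i) + complex_of_real (q i))
        = \<i> * complex_of_real (\<Sum>i<Suc n. p i) + complex_of_real (\<Sum>i<Suc n. q i)" for p q :: "nat \<Rightarrow> real"
      by (simp only: sum.distrib of_real_sum sum_distrib_left)
    have "1 = (\<integral>\<omega>. exp (\<Sum>i<Suc n. \<i> * complex_of_real ((a + b) * (B (t n (Suc i)) \<omega> - B (t n i) \<omega>)
        + Re (k i \<omega> * (W (t n (Suc i)) \<omega> - W (t n i) \<omega>)))
      + complex_of_real (((a + b)\<^sup>2 + (norm (k i \<omega>))\<^sup>2 / 2) / 2 * (t n (Suc i) - t n i))) \<partial>M)"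
      by (rule exponential_martingale[where ts="t n" and k=k, OF t(1) t(2) kF kb, symmetric])
    also have "\<dots> = (\<integral>\<omega>. iexp (Zn n \<omega>) * exp (v + a * b / 2 * A n \<omega>) \<partial>M)"
      unfolding dW_def[symmetric] split 1 2 exp_add exp_of_real ..
    finally show ?thesis ..
  qed
  have iZ: "integrable M (\<lambda>\<omega>. iexp (Zn n \<omega>))" for n
    by (rule integrable_const_bound[where B=1]) auto
  have c0: "0 \<le> c" by (simp add: c)
  \<comment> \<open>Without the factor coming from \<open>A n\<close> the identity fails by at most a multiple of the mean of \<open>A n\<close>.\<close>
  have bound_n: "norm ((\<integral>\<omega>. iexp (Zn n \<omega>) \<partial>M) * exp v - 1)
      \<le> exp v * (c * exp (c * T)) * (\<integral>\<omega>. \<bar>A n \<omega>\<bar> \<partial>M)" for n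
  proof -
    have pt: "\<bar>exp (a * b / 2 * A n \<omega>) - 1\<bar> \<le> c * exp (c * T) * \<bar>A n \<omega>\<bar>" if "\<omega> \<in> space M" for \<omega>
    proof -
      have e: "\<bar>a * b / 2 * A n \<omega>\<bar> = c * \<bar>A n \<omega>\<bar>" by (simp add: c abs_mult)
      have "\<bar>exp (a * b / 2 * A n \<omega>) - 1\<bar> \<le> c * \<bar>A n \<omega>\<bar> * exp (c * \<bar>A n \<omega>\<bar>)"
        using abs_exp_minus_one_le[of "a * b / 2 * A n \<omega>"] unfolding e .
      also have "\<dots> \<le> c * \<bar>A n \<omega>\<bar> * exp (c * T)"
        using A_le[OF that, of n] c0 by (intro mult_left_mono) (auto intro: mult_left_mono)
      finally show ?thesis by (simp add: ac_simps)
    qed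
    have iA: "integrable M (\<lambda>\<omega>. \<bar>A n \<omega>\<bar>)"
      by (rule integrable_const_bound[where B=T]) (use A_le in auto)
    have iE: "integrable M (\<lambda>\<omega>. iexp (Zn n \<omega>) * exp (v + a * b / 2 * A n \<omega>))"
    proof (rule integrable_const_bound[where B="exp (v + c * T)"])
      show "AE \<omega> in M. norm (iexp (Zn n \<omega>) * complex_of_real (exp (v + a * b / 2 * A n \<omega>))) \<le> exp (v
          + c * T)"
      proof (rule AE_I2)
        fix \<omega> assume w: "\<omega> \<in> space M"
        have "a * b / 2 * A n \<omega> \<le> \<bar>a * b / 2 * A n \<omega>\<bar>" by simp
        also have "\<dots> = c * \<bar>A n \<omega>\<bar>" by (simp add: c abs_mult)
        also have "\<dots> \<le> c * T" using A_le[OF w] c0 by (intro mult_left_mono)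
        finally show "norm (iexp (Zn n \<omega>) * complex_of_real (exp (v + a * b / 2 * A n \<omega>))) \<le> exp (v
            + c * T)"
          by (simp add: norm_mult)
      qed
    qed measurable
    have "(\<integral>\<omega>. iexp (Zn n \<omega>) \<partial>M) * exp v - 1
        = (\<integral>\<omega>. iexp (Zn n \<omega>) * exp v \<partial>M) - (\<integral>\<omega>. iexp (Zn n \<omega>) * exp (v + a * b / 2 * A n \<omega>) \<partial>M)"
      unfolding identity by simp
    also have "\<dots> = (\<integral>\<omega>. iexp (Zn n \<omega>) * exp v - iexp (Zn n \<omega>) * exp (v + a * b / 2 * A n \<omega>) \<partial>M)"
      using iZ iE by (intro Bochner_Integration.integral_diff[symmetric]) auto
    also have "norm \<dots> \<le> (\<integral>\<omega>. norm (iexp (Zn n \<omega>) * exp v - iexp (Zn n \<omega>) * exp (v + a * b / 2 * A n \<omega>)) \<partial>M)"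
      by (rule integral_norm_bound)
    also have "\<dots> \<le> (\<integral>\<omega>. exp v * (c * exp (c * T)) * \<bar>A n \<omega>\<bar> \<partial>M)"
    proof (rule integral_mono)
      show "integrable M (\<lambda>\<omega>. norm (iexp (Zn n \<omega>) * exp v - iexp (Zn n \<omega>) * exp (v + a * b / 2 * A n \<omega>)))"
        using iZ iE by (intro integrable_norm Bochner_Integration.integrable_diff) auto
      fix \<omega> assume w: "\<omega> \<in> space M"
      have "iexp (Zn n \<omega>) * exp v - iexp (Zn n \<omega>) * exp (v + a * b / 2 * A n \<omega>)
         = iexp (Zn n \<omega>) * complex_of_real (exp v * (1 - exp (a * b / 2 * A n \<omega>)))"
        by (simp add: exp_add right_diff_distrib)
      then have "norm (iexp (Zn n \<omega>) * exp v - iexp (Zn n \<omega>) * exp (v + a * b / 2 * A n \<omega>))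
          = exp v * \<bar>exp (a * b / 2 * A n \<omega>) - 1\<bar>"
        by (simp only: norm_mult norm_of_real) (simp add: abs_mult abs_minus_commute)
      then show "norm (iexp (Zn n \<omega>) * exp v - iexp (Zn n \<omega>) * exp (v + a * b / 2 * A n \<omega>))
          \<le> exp v * (c * exp (c * T)) * \<bar>A n \<omega>\<bar>"
        using pt[OF w] by (simp add: mult.assoc)
    qed (use iA in simp)
    finally show ?thesis by simp
  qed
  have Alim: "(\<lambda>n. \<integral>\<omega>. \<bar>A n \<omega>\<bar> \<partial>M) \<longlonglongrightarrow> (\<integral>\<omega>. \<bar>A' \<omega>\<bar> \<partial>M)"
    by (rule integral_dominated_convergence[where w="\<lambda>_. T"])
      (use A_lim A_le in \<open>auto intro!: AE_I2 tendsto_rabs\<close>)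
  have Zlim: "(\<lambda>n. \<integral>\<omega>. iexp (Zn n \<omega>) \<partial>M) \<longlonglongrightarrow> (\<integral>\<omega>. iexp (Z \<omega>) \<partial>M)"
  proof -
    have iZ': "integrable M (\<lambda>\<omega>. iexp (Z \<omega>))" by (rule integrable_const_bound[where B=1]) auto
    define D where "D n = ennreal \<bar>a\<bar> * mean_abs (J T) (R n) + ennreal \<bar>b\<bar> * mean_abs (K T) (S n)" for n
    have cont\<phi>: "continuous_on {0..} (\<lambda>s. unit_phase \<phi> s \<omega>)" if "\<omega> \<in> space M" for \<omega>
      using that by (intro continuous_intros phase_continuous[OF \<phi>])
    have cont\<psi>: "continuous_on {0..} (\<lambda>s. unit_phase \<psi> s \<omega>)" if "\<omega> \<in> space M" for \<omega>
      using that by (intro continuous_intros phase_continuous[OF \<psi>])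
    have "(\<lambda>n. mean_abs (J T) (R n)) \<longlonglongrightarrow> 0"
      unfolding R_def dW_def t_def using norm_unit_phase
      by (intro riemann_sums_tendsto_ito[OF T up\<phi> _ cont\<phi> J(1)]) auto
    moreover have "(\<lambda>n. mean_abs (K T) (S n)) \<longlonglongrightarrow> 0"
      unfolding S_def dW_def t_def using norm_unit_phase
      by (intro riemann_sums_tendsto_ito[OF T up\<psi> _ cont\<psi> K(1)]) auto
    ultimately have "D \<longlonglongrightarrow> ennreal \<bar>a\<bar> * 0 + ennreal \<bar>b\<bar> * 0"
      unfolding D_def by (intro tendsto_add ennreal_tendsto_cmult) auto
    then have D0: "D \<longlonglongrightarrow> 0" by simp
    have "ennreal (norm ((\<integral>\<omega>. iexp (Zn n \<omega>) \<partial>M) - (\<integral>\<omega>. iexp (Z \<omega>) \<partial>M))) \<le> D n" for n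
    proof -
      have "(\<integral>\<omega>. iexp (Zn n \<omega>) \<partial>M) - (\<integral>\<omega>. iexp (Z \<omega>) \<partial>M) = (\<integral>\<omega>. iexp (Zn n \<omega>) - iexp (Z \<omega>) \<partial>M)"
        using iZ iZ' by simp
      also have "ennreal (norm \<dots>) \<le> (\<integral>\<^sup>+\<omega>. ennreal (norm (iexp (Zn n \<omega>) - iexp (Z \<omega>))) \<partial>M)"
        using iZ iZ' by (intro integral_norm_bound_ennreal) auto
      also have "\<dots> \<le> (\<integral>\<^sup>+\<omega>. ennreal \<bar>a\<bar> * ennreal (norm (J T \<omega> - R n \<omega>))
          + ennreal \<bar>b\<bar> * ennreal (norm (K T \<omega> - S n \<omega>)) \<partial>M)"
      proof (rule nn_integral_mono_AE)
        have "AE \<omega> in M. B 0 \<omega> = 0" using brownian(1) by (simp add: standard_brownian_motion_def)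
        with J(2) K(2)
        show "AE \<omega> in M. ennreal (norm (iexp (Zn n \<omega>) - iexp (Z \<omega>)))
            \<le> ennreal \<bar>a\<bar> * ennreal (norm (J T \<omega> - R n \<omega>)) + ennreal \<bar>b\<bar> * ennreal (norm (K T \<omega> - S n \<omega>))"
        proof eventually_elim
          case (elim \<omega>)
          have "Z \<omega> - Zn n \<omega> = a * Re (J T \<omega> - R n \<omega>) + b * Re (K T \<omega> - S n \<omega>)"
            using elim by (simp add: Z_def Zn_def algebra_simps)
          then have "\<bar>Zn n \<omega> - Z \<omega>\<bar> \<le> \<bar>a * Re (J T \<omega> - R n \<omega>)\<bar> + \<bar>b * Re (K T \<omega> - S n \<omega>)\<bar>" by linarith
          also have "\<dots> \<le> \<bar>a\<bar> * norm (J T \<omega> - R n \<omega>) + \<bar>b\<bar> * norm (K T \<omega> - S n \<omega>)"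
            unfolding abs_mult by (intro add_mono mult_left_mono abs_Re_le_cmod) auto
          finally have "norm (iexp (Zn n \<omega>) - iexp (Z \<omega>)) \<le> \<bar>a\<bar> * norm (J T \<omega> - R n \<omega>)
              + \<bar>b\<bar> * norm (K T \<omega> - S n \<omega>)"
            using norm_iexp_diff_le[of "Zn n \<omega>" "Z \<omega>"] by simp
          then have "ennreal (norm (iexp (Zn n \<omega>) - iexp (Z \<omega>))) \<le> ennreal (\<bar>a\<bar> * norm (J T \<omega> - R n \<omega>)
              + \<bar>b\<bar> * norm (K T \<omega> - S n \<omega>))"
            by (rule ennreal_leI)
          then show ?case by (simp add: ennreal_plus ennreal_mult)
        qed
      qed
      also have "\<dots> = D n" unfolding D_def by (simp add: nn_integral_add nn_integral_cmult)
      finally show ?thesis .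
    qed
    then have "(\<lambda>n. ennreal (norm ((\<integral>\<omega>. iexp (Zn n \<omega>) \<partial>M) - (\<integral>\<omega>. iexp (Z \<omega>) \<partial>M)))) \<longlonglongrightarrow> 0"
      by (intro tendsto_sandwich[OF _ _ tendsto_const D0]) (auto intro!: always_eventually)
    then have "(\<lambda>n. norm ((\<integral>\<omega>. iexp (Zn n \<omega>) \<partial>M) - (\<integral>\<omega>. iexp (Z \<omega>) \<partial>M))) \<longlonglongrightarrow> 0"
      by (subst (asm) ennreal_tendsto_0_iff) auto
    then show ?thesis by (subst LIM_zero_iff[symmetric]) (rule tendsto_norm_zero_cancel)
  qed
  have "norm ((\<integral>\<omega>. iexp (Z \<omega>) \<partial>M) * exp v - 1) \<le> exp v * (c * exp (c * T)) * (\<integral>\<omega>. \<bar>A' \<omega>\<bar> \<partial>M)"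
  proof (rule LIMSEQ_le)
    show "(\<lambda>n. norm ((\<integral>\<omega>. iexp (Zn n \<omega>) \<partial>M) * exp v - 1)) \<longlonglongrightarrow> norm ((\<integral>\<omega>. iexp (Z \<omega>) \<partial>M) * exp v - 1)"
      by (intro tendsto_intros Zlim)
    show "(\<lambda>n. exp v * (c * exp (c * T)) * (\<integral>\<omega>. \<bar>A n \<omega>\<bar> \<partial>M)) \<longlonglongrightarrow> exp v * (c * exp (c * T)) * (\<integral>\<omega>. \<bar>A' \<omega>\<bar> \<partial>M)"
      by (intro tendsto_intros Alim)
  qed (use bound_n in auto)
  also have "\<dots> \<le> exp v * (c * exp (c * T)) * (3 * T * sqrt (pi / (m - l)) + pi / (m - l))"
  proof (rule mult_left_mono)
    have iA': "integrable M (\<lambda>\<omega>. \<bar>A' \<omega>\<bar>)"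
      by (rule integrable_const_bound[where B=T]) (use A'_le in auto)
    have "ennreal (\<integral>\<omega>. \<bar>A' \<omega>\<bar> \<partial>M) = (\<integral>\<^sup>+\<omega>. ennreal \<bar>A' \<omega>\<bar> \<partial>M)"
      using iA' by (intro nn_integral_eq_integral[symmetric]) auto
    also have "\<dots> \<le> ennreal (3 * T * sqrt (pi / (m - l)) + pi / (m - l))"
      unfolding A'_def by (rule phase_difference_oscillates[OF \<phi> \<psi> lm T0])
    finally show "(\<integral>\<omega>. \<bar>A' \<omega>\<bar> \<partial>M) \<le> 3 * T * sqrt (pi / (m - l)) + pi / (m - l)"
      using T lm by (subst (asm) ennreal_le_iff) auto
  qed (use c0 in auto)
  finally show ?thesis unfolding Z_def .
qed

end

section \<open>Limits of the phases and of the counting variable\<close>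

lemma real_analytic_imp_continuous:
  assumes "real_analytic f"
  shows "continuous_on UNIV f"
proof -
  have "isCont f x" for x
  proof -
    obtain r a where r: "0 < r" and a: "\<And>y. \<bar>y - x\<bar> < r \<Longrightarrow> (\<lambda>n. a n * (y - x) ^ n) sums f y"
      using assms unfolding real_analytic_def by metis
    have "summable (\<lambda>n. a n * (r / 2) ^ n)"
      using a[of "x + r / 2"] r by (auto simp: sums_iff)
    then have "isCont (\<lambda>z. \<Sum>n. a n * z ^ n) (x - x)"
      using r by (intro isCont_powser) auto
    then have c: "isCont (\<lambda>y. \<Sum>n. a n * (y - x) ^ n) x"
      by (rule isCont_o2[where f="\<lambda>y. y - x", rotated]) (intro continuous_intros)
    have "\<forall>\<^sub>F y in nhds x. (\<Sum>n. a n * (y - x) ^ n) = f y"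
      unfolding eventually_nhds_metric using r a by (auto simp: dist_real_def sums_iff)
    then show ?thesis using c isCont_cong[of "\<lambda>y. \<Sum>n. a n * (y - x) ^ n" f x] by simp
  qed
  then show ?thesis by (simp add: continuous_on_eq_continuous_at)
qed

text \<open>For an increasing continuous function, the points with a value in \<open>c \<int>\<close> correspond to the multiples of
  \<open>c\<close> between the values at the two ends.\<close>

lemma card_level_crossings:
  fixes g :: "real \<Rightarrow> real" and c :: real
  assumes g: "strict_mono g" "continuous_on UNIV g" and ab: "a \<le> b" and c: "0 < c"
  shows "int (card ({l. \<exists>n::int. g l = c * of_int n} \<inter> {a..b})) = \<lfloor>g b / c\<rfloor> - \<lceil>g a / c\<rceil> + 1"
proof -
  let ?S = "{l. \<exists>n::int. g l = c * of_int n} \<inter> {a..b}" and ?I = "{\<lceil>g a / c\<rceil>..\<lfloor>g b / c\<rfloor>}"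
  \<comment> \<open>A point is labelled by the index of its level; surjectivity is the intermediate value theorem.\<close>
  have "bij_betw (\<lambda>l. \<lfloor>g l / c\<rfloor>) ?S ?I"
  proof (rule bij_betwI')
    fix x y assume "x \<in> ?S" "y \<in> ?S"
    then show "(\<lfloor>g x / c\<rfloor> = \<lfloor>g y / c\<rfloor>) = (x = y)"
      using c strict_mono_eq[OF g(1), of x y] by auto
  next
    fix x assume x: "x \<in> ?S"
    then have "g a \<le> g x" "g x \<le> g b" using g(1) by (auto simp: strict_mono_less_eq)
    then have "g a / c \<le> g x / c" "g x / c \<le> g b / c" using c by (auto simp: divide_right_mono)
    then show "\<lfloor>g x / c\<rfloor> \<in> ?I" using x c by (auto simp: ceiling_le_iff le_floor_iff)
  next
    fix n assume "n \<in> ?I"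
    then have "g a \<le> c * of_int n" "c * of_int n \<le> g b"
      using c by (auto simp: ceiling_le_iff le_floor_iff field_simps)
    then obtain x where "a \<le> x" "x \<le> b" "g x = c * of_int n"
      using IVT'[of g a "c * of_int n" b] ab continuous_on_subset[OF g(2)] by auto
    then show "\<exists>x\<in>?S. n = \<lfloor>g x / c\<rfloor>" using c by (intro bexI[of _ x]) auto
  qed
  then have "card ?S = card ?I" by (rule bij_betw_same_card)
  moreover have "g a / c \<le> g b / c"
    using c g(1) ab by (auto simp: divide_right_mono strict_mono_less_eq)
  then have "\<lceil>g a / c\<rceil> \<le> \<lfloor>g b / c\<rfloor> + 1" by linarith
  ultimately show ?thesis by simp
qed

lemma Sch_count_eq:
  assumes \<phi>: "strict_mono (\<lambda>l. \<phi> l \<tau> \<omega>)" "continuous_on UNIV (\<lambda>l. \<phi> l \<tau> \<omega>)" and \<tau>: "0 < \<tau>" and ab: "a \<le> b"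
  shows "real (Sch_count \<phi> \<tau> a b \<omega>)
      = real_of_int (\<lfloor>\<phi> (b / \<tau>) \<tau> \<omega> / (2 * pi)\<rfloor> - \<lceil>\<phi> (a / \<tau>) \<tau> \<omega> / (2 * pi)\<rceil> + 1)"
proof -
  have "strict_mono (\<lambda>l. \<phi> (l / \<tau>) \<tau> \<omega>)"
    using \<phi>(1) \<tau> by (auto simp: strict_mono_def divide_strict_right_mono)
  moreover have "continuous_on UNIV (\<lambda>l. \<phi> (l / \<tau>) \<tau> \<omega>)"
    by (rule continuous_on_compose2[OF \<phi>(2)]) (use \<tau> in \<open>auto intro!: continuous_intros\<close>)
  ultimately have "int (Sch_count \<phi> \<tau> a b \<omega>) = \<lfloor>\<phi> (b / \<tau>) \<tau> \<omega> / (2 * pi)\<rfloor> - \<lceil>\<phi> (a / \<tau>) \<tau> \<omega> / (2 * pi)\<rceil> + 1"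
    unfolding Sch_count_def Sch_def using ab by (intro card_level_crossings) auto
  then show ?thesis by (metis of_int_of_nat_eq)
qed

lemma isCont_of_int_floor:
  fixes f :: "'a::t2_space \<Rightarrow> real"
  assumes "isCont f x" "f x \<notin> \<int>"
  shows "isCont (\<lambda>x. real_of_int \<lfloor>f x\<rfloor>) x"
  using isCont_o2[OF assms(1), of "\<lambda>x. real_of_int \<lfloor>x\<rfloor>"] continuous_floor[OF assms(2)] by (simp add: o_def)

lemma isCont_of_int_ceiling:
  fixes f :: "'a::t2_space \<Rightarrow> real"
  assumes "isCont f x" "f x \<notin> \<int>"
  shows "isCont (\<lambda>x. real_of_int \<lceil>f x\<rceil>) x"
proof -
  have "isCont (\<lambda>x. - real_of_int \<lfloor>- f x\<rfloor>) x"
    using assms by (intro continuous_minus isCont_of_int_floor) (auto simp: minus_in_Ints_iff)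
  then show ?thesis by (simp add: ceiling_def)
qed

lemma divide_two_pi_in_Ints_iff: "x / (2 * pi) \<in> \<int> \<longleftrightarrow> sin (x / 2) = 0"
proof -
  have "x / (2 * pi) = real_of_int i \<longleftrightarrow> x / 2 = real_of_int i * pi" for i
    by (auto simp: field_simps)
  then show ?thesis by (auto simp: sin_zero_iff_int2 Ints_def)
qed

text \<open>The parameters of the two phases differ by \<open>l / \<tau>\<close>, so the error in the characteristic function tends
  to zero.\<close>

lemma phase_pair_converges_in_distribution:
  fixes M :: "'a measure" and F :: "real \<Rightarrow> 'a measure"
    and \<phi> :: "real \<Rightarrow> real \<Rightarrow> 'a \<Rightarrow> real" and N :: "'b measure" and \<xi> :: "nat \<Rightarrow> 'b \<Rightarrow> real"
  assumes pM: "prob_space M" and nz: "noise M F B B2 B3"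
    and fam: "phase_family M F B (complex_brownian B2 B3) \<phi>" and \<tau>: "\<tau> > 0"
    and pN: "prob_space N" and ind: "prob_space.indep_vars N (\<lambda>_. borel) \<xi> {0, 1, 2}"
    and \<xi>: "distributed N lborel (\<xi> 0) (normal_density 0 (sqrt \<tau>))"
      "distributed N lborel (\<xi> 1) (normal_density 0 (sqrt (\<tau> / 2)))"
      "distributed N lborel (\<xi> 2) (normal_density 0 (sqrt (\<tau> / 2)))"
  shows "converges_in_distribution
           M (\<lambda>l \<omega>. (\<phi> 0 \<tau> \<omega>, \<phi> (l / \<tau>) \<tau> \<omega> - l))
           N (\<lambda>\<omega>. (\<xi> 0 \<omega> + \<xi> 1 \<omega>, \<xi> 0 \<omega> + \<xi> 2 \<omega>))
           (at_top :: real filter)"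
proof -
  interpret noise M F B B2 B3 by (rule nz)
  interpret N: prob_space N by (rule pN)
  have sol: "phase_solution M F B W l (\<phi> l)" for l using fam by (simp add: phase_family_def)
  have \<phi>m[measurable]: "\<phi> l \<tau> \<in> borel_measurable M" for l using phase_measurable[OF sol] \<tau> by simp
  have \<xi>m: "\<xi> i \<in> borel_measurable N" if "i \<in> {0, 1, 2}" for i
    using ind that by (auto simp: N.indep_vars_def)
  have [measurable]: "\<xi> 0 \<in> borel_measurable N" "\<xi> 1 \<in> borel_measurable N" "\<xi> 2 \<in> borel_measurable N"
    by (auto intro: \<xi>m)
  have seq: "converges_in_distribution M (\<lambda>n \<omega>. (\<phi> 0 \<tau> \<omega>, \<phi> (L n / \<tau>) \<tau> \<omega> - L n))
      N (\<lambda>\<omega>. (\<xi> 0 \<omega> + \<xi> 1 \<omega>, \<xi> 0 \<omega> + \<xi> 2 \<omega>)) sequentially"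
    if L: "filterlim L at_top sequentially" for L :: "nat \<Rightarrow> real"
  proof (rule joint_levy_continuity[OF pM pN])
    fix a b :: real
    define v where "v = ((a + b)\<^sup>2 + (a\<^sup>2 + b\<^sup>2) / 2) / 2 * \<tau>"
    define c where "c = \<bar>a * b\<bar> / 2"
    define E where "E n = (\<integral>\<omega>. iexp (a * \<phi> 0 \<tau> \<omega> + b * (\<phi> (L n / \<tau>) \<tau> \<omega> - L n)) \<partial>M)" for n
    have "((\<lambda>n. exp v * (c * exp (c * \<tau>)) * (3 * \<tau> * sqrt (pi * \<tau> / L n) + pi * \<tau> / L n)) \<longlonglongrightarrow>
       exp v * (c * exp (c * \<tau>)) * (3 * \<tau> * sqrt 0 + 0))"
      by (intro tendsto_intros tendsto_divide_0[OF tendsto_const filterlim_at_top_imp_at_infinity[OF L]])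
    then have lim0: "(\<lambda>n. exp v * (c * exp (c * \<tau>)) * (3 * \<tau> * sqrt (pi * \<tau> / L n) + pi * \<tau> / L n)) \<longlonglongrightarrow> 0"
      by simp
    have "(\<lambda>n. E n * exp v - 1) \<longlonglongrightarrow> 0"
    proof (rule Lim_null_comparison[OF _ lim0])
      have "\<forall>\<^sub>F n in sequentially. 0 < L n" using L by (simp add: filterlim_at_top_dense)
      then show "\<forall>\<^sub>F n in sequentially. norm (E n * exp v - 1)
          \<le> exp v * (c * exp (c * \<tau>)) * (3 * \<tau> * sqrt (pi * \<tau> / L n) + pi * \<tau> / L n)"
      proof eventually_elim
        case (elim n)
        then have "0 < L n / \<tau>" using \<tau> by simp
        from phase_characteristic_function[OF sol sol this \<tau> v_def c_def] show ?case
          using \<tau> by (simp add: E_def)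
      qed
    qed
    then have "(\<lambda>n. ((E n * exp v - 1) + 1) * exp (- v)) \<longlonglongrightarrow> (0 + 1) * complex_of_real (exp (- v))"
      by (intro tendsto_intros)
    also have "(\<lambda>n. ((E n * exp v - 1) + 1) * exp (- v)) = E"
      by (simp add: mult.assoc flip: of_real_mult exp_add)
    finally have "E \<longlonglongrightarrow> complex_of_real (exp (- v))" by simp
    also have "complex_of_real (exp (- v)) = (\<integral>x. iexp (a * (\<xi> 0 x + \<xi> 1 x) + b * (\<xi> 0 x + \<xi> 2 x)) \<partial>N)"
      unfolding v_def by (rule N.expectation_iexp_shared_normal[OF \<tau> ind \<xi>, symmetric])
    finally show "(\<lambda>n. \<integral>\<omega>. iexp (a * \<phi> 0 \<tau> \<omega> + b * (\<phi> (L n / \<tau>) \<tau> \<omega> - L n)) \<partial>M)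
      \<longlonglongrightarrow> (\<integral>x. iexp (a * (\<xi> 0 x + \<xi> 1 x) + b * (\<xi> 0 x + \<xi> 2 x)) \<partial>N)"
      unfolding E_def .
  qed measurable
  show ?thesis
    unfolding converges_in_distribution_def
  proof (intro conjI allI impI)
    show "(\<lambda>\<omega>. (\<phi> 0 \<tau> \<omega>, \<phi> (l / \<tau>) \<tau> \<omega> - l)) \<in> borel_measurable M" for l
      by (subst borel_prod[symmetric]) measurable
    show "(\<lambda>\<omega>. (\<xi> 0 \<omega> + \<xi> 1 \<omega>, \<xi> 0 \<omega> + \<xi> 2 \<omega>)) \<in> borel_measurable N"
      by (subst borel_prod[symmetric]) measurable
    fix f :: "real \<times> real \<Rightarrow> real" assume f: "continuous_on UNIV f \<and> bounded (range f)"
    show "((\<lambda>l. \<integral>\<omega>. f (\<phi> 0 \<tau> \<omega>, \<phi> (l / \<tau>) \<tau> \<omega> - l) \<partial>M) \<longlongrightarrow> (\<integral>\<omega>. f (\<xi> 0 \<omega> + \<xi> 1 \<omega>, \<xi> 0 \<omega> + \<xi> 2 \<omega>) \<partial>N)) at_top"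
    proof (rule tendsto_at_topI_sequentially)
      fix L :: "nat \<Rightarrow> real" assume "filterlim L at_top sequentially"
      from seq[OF this] f show "(\<lambda>n. \<integral>\<omega>. f (\<phi> 0 \<tau> \<omega>, \<phi> (L n / \<tau>) \<tau> \<omega> - L n) \<partial>M)
        \<longlonglongrightarrow> (\<integral>\<omega>. f (\<xi> 0 \<omega> + \<xi> 1 \<omega>, \<xi> 0 \<omega> + \<xi> 2 \<omega>) \<partial>N)"
        unfolding converges_in_distribution_def by blast
    qed
  qed
qed

theorem theorem13:
  fixes M :: "'a measure" and F :: "real \<Rightarrow> 'a measure"
    and B B2 B3 :: "real \<Rightarrow> 'a \<Rightarrow> real"
    and \<phi> :: "real \<Rightarrow> real \<Rightarrow> 'a \<Rightarrow> real"
    and N :: "'b measure" and \<xi> :: "nat \<Rightarrow> 'b \<Rightarrow> real"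
    and \<tau> :: real
  assumes "prob_space M" and "filtration_on M F"
    and "driving_noise M F B B2 B3"
    and "phase_family M F B (complex_brownian B2 B3) \<phi>"
    and "\<tau> > 0"
    and "prob_space N"
    and "prob_space.indep_vars N (\<lambda>_. borel) \<xi> {0, 1, 2}"
    and "distributed N lborel (\<xi> 0) (normal_density 0 (sqrt \<tau>))"
    and "distributed N lborel (\<xi> 1) (normal_density 0 (sqrt (\<tau> / 2)))"
    and "distributed N lborel (\<xi> 2) (normal_density 0 (sqrt (\<tau> / 2)))"
  shows "converges_in_distribution
           M (\<lambda>l \<omega>. (\<phi> 0 \<tau> \<omega>, \<phi> (l / \<tau>) \<tau> \<omega> - l))
           N (\<lambda>\<omega>. (\<xi> 0 \<omega> + \<xi> 1 \<omega>, \<xi> 0 \<omega> + \<xi> 2 \<omega>))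
           (at_top :: real filter) \<and>
         (\<forall>\<theta>::real. 0 \<le> \<theta> \<and> \<theta> < 2 * pi \<longrightarrow>
           converges_in_distribution
             M (\<lambda>k \<omega>. real (Sch_count \<phi> \<tau> 0 (2 * pi * real_of_int k + \<theta>) \<omega>) - real_of_int k)
             N (\<lambda>\<omega>. real_of_int (\<lfloor>(\<xi> 0 \<omega> + \<xi> 2 \<omega> + \<theta>) / (2 * pi)\<rfloor> - \<lfloor>(\<xi> 0 \<omega> + \<xi> 1 \<omega>) / (2 * pi)\<rfloor>))
             (at_top :: int filter))"
proof (intro conjI allI impI)
  interpret noise M F B B2 B3 using assms(1-3) by (simp add: noise_def noise_axioms_def)
  interpret N: prob_space N by fact
  show joint: "converges_in_distribution M (\<lambda>l \<omega>. (\<phi> 0 \<tau> \<omega>, \<phi> (l / \<tau>) \<tau> \<omega> - l))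
           N (\<lambda>\<omega>. (\<xi> 0 \<omega> + \<xi> 1 \<omega>, \<xi> 0 \<omega> + \<xi> 2 \<omega>)) (at_top :: real filter)"
    by (rule phase_pair_converges_in_distribution[OF assms(1) noise_axioms assms(4-10)])
  have sol: "phase_solution M F B W l (\<phi> l)" for l using assms(4) by (simp add: phase_family_def)
  have \<phi>m[measurable]: "\<phi> l \<tau> \<in> borel_measurable M" for l using phase_measurable[OF sol] assms(5) by simp
  have \<xi>m: "\<xi> i \<in> borel_measurable N" if "i \<in> {0, 1, 2}" for i
    using assms(7) that by (auto simp: N.indep_vars_def)
  have [measurable]: "\<xi> 0 \<in> borel_measurable N" "\<xi> 1 \<in> borel_measurable N" "\<xi> 2 \<in> borel_measurable N"
    by (auto intro: \<xi>m)
  fix \<theta> :: real assume \<theta>: "0 \<le> \<theta> \<and> \<theta> < 2 * pi"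
  \<comment> \<open>The count is a function \<open>g\<close> of the pair of phases, continuous where \<open>s\<close> is not zero.\<close>
  define g where "g z = real_of_int (\<lfloor>(snd z + \<theta>) / (2 * pi)\<rfloor> - \<lceil>fst z / (2 * pi)\<rceil> + 1)"
      for z :: "real \<times> real"
  define s where "s z = \<bar>sin (fst z / 2) * sin ((snd z + \<theta>) / 2)\<bar>" for z :: "real \<times> real"
  define b where "b k = 2 * pi * real_of_int k + \<theta>" for k :: int
  have count: "real (Sch_count \<phi> \<tau> 0 (b k) \<omega>) - real_of_int k = g (\<phi> 0 \<tau> \<omega>, \<phi> (b k / \<tau>) \<tau> \<omega> - b k)"
    if "0 \<le> k" "\<omega> \<in> space M" for k \<omega>
  proof -
    have mono: "strict_mono (\<lambda>l. \<phi> l \<tau> \<omega>)" and cont: "continuous_on UNIV (\<lambda>l. \<phi> l \<tau> \<omega>)"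
      using assms(4,5) that(2) by (auto simp: phase_family_def intro!: real_analytic_imp_continuous)
    have "(\<phi> (b k / \<tau>) \<tau> \<omega> - b k + \<theta>) / (2 * pi) = \<phi> (b k / \<tau>) \<tau> \<omega> / (2 * pi) - real_of_int k"
      by (simp add: b_def field_simps)
    moreover have "0 \<le> b k" using that(1) \<theta> by (simp add: b_def)
    ultimately show ?thesis
      using Sch_count_eq[where \<phi>=\<phi> and \<omega>=\<omega> and a=0 and b="b k", OF mono cont assms(5)] by (simp add: g_def)
  qed
  \<comment> \<open>For negative \<open>k\<close> the interval is empty; this matters only for measurability.\<close>
  have empty: "Sch_count \<phi> \<tau> 0 (b k) \<omega> = 0" if "k < 0" for k \<omega>
  proof -
    have "2 * pi * real_of_int k \<le> 2 * pi * (- 1)" using that by (intro mult_left_mono) auto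
    then have "b k < 0" using \<theta> by (simp add: b_def)
    then show ?thesis by (simp add: Sch_count_def)
  qed
  have gm: "g \<in> borel_measurable borel"
    unfolding g_def[abs_def] borel_prod[symmetric] by measurable
  have "filterlim b at_top at_top"
    unfolding b_def filterlim_at_top
  proof
    fix Z :: real
    show "\<forall>\<^sub>F k in at_top. Z \<le> 2 * pi * real_of_int k + \<theta>"
      using eventually_ge_at_top[of "\<lceil>(Z - \<theta>) / (2 * pi)\<rceil>"]
      by eventually_elim (simp add: ceiling_le_iff field_simps)
  qed
  then have joint_int: "converges_in_distribution M (\<lambda>k \<omega>. (\<phi> 0 \<tau> \<omega>, \<phi> (b k / \<tau>) \<tau> \<omega> - b k))
           N (\<lambda>\<omega>. (\<xi> 0 \<omega> + \<xi> 1 \<omega>, \<xi> 0 \<omega> + \<xi> 2 \<omega>)) (at_top :: int filter)"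
    using joint unfolding converges_in_distribution_def by (auto intro: filterlim_compose)
  have sz: "fst z / (2 * pi) \<notin> \<int> \<and> (snd z + \<theta>) / (2 * pi) \<notin> \<int>" if "s z \<noteq> 0" for z
    using that by (auto simp: s_def divide_two_pi_in_Ints_iff)
  have AE1: "AE \<omega> in N. (\<xi> 0 \<omega> + \<xi> 1 \<omega>) / (2 * pi) \<notin> \<int> \<and> (\<xi> 0 \<omega> + \<xi> 2 \<omega> + \<theta>) / (2 * pi) \<notin> \<int>"
  proof -
    have pos: "0 < sqrt \<tau>" "0 < sqrt (\<tau> / 2)" using assms(5) by auto
    have cnt: "countable ((\<lambda>i. 2 * pi * i - \<theta>') ` \<int>)" for \<theta>' :: real
      by (intro countable_image countable_int)
    have iff: "x / (2 * pi) \<in> \<int> \<longleftrightarrow> x - \<theta>' \<in> (\<lambda>i. 2 * pi * i - \<theta>') ` \<int>" for x \<theta>'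
    proof -
      have "x - \<theta>' \<in> (\<lambda>i. 2 * pi * i - \<theta>') ` \<int> \<longleftrightarrow> (\<exists>i\<in>\<int>. x / (2 * pi) = i)"
        by (auto simp: field_simps)
      then show ?thesis by auto
    qed
    have "AE \<omega> in N. \<xi> 0 \<omega> + \<xi> 1 \<omega> \<notin> (\<lambda>i. 2 * pi * i - 0) ` \<int>"
      using N.indep_normal_sum_distributed[OF assms(7) _ _ _ pos assms(8,9)]
      by (intro N.distributed_lborel_AE_notin_countable cnt) auto
    moreover have "AE \<omega> in N. \<xi> 0 \<omega> + \<xi> 2 \<omega> \<notin> (\<lambda>i. 2 * pi * i - \<theta>) ` \<int>"
      using N.indep_normal_sum_distributed[OF assms(7) _ _ _ pos assms(8,10)]
      by (intro N.distributed_lborel_AE_notin_countable cnt) auto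
    ultimately show ?thesis
    proof eventually_elim
      case (elim \<omega>)
      then show ?case using iff[of "\<xi> 0 \<omega> + \<xi> 1 \<omega>" 0] iff[of "\<xi> 0 \<omega> + \<xi> 2 \<omega> + \<theta>" \<theta>] by simp
    qed
  qed
  have limit: "converges_in_distribution M (\<lambda>k \<omega>. g (\<phi> 0 \<tau> \<omega>, \<phi> (b k / \<tau>) \<tau> \<omega> - b k))
           N (\<lambda>\<omega>. g (\<xi> 0 \<omega> + \<xi> 1 \<omega>, \<xi> 0 \<omega> + \<xi> 2 \<omega>)) (at_top :: int filter)"
  proof (rule continuous_mapping_off_zeros[OF assms(1,6) joint_int gm, of s])
    show "continuous_on UNIV s" unfolding s_def by (intro continuous_intros) auto
    show "0 \<le> s z" for z by (simp add: s_def)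
    show "isCont g z" if "s z \<noteq> 0" for z
      unfolding g_def of_int_add of_int_diff
      using sz[OF that] by (intro continuous_intros isCont_of_int_floor isCont_of_int_ceiling) auto
    show "AE x in N. s (\<xi> 0 x + \<xi> 1 x, \<xi> 0 x + \<xi> 2 x) \<noteq> 0"
      using AE1 by eventually_elim (simp add: s_def divide_two_pi_in_Ints_iff)
  qed
  show "converges_in_distribution
             M (\<lambda>k \<omega>. real (Sch_count \<phi> \<tau> 0 (2 * pi * real_of_int k + \<theta>) \<omega>) - real_of_int k)
             N (\<lambda>\<omega>. real_of_int (\<lfloor>(\<xi> 0 \<omega> + \<xi> 2 \<omega> + \<theta>) / (2 * pi)\<rfloor> - \<lfloor>(\<xi> 0 \<omega> + \<xi> 1 \<omega>) / (2 * pi)\<rfloor>))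
             (at_top :: int filter)"
    unfolding b_def[symmetric]
  proof (rule converges_in_distribution_eventually_cong[OF limit])
    show "(\<lambda>\<omega>. real (Sch_count \<phi> \<tau> 0 (b k) \<omega>) - real_of_int k) \<in> borel_measurable M" for k
    proof (cases "0 \<le> k")
      case True
      have "(\<lambda>\<omega>. g (\<phi> 0 \<tau> \<omega>, \<phi> (b k / \<tau>) \<tau> \<omega> - b k)) \<in> borel_measurable M"
        using limit by (simp add: converges_in_distribution_def)
      then show ?thesis using count[OF True] by (simp cong: measurable_cong)
    qed (simp add: empty)
    show "\<forall>\<^sub>F k in at_top. \<forall>\<omega>\<in>space M. real (Sch_count \<phi> \<tau> 0 (b k) \<omega>) - real_of_int k
        = g (\<phi> 0 \<tau> \<omega>, \<phi> (b k / \<tau>) \<tau> \<omega> - b k)"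
      using eventually_ge_at_top[of "0::int"] by eventually_elim (simp add: count)
    show "(\<lambda>\<omega>. real_of_int (\<lfloor>(\<xi> 0 \<omega> + \<xi> 2 \<omega> + \<theta>) / (2 * pi)\<rfloor> - \<lfloor>(\<xi> 0 \<omega>
        + \<xi> 1 \<omega>) / (2 * pi)\<rfloor>)) \<in> borel_measurable N"
      by measurable
    show "AE \<omega> in N. real_of_int (\<lfloor>(\<xi> 0 \<omega> + \<xi> 2 \<omega> + \<theta>) / (2 * pi)\<rfloor> - \<lfloor>(\<xi> 0 \<omega> + \<xi> 1 \<omega>) / (2 * pi)\<rfloor>)
        = g (\<xi> 0 \<omega> + \<xi> 1 \<omega>, \<xi> 0 \<omega> + \<xi> 2 \<omega>)"
      using AE1
    proof eventually_elim
      case (elim \<omega>)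
      \<comment> \<open>The endpoint \<open>0\<close> is counted, hence the ceiling in \<open>g\<close>; it differs from the floor by one
        almost surely in the limit.\<close>
      then have "\<lceil>(\<xi> 0 \<omega> + \<xi> 1 \<omega>) / (2 * pi)\<rceil> = \<lfloor>(\<xi> 0 \<omega> + \<xi> 1 \<omega>) / (2 * pi)\<rfloor> + 1"
        by (auto simp: ceiling_altdef Ints_def)
      then show ?case by (simp add: g_def)
    qed
  qed
qed

end
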